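(* Let $(A,\Phi)$ be a compact quantum group with Haar measure $h$ and let $(A_0,\Phi)$ be its associated Hopf $^*$-algebra, with antipode $\kappa$. Let $B_0$ be the space of linear functionals on $A$ of the form $x\mapsto h(ax)$ with $a\in A_0$, with the product $(\omega\psi)(x)=(\omega\otimes\psi)\Phi(x)$ and the involution determined by $\omega^*(x)=\overline{\omega(\kappa(x)^* )}$ for $x\in A_0$, and for $\omega\in B_0$ define $\Phi(\omega)$ by $\Phi(\omega)(a\otimes b)=\omega(ab)$ for $a,b\in A_0$. Then $(B_0,\Phi)$ is a discrete quantum group.
   Context: $A\otimes A$ denotes the minimal C$^*$-tensor product, $\odot$ the algebraic tensor product, $\iota$ the identity map. A comultiplication on a unital C$^*$-algebra $A$ is a unital $^*$-homomorphism $\Phi:A\to A\otimes A$ with $(\Phi\otimes\iota)\Phi=(\iota\otimes\Phi)\Phi$. A compact quantum group is a pair $(A,\Phi)$ of a unital C$^*$-algebra $A$ and a comultiplication $\Phi$ such that $\Phi(A)(1\otimes A)$ and $\Phi(A)(A\otimes 1)$ (linear spans of the products) are dense in $A\otimes A$. Its Haar measure is the unique state $h$ on $A$ with $(\iota\otimes h)\Phi(a)=h(a)1=(h\otimes\iota)\Phi(a)$ for all $a\in A$. A finite-dimensional unitary representation is a unitary matrix $(v_{pq})\in M_n(A)$ with $\Phi(v_{pq})=\sum_k v_{pk}\otimes v_{kq}$. $A_0$ is the linear span of the matrix elements $v_{pq}$ of all finite-dimensional unitary representations; it is a dense unital $^*$-subalgebra of $A$, and with the restriction of $\Phi$ it is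 a Hopf $^*$-algebra, with counit $\varepsilon$ and antipode $\kappa$ given on unitary representations by $\varepsilon(v_{pq})=\delta_{pq}$, $\kappa(v_{pq})=(v_{qp})^*$. Let $\{u^\alpha\mid\alpha\in I\}$ be a complete set of mutually inequivalent irreducible unitary representations of $(A,\Phi)$, $u^\alpha=(u^\alpha_{pq})$ of dimension $n(\alpha)$; the elements $u^\alpha_{pq}$ form a basis of $A_0$. The space $B_0$ is spanned by the functionals $\omega^\alpha_{pq}$ with $\omega^\alpha_{pq}(u^\beta_{rs})=\delta_{\alpha\beta}\delta_{pr}\delta_{qs}$, and is identified through these with $\bigoplus_{\alpha\in I}M_{n(\alpha)}(\mathbb C)$ (algebraic direct sum). The multiplier algebra $M(B_0\odot B_0)$ is $\prod_{\alpha,\beta}M_{n(\alpha)}\otimes M_{n(\beta)}$, which is identified with the space of all linear functionals on $A_0\odot A_0$ (extending the pairing of $B_0\odot B_0$ with $A_0\odot A_0$); $\Phi(\omega)$ is viewed as an element of $M(B_0\odot B_0)$ in this way. A discrete quantum group is a pair $(B_0,\Phi)$ where $B_0$ is an (algebraic) direct sum of full matrix algebras over $\mathbb C$, with its usual $^*$-algebra structure, and $\Phi$ is a comultiplication on $B_0$ making $B_0$ into a multiplier Hopf $^*$-algebra. That is: $\Phi:B_0\to M(B_0\odot B_0)$ is a $^*$-homomorphism; $\Phi(x)(1\otimes y)$ and $(x\otimes 1)\Phi(y)$ lie in $B_0\odot B_0$ for all $x,y\in B_0$; $\Phi$ is coassociative, i.e. $(x\otimes1\otimes1)(\Phi\otimes\iota)(\Phi(y)(1\otimes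 z))=(\iota\otimes\Phi)((x\otimes 1)\Phi(y))(1\otimes 1\otimes z)$ for all $x,y,z\in B_0$; and the linear maps $x\otimes y\mapsto\Phi(x)(1\otimes y)$ and $x\otimes y\mapsto(x\otimes1)\Phi(y)$ from $B_0\odot B_0$ to itself are bijective. *)

theory Defs
  imports "HOL-Analysis.Analysis" "HOL-Library.Nonpos_Ints"
begin

section \<open>Unital C*-algebras\<close>

text \<open>The library has neither complex vector spaces nor C*-algebras as type classes. Since
  \<^class>\<open>real_normed_algebra_1\<close> requires norm 1 = 1, the zero algebra is excluded.\<close>

class unital_cstar_algebra = real_normed_algebra_1 + banach +
  fixes scaleC :: "complex \<Rightarrow> 'a \<Rightarrow> 'a" (infixr "*\<^sub>C" 75)
    and star :: "'a \<Rightarrow> 'a"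
  assumes scaleC_add_right: "c *\<^sub>C (x + y) = c *\<^sub>C x + c *\<^sub>C y"
    and scaleC_add_left: "(c + d) *\<^sub>C x = c *\<^sub>C x + d *\<^sub>C x"
    and scaleC_scaleC: "c *\<^sub>C d *\<^sub>C x = (c * d) *\<^sub>C x"
    and scaleR_scaleC: "scaleR r x = complex_of_real r *\<^sub>C x"
    and mult_scaleC_left: "(c *\<^sub>C x) * y = c *\<^sub>C (x * y)"
    and mult_scaleC_right: "x * (c *\<^sub>C y) = c *\<^sub>C (x * y)"
    and norm_scaleC: "norm (c *\<^sub>C x) = cmod c * norm x"
    and star_add: "star (x + y) = star x + star y"
    and star_scaleC: "star (c *\<^sub>C x) = cnj c *\<^sub>C star x"
    and star_mult: "star (x * y) = star y * star x"
    and star_star: "star (star x) = x"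
    and cstar_identity: "norm (star x * x) = (norm x)\<^sup>2"

instantiation complex :: unital_cstar_algebra
begin

definition scaleC_complex :: "complex \<Rightarrow> complex \<Rightarrow> complex"
  where "scaleC_complex c z = c * z"

definition star_complex :: "complex \<Rightarrow> complex"
  where "star_complex z = cnj z"

instance
  by standard
    (auto simp: scaleC_complex_def star_complex_def algebra_simps scaleR_conv_of_real
       norm_mult power2_eq_square)

end

global_interpretation cvec: vector_space
  "scaleC :: complex \<Rightarrow> 'a \<Rightarrow> 'a::unital_cstar_algebra"
  defines cspan = cvec.span
    and cdependent = cvec.dependent
proof
  fix x :: 'a
  show "1 *\<^sub>C x = x"
    using scaleR_scaleC[of 1 x] by simp
qed (simp_all add: scaleC_add_right scaleC_add_left scaleC_scaleC)

definition clinear :: "('a::unital_cstar_algebra \<Rightarrow> 'b::unital_cstar_algebra) \<Rightarrow> bool"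
  where "clinear f \<longleftrightarrow> Vector_Spaces.linear scaleC scaleC f"

definition unital_star_hom :: "('a::unital_cstar_algebra \<Rightarrow> 'b::unital_cstar_algebra) \<Rightarrow> bool"
  where "unital_star_hom f \<longleftrightarrow> clinear f \<and> f 1 = 1 \<and>
    (\<forall>x y. f (x * y) = f x * f y) \<and> (\<forall>x. f (star x) = star (f x))"

definition state :: "('a::unital_cstar_algebra \<Rightarrow> complex) \<Rightarrow> bool"
  where "state h \<longleftrightarrow> clinear h \<and> (\<forall>x. h (star x * x) \<in> \<real>\<^sub>\<ge>\<^sub>0) \<and> h 1 = 1"


section \<open>Minimal C*-tensor products\<close>

definition cstar_norm_on :: "'a::unital_cstar_algebra set \<Rightarrow> ('a \<Rightarrow> real) \<Rightarrow> bool"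
  where "cstar_norm_on S p \<longleftrightarrow>
    (\<forall>x\<in>S. 0 \<le> p x \<and> (p x = 0 \<longleftrightarrow> x = 0)) \<and>
    (\<forall>x\<in>S. \<forall>c. p (c *\<^sub>C x) = cmod c * p x) \<and>
    (\<forall>x\<in>S. \<forall>y\<in>S. p (x + y) \<le> p x + p y) \<and>
    (\<forall>x\<in>S. \<forall>y\<in>S. p (x * y) \<le> p x * p y) \<and>
    (\<forall>x\<in>S. p (star x * x) = (p x)\<^sup>2)"

definition elementary_span ::
    "('a::unital_cstar_algebra \<Rightarrow> 'b::unital_cstar_algebra \<Rightarrow> 't::unital_cstar_algebra) \<Rightarrow> 't set"
  where "elementary_span ten = cspan {ten a b |a b. True}"

text \<open>\<^term>\<open>ten\<close> exhibits the C*-algebra \<open>'t\<close> as the minimal tensor product of \<open>'a\<close> and \<open>'b\<close>: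
  the span of the elements \<^term>\<open>ten a b\<close> is a copy of the algebraic tensor product (the condition
  on independent sets says that no nonzero algebraic tensor is sent to 0), it is dense, and
  the norm is the least C*-norm on it. This determines \<open>'t\<close> up to isomorphism.\<close>

definition min_tensor_product ::
    "('a::unital_cstar_algebra \<Rightarrow> 'b::unital_cstar_algebra \<Rightarrow> 't::unital_cstar_algebra) \<Rightarrow> bool"
  where "min_tensor_product ten \<longleftrightarrow>
    (\<forall>a. clinear (ten a)) \<and> (\<forall>b. clinear (\<lambda>a. ten a b)) \<and>
    (\<forall>a b a' b'. ten a b * ten a' b' = ten (a * a') (b * b')) \<and>
    (\<forall>a b. star (ten a b) = ten (star a) (star b)) \<and>
    (\<forall>S f. finite S \<and> \<not> cdependent S \<and> (\<Sum>a\<in>S. ten a (f a)) = 0 \<longrightarrow> (\<forall>a\<in>S. f a = 0)) \<and>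
    closure (elementary_span ten) = UNIV \<and>
    (\<forall>p. cstar_norm_on (elementary_span ten) p \<longrightarrow> (\<forall>x\<in>elementary_span ten. norm x \<le> p x))"

text \<open>\<^term>\<open>F\<close> is the bounded linear map \<open>f \<otimes> g\<close>. If \<^term>\<open>ten\<close> is a minimal tensor product there is at
  most one such map, and for minimal tensor products of *-homomorphisms, slice maps and product
  functionals it always exists, so the existential quantifiers over such maps below impose nothing. Taking for \<^term>\<open>ten'\<close> a scalar multiplication gives slice maps, taking the
  multiplication of \<open>complex\<close> gives product functionals.\<close>

definition is_tensor_map ::
    "('a::unital_cstar_algebra \<Rightarrow> 'b::unital_cstar_algebra \<Rightarrow> 't::unital_cstar_algebra) \<Rightarrow>
     ('c \<Rightarrow> 'd \<Rightarrow> 's::unital_cstar_algebra) \<Rightarrow> ('a \<Rightarrow> 'c) \<Rightarrow> ('b \<Rightarrow> 'd) \<Rightarrow> ('t \<Rightarrow> 's) \<Rightarrow> bool"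
  where "is_tensor_map ten ten' f g F \<longleftrightarrow>
    clinear F \<and> bounded_linear F \<and> (\<forall>a b. F (ten a b) = ten' (f a) (g b))"

definition tensor_functional ::
    "('a::unital_cstar_algebra \<Rightarrow> 'a \<Rightarrow> 't::unital_cstar_algebra) \<Rightarrow>
     ('a \<Rightarrow> complex) \<Rightarrow> ('a \<Rightarrow> complex) \<Rightarrow> 't \<Rightarrow> complex"
  where "tensor_functional ten \<omega> \<psi> = (THE F. is_tensor_map ten (*) \<omega> \<psi> F)"

text \<open>\<open>'t\<close> is \<open>A \<otimes> A\<close>, and \<open>'w\<close> is \<open>A \<otimes> A \<otimes> A\<close>, bracketed as \<open>(A \<otimes> A) \<otimes> A\<close> through \<^term>\<open>tenl\<close>
  and as \<open>A \<otimes> (A \<otimes> A)\<close> through \<^term>\<open>tenr\<close>.\<close>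

definition min_tensor_powers ::
    "('a::unital_cstar_algebra \<Rightarrow> 'a \<Rightarrow> 't::unital_cstar_algebra) \<Rightarrow>
     ('t \<Rightarrow> 'a \<Rightarrow> 'w::unital_cstar_algebra) \<Rightarrow> ('a \<Rightarrow> 't \<Rightarrow> 'w) \<Rightarrow> bool"
  where "min_tensor_powers ten tenl tenr \<longleftrightarrow>
    min_tensor_product ten \<and> min_tensor_product tenl \<and> min_tensor_product tenr \<and>
    (\<forall>a b c. tenl (ten a b) c = tenr a (ten b c))"


section \<open>Compact quantum groups\<close>

definition comultiplication ::
    "('a::unital_cstar_algebra \<Rightarrow> 'a \<Rightarrow> 't::unital_cstar_algebra) \<Rightarrow>
     ('t \<Rightarrow> 'a \<Rightarrow> 'w::unital_cstar_algebra) \<Rightarrow> ('a \<Rightarrow> 't \<Rightarrow> 'w) \<Rightarrow> ('a \<Rightarrow> 't) \<Rightarrow> bool"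
  where "comultiplication ten tenl tenr \<Phi> \<longleftrightarrow> unital_star_hom \<Phi> \<and>
    (\<exists>F G. is_tensor_map ten tenl \<Phi> id F \<and> is_tensor_map ten tenr id \<Phi> G \<and>
       (\<forall>a. F (\<Phi> a) = G (\<Phi> a)))"

definition compact_quantum_group ::
    "('a::unital_cstar_algebra \<Rightarrow> 'a \<Rightarrow> 't::unital_cstar_algebra) \<Rightarrow>
     ('t \<Rightarrow> 'a \<Rightarrow> 'w::unital_cstar_algebra) \<Rightarrow> ('a \<Rightarrow> 't \<Rightarrow> 'w) \<Rightarrow> ('a \<Rightarrow> 't) \<Rightarrow> bool"
  where "compact_quantum_group ten tenl tenr \<Phi> \<longleftrightarrow>
    min_tensor_powers ten tenl tenr \<and> comultiplication ten tenl tenr \<Phi> \<and>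
    closure (cspan {\<Phi> a * ten 1 b |a b. True}) = UNIV \<and>
    closure (cspan {\<Phi> a * ten b 1 |a b. True}) = UNIV"

definition haar_measure ::
    "('a::unital_cstar_algebra \<Rightarrow> 'a \<Rightarrow> 't::unital_cstar_algebra) \<Rightarrow> ('a \<Rightarrow> 't) \<Rightarrow>
     ('a \<Rightarrow> complex) \<Rightarrow> bool"
  where "haar_measure ten \<Phi> h \<longleftrightarrow> state h \<and>
    (\<exists>L R. is_tensor_map ten (\<lambda>a z. z *\<^sub>C a) id h L \<and> is_tensor_map ten (\<lambda>z a. z *\<^sub>C a) h id R \<and>
       (\<forall>a. L (\<Phi> a) = h a *\<^sub>C 1 \<and> R (\<Phi> a) = h a *\<^sub>C 1))"

text \<open>An \<open>m \<times> m\<close> matrix over \<open>A\<close> or over \<open>complex\<close> is a function of two indices, of which only the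
  values at indices below \<open>m\<close> are relevant.\<close>

definition unitary_rep ::
    "('a::unital_cstar_algebra \<Rightarrow> 'a \<Rightarrow> 't::unital_cstar_algebra) \<Rightarrow> ('a \<Rightarrow> 't) \<Rightarrow>
     nat \<Rightarrow> (nat \<Rightarrow> nat \<Rightarrow> 'a) \<Rightarrow> bool"
  where "unitary_rep ten \<Phi> m v \<longleftrightarrow>
    (\<forall>p<m. \<forall>q<m. \<Phi> (v p q) = (\<Sum>k<m. ten (v p k) (v k q))) \<and>
    (\<forall>p<m. \<forall>q<m. (\<Sum>k<m. star (v k p) * v k q) = (if p = q then 1 else 0)) \<and>
    (\<forall>p<m. \<forall>q<m. (\<Sum>k<m. v p k * star (v q k)) = (if p = q then 1 else 0))"

text \<open>There is no nontrivial invariant subspace: an orthogonal projection \<open>e\<close> with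
  \<open>(e \<otimes> 1) v (e \<otimes> 1) = v (e \<otimes> 1)\<close> is 0 or 1.\<close>

definition irreducible_rep ::
    "('a::unital_cstar_algebra \<Rightarrow> 'a \<Rightarrow> 't::unital_cstar_algebra) \<Rightarrow> ('a \<Rightarrow> 't) \<Rightarrow>
     nat \<Rightarrow> (nat \<Rightarrow> nat \<Rightarrow> 'a) \<Rightarrow> bool"
  where "irreducible_rep ten \<Phi> m v \<longleftrightarrow> 0 < m \<and> unitary_rep ten \<Phi> m v \<and>
    (\<forall>e :: nat \<Rightarrow> nat \<Rightarrow> complex.
      (\<forall>p<m. \<forall>q<m. cnj (e q p) = e p q \<and> (\<Sum>k<m. e p k * e k q) = e p q) \<and>
      (\<forall>p<m. \<forall>q<m. (\<Sum>k<m. \<Sum>l<m. (e p k * e l q) *\<^sub>C v k l) = (\<Sum>l<m. e l q *\<^sub>C v p l)) \<longrightarrow>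
      (\<forall>p<m. \<forall>q<m. e p q = 0) \<or> (\<forall>p<m. \<forall>q<m. e p q = (if p = q then 1 else 0)))"

definition equivalent_reps ::
    "nat \<Rightarrow> (nat \<Rightarrow> nat \<Rightarrow> 'a::unital_cstar_algebra) \<Rightarrow> nat \<Rightarrow> (nat \<Rightarrow> nat \<Rightarrow> 'a) \<Rightarrow> bool"
  where "equivalent_reps m v m' w \<longleftrightarrow> m = m' \<and>
    (\<exists>s t :: nat \<Rightarrow> nat \<Rightarrow> complex.
      (\<forall>p<m. \<forall>q<m. (\<Sum>k<m. s p k * t k q) = (if p = q then 1 else 0) \<and>
                     (\<Sum>k<m. t p k * s k q) = (if p = q then 1 else 0)) \<and>
      (\<forall>p<m. \<forall>q<m. (\<Sum>k<m. s p k *\<^sub>C v k q) = (\<Sum>k<m. s k q *\<^sub>C w p k)))"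

definition complete_irreps ::
    "('a::unital_cstar_algebra \<Rightarrow> 'a \<Rightarrow> 't::unital_cstar_algebra) \<Rightarrow> ('a \<Rightarrow> 't) \<Rightarrow>
     'i set \<Rightarrow> ('i \<Rightarrow> nat) \<Rightarrow> ('i \<Rightarrow> nat \<Rightarrow> nat \<Rightarrow> 'a) \<Rightarrow> bool"
  where "complete_irreps ten \<Phi> I n u \<longleftrightarrow>
    (\<forall>\<alpha>\<in>I. irreducible_rep ten \<Phi> (n \<alpha>) (u \<alpha>)) \<and>
    (\<forall>\<alpha>\<in>I. \<forall>\<beta>\<in>I. \<alpha> \<noteq> \<beta> \<longrightarrow> \<not> equivalent_reps (n \<alpha>) (u \<alpha>) (n \<beta>) (u \<beta>)) \<and>
    (\<forall>m v. irreducible_rep ten \<Phi> m v \<longrightarrow> (\<exists>\<alpha>\<in>I. equivalent_reps m v (n \<alpha>) (u \<alpha>)))"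

definition hopf_algebra_of ::
    "('a::unital_cstar_algebra \<Rightarrow> 'a \<Rightarrow> 't::unital_cstar_algebra) \<Rightarrow> ('a \<Rightarrow> 't) \<Rightarrow> 'a set"
  where "hopf_algebra_of ten \<Phi> = cspan {v p q |m v p q. unitary_rep ten \<Phi> m v \<and> p < m \<and> q < m}"

text \<open>The values of \<^term>\<open>\<kappa>\<close> outside the Hopf *-algebra are irrelevant.\<close>

definition antipode ::
    "('a::unital_cstar_algebra \<Rightarrow> 'a \<Rightarrow> 't::unital_cstar_algebra) \<Rightarrow> ('a \<Rightarrow> 't) \<Rightarrow>
     ('a \<Rightarrow> 'a) \<Rightarrow> bool"
  where "antipode ten \<Phi> \<kappa> \<longleftrightarrow>
    (\<forall>x\<in>hopf_algebra_of ten \<Phi>. \<forall>y\<in>hopf_algebra_of ten \<Phi>. \<kappa> (x + y) = \<kappa> x + \<kappa> y) \<and>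
    (\<forall>c. \<forall>x\<in>hopf_algebra_of ten \<Phi>. \<kappa> (c *\<^sub>C x) = c *\<^sub>C \<kappa> x) \<and>
    (\<forall>m v. unitary_rep ten \<Phi> m v \<longrightarrow> (\<forall>p<m. \<forall>q<m. \<kappa> (v p q) = star (v q p)))"


section \<open>The dual *-algebra of functionals\<close>

definition dual_space ::
    "('a::unital_cstar_algebra \<Rightarrow> 'a \<Rightarrow> 't::unital_cstar_algebra) \<Rightarrow> ('a \<Rightarrow> 't) \<Rightarrow>
     ('a \<Rightarrow> complex) \<Rightarrow> ('a \<Rightarrow> complex) set"
  where "dual_space ten \<Phi> h = {(\<lambda>x. h (a * x)) |a. a \<in> hopf_algebra_of ten \<Phi>}"

definition dual_mult ::
    "('a::unital_cstar_algebra \<Rightarrow> 'a \<Rightarrow> 't::unital_cstar_algebra) \<Rightarrow> ('a \<Rightarrow> 't) \<Rightarrow>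
     ('a \<Rightarrow> complex) \<Rightarrow> ('a \<Rightarrow> complex) \<Rightarrow> 'a \<Rightarrow> complex"
  where "dual_mult ten \<Phi> \<omega> \<psi> = (\<lambda>x. tensor_functional ten \<omega> \<psi> (\<Phi> x))"

definition dual_star ::
    "('a::unital_cstar_algebra \<Rightarrow> 'a \<Rightarrow> 't::unital_cstar_algebra) \<Rightarrow> ('a \<Rightarrow> 't) \<Rightarrow>
     ('a \<Rightarrow> complex) \<Rightarrow> ('a \<Rightarrow> 'a) \<Rightarrow> ('a \<Rightarrow> complex) \<Rightarrow> 'a \<Rightarrow> complex"
  where "dual_star ten \<Phi> h \<kappa> \<omega> = (THE \<psi>. \<psi> \<in> dual_space ten \<Phi> h \<and>
    (\<forall>x\<in>hopf_algebra_of ten \<Phi>. \<psi> x = cnj (\<omega> (star (\<kappa> x)))))"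

text \<open>\<open>\<Phi>(\<omega>)\<close>, a linear functional on the algebraic tensor square of the Hopf *-algebra,
  as the corresponding bilinear form.\<close>

definition dual_comult :: "('a::unital_cstar_algebra \<Rightarrow> complex) \<Rightarrow> 'a \<Rightarrow> 'a \<Rightarrow> complex"
  where "dual_comult \<omega> = (\<lambda>a b. \<omega> (a * b))"


section \<open>Direct sums and products of full matrix algebras\<close>

text \<open>A family of matrices, the \<open>k\<close>-th one having rows and columns indexed by the finite set
  \<^term>\<open>J k\<close>, with \<open>k\<close> ranging over \<^term>\<open>K\<close>; entries outside these ranges are 0.\<close>

type_synonym ('k, 'r) matrices = "'k \<Rightarrow> 'r \<Rightarrow> 'r \<Rightarrow> complex"

definition mat_prod :: "'k set \<Rightarrow> ('k \<Rightarrow> 'r set) \<Rightarrow> ('k, 'r) matrices set"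
  where "mat_prod K J = {x. \<forall>k i j. x k i j \<noteq> 0 \<longrightarrow> k \<in> K \<and> i \<in> J k \<and> j \<in> J k}"

definition mat_sum :: "'k set \<Rightarrow> ('k \<Rightarrow> 'r set) \<Rightarrow> ('k, 'r) matrices set"
  where "mat_sum K J = {x \<in> mat_prod K J. finite {k. x k \<noteq> (\<lambda>i j. 0)}}"

definition mat_add :: "('k, 'r) matrices \<Rightarrow> ('k, 'r) matrices \<Rightarrow> ('k, 'r) matrices"
  where "mat_add x y = (\<lambda>k i j. x k i j + y k i j)"

definition mat_scale :: "complex \<Rightarrow> ('k, 'r) matrices \<Rightarrow> ('k, 'r) matrices"
  where "mat_scale c x = (\<lambda>k i j. c * x k i j)"

definition mat_mult ::
    "('k \<Rightarrow> 'r set) \<Rightarrow> ('k, 'r) matrices \<Rightarrow> ('k, 'r) matrices \<Rightarrow> ('k, 'r) matrices"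
  where "mat_mult J x y = (\<lambda>k i j. \<Sum>l\<in>J k. x k i l * y k l j)"

definition mat_star :: "('k, 'r) matrices \<Rightarrow> ('k, 'r) matrices"
  where "mat_star x = (\<lambda>k i j. cnj (x k j i))"

definition mat_one :: "'k set \<Rightarrow> ('k \<Rightarrow> 'r set) \<Rightarrow> ('k, 'r) matrices"
  where "mat_one K J = (\<lambda>k i j. if k \<in> K \<and> i \<in> J k \<and> i = j then 1 else 0)"

definition mat_unit :: "'k \<Rightarrow> 'r \<Rightarrow> 'r \<Rightarrow> ('k, 'r) matrices"
  where "mat_unit k i j = (\<lambda>k' i' j'. if k' = k \<and> i' = i \<and> j' = j then 1 else 0)"

text \<open>With \<open>B = mat_sum K J\<close> and \<open>C = mat_sum K' J'\<close>, the algebraic tensor product of \<open>B\<close> and \<open>C\<close> is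
  \<open>mat_sum (K \<times> K') (ind_tensor J J')\<close>, and the multiplier algebra of the latter is
  \<open>mat_prod (K \<times> K') (ind_tensor J J')\<close>.\<close>

definition ind_tensor :: "('k \<Rightarrow> 'r set) \<Rightarrow> ('l \<Rightarrow> 's set) \<Rightarrow> 'k \<times> 'l \<Rightarrow> ('r \<times> 's) set"
  where "ind_tensor J J' = (\<lambda>(k, l). J k \<times> J' l)"

definition mat_tensor ::
    "('k, 'r) matrices \<Rightarrow> ('l, 's) matrices \<Rightarrow> ('k \<times> 'l, 'r \<times> 's) matrices"
  where "mat_tensor x y = (\<lambda>(k, l) (i, i') (j, j'). x k i j * y l i' j')"

definition mat_assoc ::
    "(('k \<times> 'l) \<times> 'm, ('r \<times> 's) \<times> 't) matrices \<Rightarrow> ('k \<times> 'l \<times> 'm, 'r \<times> 's \<times> 't) matrices"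
  where "mat_assoc x = (\<lambda>(k, l, m) (i, i', i'') (j, j', j''). x ((k, l), m) ((i, i'), i'') ((j, j'), j''))"

text \<open>The linear extension, to the algebraic tensor product, of the bilinear map \<^term>\<open>f\<close>.\<close>

definition tensor_lift ::
    "(('k, 'r) matrices \<Rightarrow> ('l, 's) matrices \<Rightarrow> ('m, 't) matrices) \<Rightarrow>
     ('k \<times> 'l, 'r \<times> 's) matrices \<Rightarrow> ('m, 't) matrices"
  where "tensor_lift f x = (\<lambda>m a b.
    \<Sum>((k, l), (i, i'), (j, j')) \<in> {(kl, ii, jj). x kl ii jj \<noteq> 0}.
      x (k, l) (i, i') (j, j') * f (mat_unit k i j) (mat_unit l i' j') m a b)"


section \<open>Discrete quantum groups\<close>

definition discrete_quantum_group ::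
    "'i set \<Rightarrow> ('i \<Rightarrow> nat) \<Rightarrow>
     (('i, nat) matrices \<Rightarrow> ('i \<times> 'i, nat \<times> nat) matrices) \<Rightarrow> bool"
  where "discrete_quantum_group I n \<Delta> \<longleftrightarrow>
   (let J = (\<lambda>\<alpha>. {..<n \<alpha>}); J2 = ind_tensor J J; J3 = ind_tensor J J2;
        B = mat_sum I J; BB = mat_sum (I \<times> I) J2; MBB = mat_prod (I \<times> I) J2;
        one = mat_one I J; one2 = mat_one (I \<times> I) J2
    in (\<forall>\<alpha>\<in>I. 0 < n \<alpha>) \<and>
       (\<forall>x\<in>B. \<Delta> x \<in> MBB) \<and>
       (\<forall>x\<in>B. \<forall>y\<in>B. \<Delta> (mat_add x y) = mat_add (\<Delta> x) (\<Delta> y)) \<and>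
       (\<forall>c. \<forall>x\<in>B. \<Delta> (mat_scale c x) = mat_scale c (\<Delta> x)) \<and>
       (\<forall>x\<in>B. \<forall>y\<in>B. \<Delta> (mat_mult J x y) = mat_mult J2 (\<Delta> x) (\<Delta> y)) \<and>
       (\<forall>x\<in>B. \<Delta> (mat_star x) = mat_star (\<Delta> x)) \<and>
       (\<forall>x\<in>B. \<forall>y\<in>B. mat_mult J2 (\<Delta> x) (mat_tensor one y) \<in> BB \<and>
                      mat_mult J2 (mat_tensor x one) (\<Delta> y) \<in> BB) \<and>
       (\<forall>x\<in>B. \<forall>y\<in>B. \<forall>z\<in>B.
          mat_mult J3 (mat_tensor x one2)
            (tensor_lift (\<lambda>a b. mat_assoc (mat_tensor (\<Delta> a) b))
              (mat_mult J2 (\<Delta> y) (mat_tensor one z))) =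
          mat_mult J3
            (tensor_lift (\<lambda>a b. mat_tensor a (\<Delta> b)) (mat_mult J2 (mat_tensor x one) (\<Delta> y)))
            (mat_tensor one (mat_tensor one z))) \<and>
       bij_betw (tensor_lift (\<lambda>x y. mat_mult J2 (\<Delta> x) (mat_tensor one y))) BB BB \<and>
       bij_betw (tensor_lift (\<lambda>x y. mat_mult J2 (mat_tensor x one) (\<Delta> y))) BB BB)"

text \<open>A set \<^term>\<open>B\<close> of functionals, with pointwise vector space operations, product \<^term>\<open>prd\<close> and
  involution \<^term>\<open>invol\<close>, is closed under these operations and \<^term>\<open>\<theta>\<close> maps it *-isomorphically
  onto a direct sum of full matrix algebras.\<close>

definition star_isomorphism ::
    "('a \<Rightarrow> complex) set \<Rightarrow> (('a \<Rightarrow> complex) \<Rightarrow> ('a \<Rightarrow> complex) \<Rightarrow> 'a \<Rightarrow> complex) \<Rightarrow>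
     (('a \<Rightarrow> complex) \<Rightarrow> 'a \<Rightarrow> complex) \<Rightarrow> 'i set \<Rightarrow> ('i \<Rightarrow> nat) \<Rightarrow>
     (('a \<Rightarrow> complex) \<Rightarrow> ('i, nat) matrices) \<Rightarrow> bool"
  where "star_isomorphism B prd invol I n \<theta> \<longleftrightarrow>
   (let J = (\<lambda>\<alpha>. {..<n \<alpha>})
    in bij_betw \<theta> B (mat_sum I J) \<and>
       (\<forall>\<omega>\<in>B. \<forall>\<psi>\<in>B. (\<lambda>x. \<omega> x + \<psi> x) \<in> B \<and> \<theta> (\<lambda>x. \<omega> x + \<psi> x) = mat_add (\<theta> \<omega>) (\<theta> \<psi>)) \<and>
       (\<forall>c. \<forall>\<omega>\<in>B. (\<lambda>x. c * \<omega> x) \<in> B \<and> \<theta> (\<lambda>x. c * \<omega> x) = mat_scale c (\<theta> \<omega>)) \<and>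
       (\<forall>\<omega>\<in>B. \<forall>\<psi>\<in>B. prd \<omega> \<psi> \<in> B \<and> \<theta> (prd \<omega> \<psi>) = mat_mult J (\<theta> \<omega>) (\<theta> \<psi>)) \<and>
       (\<forall>\<omega>\<in>B. invol \<omega> \<in> B \<and> \<theta> (invol \<omega>) = mat_star (\<theta> \<omega>)))"

text \<open>The coefficients of a functional with respect to the functionals \<open>\<omega>\<^sup>\<alpha>\<^sub>p\<^sub>q\<close> dual to the
  elements \<^term>\<open>u \<alpha> p q\<close>, which correspond to the matrix units; and the coefficients of a bilinear
  form with respect to the products of these functionals.\<close>

definition dual_coords ::
    "'i set \<Rightarrow> ('i \<Rightarrow> nat) \<Rightarrow> ('i \<Rightarrow> nat \<Rightarrow> nat \<Rightarrow> 'a) \<Rightarrow> ('a \<Rightarrow> complex) \<Rightarrow> ('i, nat) matrices"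
  where "dual_coords I n u \<omega> =
    (\<lambda>\<alpha> p q. if \<alpha> \<in> I \<and> p < n \<alpha> \<and> q < n \<alpha> then \<omega> (u \<alpha> p q) else 0)"

definition dual_coords2 ::
    "'i set \<Rightarrow> ('i \<Rightarrow> nat) \<Rightarrow> ('i \<Rightarrow> nat \<Rightarrow> nat \<Rightarrow> 'a) \<Rightarrow> ('a \<Rightarrow> 'a \<Rightarrow> complex) \<Rightarrow>
     ('i \<times> 'i, nat \<times> nat) matrices"
  where "dual_coords2 I n u F =
    (\<lambda>(\<alpha>, \<beta>) (p, r) (q, s).
       if \<alpha> \<in> I \<and> \<beta> \<in> I \<and> p < n \<alpha> \<and> q < n \<alpha> \<and> r < n \<beta> \<and> s < n \<beta>
       then F (u \<alpha> p q) (u \<beta> r s) else 0)"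

end

theory Submission
  imports Defs "Jordan_Normal_Form.Schur_Decomposition"
begin

text \<open>For a unitary representation \<open>v\<close> let \<open>Y x\<close> be the matrix \<open>(h (x * v p q))\<close>. The density of
  \<open>\<Phi>(A)(1 \<otimes> A)\<close> shows that the matrices \<open>Y x\<close> form a nondegenerate *-algebra. Hence invariant
  subspaces have invariant complements, and the matrices \<open>Q\<close> and \<open>Q'\<close> in the orthogonality relations
  \<open>h (star u\<^sub>p\<^sub>q u\<^sub>r\<^sub>s) = Q\<^sub>p\<^sub>r \<delta>\<^sub>q\<^sub>s\<close> and \<open>h (u\<^sub>p\<^sub>q star u\<^sub>r\<^sub>s) = Q'\<^sub>q\<^sub>s \<delta>\<^sub>p\<^sub>r\<close> are positive definite. Invariance of \<open>h\<close>
  then makes the conjugate of an irreducible representation equivalent to a unitary one, so \<open>A\<^sub>0\<close>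
  is a *-algebra spanned by the \<open>u\<^sup>\<alpha>\<^sub>p\<^sub>q\<close>, and both \<open>h (a \<cdot>)\<close> and \<open>h (\<cdot> a)\<close>, \<open>a \<in> A\<^sub>0\<close>, run through all
  functionals on \<open>A\<^sub>0\<close> that vanish on all but finitely many blocks. The axioms of a discrete
  quantum group are dual to those of the Hopf *-algebra \<open>A\<^sub>0\<close>, once functionals \<open>\<omega> (a \<cdot> b)\<close> are seen to
  be finitely supported, which the equality of these two sets of functionals provides.\<close>

text \<open>The Haar state need not be faithful. Two facts take the place of faithfulness. By
  Cauchy-Schwarz a null vector is invisible to \<open>h\<close> under multiplication, and the values
  \<open>h (x * v p q)\<close> suffice for many conclusions because \<open>x\<close> may be chosen
  as \<open>star (v p r)\<close>, where unitarity collapses the sum over p. The first obstacle is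
  that unitarity alone does not make the complement of an invariant subspace invariant: the adjoint
  of (1 - E) v E = 0 constrains the entries of the adjoint matrix, not those of v. The second is
  that the entrywise conjugate of a unitary representation is a priori not known to be invertible;
  the two invariance properties of \<open>h\<close> supply a left and a right inverse. The dual is
  treated in coordinates. An element x of the direct sum is turned into a functional
  \<open>W x\<close>, an element of the algebraic tensor product is described by its slices, and
  each axiom becomes an identity between values of \<open>W\<close> on products of matrix
  elements.\<close>

lemma clinear_iff:
  fixes f :: "'a::unital_cstar_algebra \<Rightarrow> 'b::unital_cstar_algebra"
  shows "clinear f \<longleftrightarrow> (\<forall>x y. f (x + y) = f x + f y) \<and> (\<forall>c x. f (c *\<^sub>C x) = c *\<^sub>C f x)"
  unfolding clinear_def Vector_Spaces.linear_iff
  using cvec.vector_space_axioms[where 'a='a] cvec.vector_space_axioms[where 'a='b] by auto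

lemma clinear_add: "clinear f \<Longrightarrow> f (x + y) = f x + f y"
  and clinear_scaleC: "clinear f \<Longrightarrow> f (c *\<^sub>C x) = c *\<^sub>C f x"
  by (simp_all add: clinear_iff)

lemma scaleC_complex [simp]: "c *\<^sub>C (z::complex) = c * z"
  by (simp add: scaleC_complex_def)

lemma star_complex [simp]: "star (z::complex) = cnj z"
  by (simp add: star_complex_def)

lemma clinear_zero: "clinear f \<Longrightarrow> f 0 = 0"
  by (metis clinear_add add_cancel_right_right)

lemma clinear_minus: "clinear f \<Longrightarrow> f (- x) = - f x"
  using clinear_add[of f x "- x"] by (simp add: clinear_zero eq_neg_iff_add_eq_0 add.commute)

lemma clinear_diff: "clinear f \<Longrightarrow> f (x - y) = f x - f y"
  using clinear_add[of f x "- y"] by (simp add: clinear_minus)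

lemma clinear_sum: "clinear f \<Longrightarrow> f (\<Sum>i\<in>A. g i) = (\<Sum>i\<in>A. f (g i))"
  by (induction A rule: infinite_finite_induct) (simp_all add: clinear_zero clinear_add)

lemma clinear_comp: "clinear f \<Longrightarrow> clinear g \<Longrightarrow> clinear (\<lambda>x. f (g x))"
  by (simp add: clinear_iff)

lemma clinear_mult_left: "clinear f \<Longrightarrow> clinear (\<lambda>x. f (a * x))"
  and clinear_mult_right: "clinear f \<Longrightarrow> clinear (\<lambda>x. f (x * a))"
  by (simp_all add: clinear_iff distrib_left distrib_right mult_scaleC_left mult_scaleC_right)

lemma star_zero [simp]: "star 0 = 0"
  by (metis add_cancel_right_right star_add)

lemma star_one [simp]: "star 1 = 1"
  by (metis mult.left_neutral mult.right_neutral star_mult star_star)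

lemma star_sum: "star (\<Sum>i\<in>A. g i) = (\<Sum>i\<in>A. star (g i))"
  by (induction A rule: infinite_finite_induct) (simp_all add: star_add)

text \<open>The C*-identity with submultiplicativity gives one inequality; applied to
  \<open>star x\<close> it gives the other.\<close>

lemma norm_star [simp]: "norm (star x) = norm (x :: 'a::unital_cstar_algebra)"
proof -
  have le: "norm y \<le> norm (star y)" for y :: 'a
  proof (cases "y = 0")
    case False
    have "norm y * norm y \<le> norm (star y) * norm y"
      using norm_mult_ineq[of "star y" y] by (simp add: cstar_identity power2_eq_square)
    then show ?thesis using False by simp
  qed simp
  from le[of x] le[of "star x"] show ?thesis by (simp add: star_star)
qed

lemma star_scaleR: "star (r *\<^sub>R x) = r *\<^sub>R star x"
  by (simp add: scaleR_scaleC star_scaleC)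

lemma bounded_linear_star: "bounded_linear star"
  by (rule bounded_linear_intro[of _ 1]) (simp_all add: star_add star_scaleR)

lemma star_power: "star (x ^ k) = star x ^ k"
  by (induction k) (simp_all add: star_mult power_commutes)

text \<open>Identities between bounded maps are reduced to a spanning set in this way: to elementary
  tensors, or to the products whose span is dense by the axioms of a compact quantum group.\<close>

lemma clinear_zero_on_dense:
  assumes "clinear F" "bounded_linear F" and dense: "closure (cspan S) = UNIV"
    and "\<And>s. s \<in> S \<Longrightarrow> F s = 0"
  shows "F x = 0"
proof -
  have "cspan S \<subseteq> {x. F x = 0}"
  proof
    fix x assume "x \<in> cspan S"
    then show "x \<in> {x. F x = 0}"
      by (induction rule: cvec.span_induct_alt)
        (use assms in \<open>simp_all add: clinear_zero clinear_add clinear_scaleC\<close>)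
  qed
  moreover have "closed {x. F x = 0}"
    using continuous_closed_vimage[of "{0}" F] linear_continuous_on[OF assms(2)]
      linear_continuous_at[OF assms(2)]
    by (auto simp: vimage_def)
  ultimately have "closure (cspan S) \<subseteq> {x. F x = 0}"
    by (rule closure_minimal)
  then show ?thesis using dense by auto
qed

subsection \<open>Positive functionals\<close>

text \<open>Consecutive coefficients differ by the factor (1/2 - k) / (k + 1), of modulus at most 1.
  This crude bound already makes the series converge absolutely in the open unit ball.\<close>

lemma abs_gchoose_half_le: "\<bar>(1 / 2 :: real) gchoose k\<bar> \<le> 1"
proof (induction k)
  case (Suc k)
  have "(1 / 2 :: real) gchoose Suc k = (1/2 gchoose k) * ((1 / 2 - real k) / real (Suc k))"
    using gbinomial_mult_1[of "1/2 :: real" k] by (simp add: field_simps)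
  moreover have "\<bar>(1 / 2 - real k) / real (Suc k)\<bar> \<le> 1"
    by (simp add: abs_le_iff)
  ultimately show ?case
    using Suc mult_le_one[of "\<bar>(1 / 2 :: real) gchoose k\<bar>" "\<bar>(1 / 2 - real k) / real (Suc k)\<bar>"]
    by (simp only: abs_mult abs_ge_zero)
qed simp

text \<open>The square root is the binomial series of \<open>(1 - y)\<^sup>1\<^sup>/\<^sup>2\<close>.\<close>

lemma self_adjoint_sqrt:
  fixes y :: "'a::unital_cstar_algebra"
  assumes "norm y < 1" "star y = y"
  obtains z where "star z = z" "z * z = 1 - y"
proof -
  define c :: "nat \<Rightarrow> real" where "c k = (1 / 2 gchoose k) * (-1) ^ k" for k
  define a where "a k = c k *\<^sub>R y ^ k" for k
  have c: "\<bar>c k\<bar> \<le> 1" for k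
    by (simp add: c_def abs_mult abs_gchoose_half_le)
  have na: "norm (a k) \<le> norm y ^ k" for k
  proof -
    have "norm (a k) = \<bar>c k\<bar> * norm (y ^ k)" by (simp add: a_def)
    also have "\<dots> \<le> 1 * norm y ^ k"
      by (intro mult_mono c norm_power_ineq) auto
    finally show ?thesis by simp
  qed
  have sum_norm: "summable (\<lambda>k. norm (a k))"
    by (rule summable_comparison_test'[of "\<lambda>k. norm y ^ k" 0])
      (use assms na in \<open>auto intro: summable_geometric\<close>)
  \<comment> \<open>Vandermonde: the square of the series has the coefficients 1 choose k up to
    sign, so only the terms 1 and -y survive.\<close>
  have conv: "(\<Sum>i\<le>k. a i * a (k - i)) = (if k = 0 then 1 else if k = 1 then - y else 0)" for k
  proof -
    have "(\<Sum>i\<le>k. a i * a (k - i)) = (\<Sum>i\<le>k. ((-1) ^ k * ((1/2 gchoose i) * (1/2 gchoose (k - i)))) *\<^sub>R y ^ k)"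
    proof (intro sum.cong refl)
      fix i assume "i \<in> {..k}"
      then have "i + (k - i) = k" by simp
      then have "y ^ i * y ^ (k - i) = y ^ k" "(-1::real) ^ i * (-1) ^ (k - i) = (-1) ^ k"
        by (metis power_add)+
      moreover have "a i * a (k - i) = (c i * c (k - i)) *\<^sub>R (y ^ i * y ^ (k - i))"
        by (simp add: a_def)
      moreover have "c i * c (k - i) = ((-1) ^ i * (-1) ^ (k - i)) * ((1/2 gchoose i) * (1/2 gchoose (k - i)))"
        unfolding c_def by (simp only: mult_ac)
      ultimately show "a i * a (k - i) = ((-1) ^ k * ((1/2 gchoose i) * (1/2 gchoose (k - i)))) *\<^sub>R y ^ k"
        by simp
    qed
    also have "\<dots> = ((-1) ^ k * (\<Sum>i\<le>k. (1/2 gchoose i) * (1/2 gchoose (k - i)))) *\<^sub>R y ^ k"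
      by (simp add: scaleR_sum_left sum_distrib_left)
    also have "(\<Sum>i\<le>k. (1/2 gchoose i) * ((1/2 :: real) gchoose (k - i))) = (1 gchoose k)"
      using gbinomial_Vandermonde[of "1/2 :: real" "1/2" k] by (simp add: atMost_atLeast0)
    also have "(1 gchoose k :: real) = of_nat (1 choose k)"
      by (metis binomial_gbinomial of_nat_1)
    finally show ?thesis
      by (cases "k \<le> 1") (auto simp: binomial_eq_0 le_Suc_eq)
  qed
  have "(\<lambda>k. \<Sum>i\<le>k. a i * a (k - i)) sums ((\<Sum>k. a k) * (\<Sum>k. a k))"
    by (rule Cauchy_product_sums[OF sum_norm sum_norm])
  moreover have "(\<lambda>k. \<Sum>i\<le>k. a i * a (k - i)) sums (1 - y)"
  proof -
    have "(\<lambda>k. \<Sum>i\<le>k. a i * a (k - i)) sums (\<Sum>k\<in>{0,1}. \<Sum>i\<le>k. a i * a (k - i))"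
      by (rule sums_finite) (simp_all only: conv, auto)
    then show ?thesis by (simp only: conv) simp
  qed
  ultimately have "(\<Sum>k. a k) * (\<Sum>k. a k) = 1 - y"
    by (rule sums_unique2)
  moreover have "star (\<Sum>k. a k) = (\<Sum>k. a k)"
    using bounded_linear.suminf[OF bounded_linear_star summable_norm_cancel[OF sum_norm]]
    by (simp add: a_def star_scaleR star_power assms)
  ultimately show thesis using that by blast
qed

context
  fixes h :: "'a::unital_cstar_algebra \<Rightarrow> complex"
  assumes state: "state h"
begin

lemma state_clinear: "clinear h"
  and state_pos: "h (star x * x) \<in> \<real>\<^sub>\<ge>\<^sub>0"
  and state_one: "h 1 = 1"
  using state by (auto simp: state_def)

lemmas state_add = clinear_add[OF state_clinear]
  and state_scaleC = clinear_scaleC[OF state_clinear, simplified]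
  and state_zero = clinear_zero[OF state_clinear]

lemma state_sesq_expand:
  "h (star (x + c *\<^sub>C y) * (x + c *\<^sub>C y)) =
     h (star x * x) + c * h (star x * y) + cnj c * h (star y * x) + cnj c * c * h (star y * y)"
  by (simp add: star_add star_scaleC distrib_left distrib_right mult_scaleC_left mult_scaleC_right
      state_add state_scaleC algebra_simps)

text \<open>Polarization: the quadratic form is real at \<open>x + c *\<^sub>C y\<close>. The choice
  c = 1 compares the imaginary parts of the cross terms, c = \<i> their real parts.\<close>

lemma state_hermitian: "h (star y * x) = cnj (h (star x * y))"
proof -
  have real: "h (star z * z) \<in> \<real>" for z
    using state_pos[of z] by (auto simp: nonneg_Reals_def)
  have im: "Im (h (star x * x)) = 0" "Im (h (star y * y)) = 0"
    using real by (auto simp: complex_is_Real_iff)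
  have "Im (h (star (x + c *\<^sub>C y) * (x + c *\<^sub>C y))) = 0" for c
    using real by (auto simp: complex_is_Real_iff)
  from this[of 1] this[of \<i>] im show ?thesis
    unfolding state_sesq_expand by (simp add: complex_eq_iff)
qed

lemma state_star: "h (star x) = cnj (h x)"
  using state_hermitian[of x 1] by simp

lemma state_cauchy_schwarz:
  "(cmod (h (star x * y)))\<^sup>2 \<le> Re (h (star x * x)) * Re (h (star y * y))"
proof -
  define b where "b = h (star x * y)"
  define p where "p = Re (h (star x * x))"
  define q where "q = Re (h (star y * y))"
  have p: "h (star x * x) = of_real p" "p \<ge> 0" and q: "h (star y * y) = of_real q" "q \<ge> 0"
    using state_pos[of x] state_pos[of y] by (auto simp: p_def q_def nonneg_Reals_def)
  \<comment> \<open>Positivity at \<open>x + ?c *\<^sub>C y\<close>: the factor \<open>cnj b\<close>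
    in \<open>?c\<close> absorbs the phase of b and leaves a real polynomial in t.\<close>
  have pos: "p - 2 * t * (cmod b)\<^sup>2 + t\<^sup>2 * (cmod b)\<^sup>2 * q \<ge> 0" for t :: real
  proof -
    let ?c = "- of_real t * cnj b"
    have bb: "b * cnj b = of_real ((cmod b)\<^sup>2)"
      by (simp only: complex_norm_square)
    then have "?c * b = - of_real (t * (cmod b)\<^sup>2)" "cnj ?c * cnj b = - of_real (t * (cmod b)\<^sup>2)"
      "cnj ?c * ?c = of_real (t\<^sup>2 * (cmod b)\<^sup>2)"
      by (simp_all add: power2_eq_square mult_ac flip: bb)
    then have "h (star (x + ?c *\<^sub>C y) * (x + ?c *\<^sub>C y)) =
        of_real (p - 2 * t * (cmod b)\<^sup>2 + t\<^sup>2 * (cmod b)\<^sup>2 * q)"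
      unfolding state_sesq_expand state_hermitian[of y x] p q b_def[symmetric] by simp
    then show ?thesis
      using state_pos[of "x + ?c *\<^sub>C y"] by (simp only: nonneg_Reals_of_real_iff)
  qed
  have "(cmod b)\<^sup>2 \<le> p * q"
  proof (cases "q = 0")
    case True
    show ?thesis
    proof (rule ccontr)
      assume "\<not> ?thesis"
      then have b: "(cmod b)\<^sup>2 > 0" using True by simp
      \<comment> \<open>For q = 0 the polynomial is affine in t, and this t gives it the value -p -
        2.\<close>
      from pos[of "(p + 1) / (cmod b)\<^sup>2"] b True p(2) show False by simp
    qed
  next
    case False
    then have "q > 0" using q by simp
    \<comment> \<open>The point where the quadratic polynomial is smallest.\<close>
    with pos[of "1 / q"] show ?thesis by (simp add: field_simps power2_eq_square)
  qed
  then show ?thesis by (simp add: b_def p_def q_def)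
qed

text \<open>Without faithfulness \<open>h (star x * x) = 0\<close> does not give
  \<open>x = 0\<close>. What Cauchy-Schwarz yields is that \<open>h\<close> cannot see the products
  with such an element, here and in the next lemma.\<close>

lemma state_null_left: "h (star x * x) = 0 \<Longrightarrow> h (star x * y) = 0"
  using state_cauchy_schwarz[of x y] by simp

lemma state_null_right: "h (star x * x) = 0 \<Longrightarrow> h (y * x) = 0"
  using state_cauchy_schwarz[of "star y" x] by (simp add: star_star)

text \<open>Positivity forces continuity: if \<open>norm x < 1\<close> then
  \<open>1 - star x * x\<close> is the square of a self-adjoint element, whence
  \<open>h (star x * x)\<close> is at most 1, and Cauchy-Schwarz against 1 bounds
  \<open>h x\<close>. The square root is available in the open unit ball, so x is scaled to norm
  1/2; hence the constant 2.\<close>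

lemma bounded_linear_state: "bounded_linear h"
proof (rule bounded_linear_intro[of _ 2])
  have le1: "Re (h (star x * x)) \<le> 1" if "norm x < 1" for x
  proof -
    have "norm (star x * x) < 1"
      using that by (simp add: cstar_identity power_less_one_iff)
    then obtain z where z: "star z = z" "z * z = 1 - star x * x"
      using self_adjoint_sqrt[of "star x * x"] by (metis star_mult star_star)
    have "h (star z * z) = 1 - h (star x * x)"
      by (simp add: z clinear_diff[OF state_clinear] state_one)
    then show ?thesis using state_pos[of z] by (auto simp: nonneg_Reals_def complex_eq_iff)
  qed
  have unit: "cmod (h x) \<le> 1" if "norm x < 1" for x
  proof -
    have "(cmod (h x))\<^sup>2 \<le> Re (h (star x * x))"
      using state_cauchy_schwarz[of 1 x] by (simp add: state_one)
    also have "\<dots> \<le> 1" by (rule le1[OF that])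
    finally show ?thesis by (simp add: power_le_one_iff)
  qed
  show "norm (h x) \<le> norm x * 2" for x
  proof (cases "x = 0")
    case False
    define r where "r = 1 / (2 * norm x)"
    have "norm (r *\<^sub>R x) < 1" using False by (simp add: r_def)
    then have "cmod (h (r *\<^sub>R x)) \<le> 1" by (rule unit)
    then have "cmod (h x) / (2 * norm x) \<le> 1"
      by (simp add: scaleR_scaleC state_scaleC norm_mult norm_divide r_def)
    then show ?thesis using False by (simp add: field_simps)
  qed (simp add: state_zero)
qed (simp_all add: state_add scaleR_scaleC state_scaleC scaleR_conv_of_real)

end

subsection \<open>Matrices over a C*-algebra\<close>

definition adj :: "'a::unital_cstar_algebra mat \<Rightarrow> 'a mat"
  where "adj A = mat (dim_col A) (dim_row A) (\<lambda>(i, j). star (A $$ (j, i)))"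

text \<open>The embedding of M as M \<otimes> 1: intertwiners and projections are complex matrices
  that have to multiply matrices over the algebra.\<close>

definition scalar_mat :: "complex mat \<Rightarrow> 'a::unital_cstar_algebra mat"
  where "scalar_mat A = map_mat (\<lambda>c. c *\<^sub>C 1) A"

lemma adj_carrier [simp]: "A \<in> carrier_mat n m \<Longrightarrow> adj A \<in> carrier_mat m n"
  and adj_dim [simp]: "dim_row (adj A) = dim_col A" "dim_col (adj A) = dim_row A"
  and adj_index [simp]: "i < dim_col A \<Longrightarrow> j < dim_row A \<Longrightarrow> adj A $$ (i, j) = star (A $$ (j, i))"
  by (auto simp: adj_def)

lemma adj_adj [simp]: "adj (adj A) = A"
  by (rule eq_matI) (auto simp: star_star)

lemma index_mult_mat_sum:
  "i < dim_row A \<Longrightarrow> j < dim_col B \<Longrightarrow> dim_col A = dim_row B \<Longrightarrow>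
    (A * B) $$ (i, j) = (\<Sum>k<dim_row B. A $$ (i, k) * B $$ (k, j))"
  unfolding times_mat_def scalar_prod_def by (auto simp: lessThan_atLeast0 intro!: sum.cong)

declare index_mult_mat(1) [simp del]

lemma adj_mult: "dim_col A = dim_row B \<Longrightarrow> adj (A * B) = adj B * adj A"
  by (rule eq_matI) (simp_all add: index_mult_mat_sum star_sum star_mult)

lemma adj_one [simp]: "adj (1\<^sub>m n) = 1\<^sub>m n"
  by (rule eq_matI) auto

lemma scalar_mat_carrier [simp]: "A \<in> carrier_mat n m \<Longrightarrow> scalar_mat A \<in> carrier_mat n m"
  and scalar_mat_dim [simp]:
    "dim_row (scalar_mat A) = dim_row A" "dim_col (scalar_mat A) = dim_col A"
  and scalar_mat_index [simp]: "i < dim_row A \<Longrightarrow> j < dim_col A \<Longrightarrow>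
    scalar_mat A $$ (i, j) = A $$ (i, j) *\<^sub>C 1"
  by (auto simp: scalar_mat_def)

lemma scaleC_one [simp]: "1 *\<^sub>C x = x"
  and scaleC_zero_left [simp]: "0 *\<^sub>C x = 0"
  and scaleC_zero_right [simp]: "c *\<^sub>C 0 = 0"
  by (rule cvec.scale_one cvec.scale_zero_left cvec.scale_zero_right)+

lemma scaleC_sum_left: "(\<Sum>i\<in>A. f i) *\<^sub>C x = (\<Sum>i\<in>A. f i *\<^sub>C x)"
  by (rule cvec.scale_sum_left)

lemma scaleC_sum_right: "c *\<^sub>C (\<Sum>i\<in>A. f i) = (\<Sum>i\<in>A. c *\<^sub>C f i)"
  by (rule cvec.scale_sum_right)

lemma scalar_mat_complex [simp]: "scalar_mat A = A"
  by (rule eq_matI) simp_all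

lemma scalar_mat_mult:
  "dim_col A = dim_row B \<Longrightarrow> scalar_mat (A * B) = scalar_mat A * scalar_mat B"
  by (rule eq_matI)
    (simp_all add: index_mult_mat_sum scaleC_sum_left mult_scaleC_left scaleC_scaleC)

lemma scalar_mat_one [simp]: "scalar_mat (1\<^sub>m n) = 1\<^sub>m n"
  by (rule eq_matI) auto

lemma scalar_mat_adj: "adj (scalar_mat A) = scalar_mat (adj A)"
  by (rule eq_matI) (simp_all add: star_scaleC)

text \<open>Used for functionals \<open>g\<close>: over the complex numbers
  \<open>scalar_mat\<close> is the identity, so the right side becomes a product of ordinary
  matrices to which linear algebra applies.\<close>

lemma map_mat_sandwich:
  assumes "clinear g" "A \<in> carrier_mat n1 n2" "V \<in> carrier_mat n2 n3" "B \<in> carrier_mat n3 n4"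
  shows "map_mat g (scalar_mat A * V * scalar_mat B) = scalar_mat A * map_mat g V * scalar_mat B"
  using assms(2-)
  by (intro eq_matI)
    (auto simp: index_mult_mat_sum sum_distrib_right mult_scaleC_left mult_scaleC_right
      clinear_sum[OF assms(1)] clinear_scaleC[OF assms(1)])

lemma mult_square_carrier:
  "A \<in> carrier_mat n n \<Longrightarrow> B \<in> carrier_mat n n \<Longrightarrow> A * B \<in> carrier_mat n n"
  by (rule mult_carrier_mat)

subsection \<open>The spectral theorem for Hermitian matrices\<close>

definition unitary_mat :: "nat \<Rightarrow> 'a::unital_cstar_algebra mat \<Rightarrow> bool"
  where "unitary_mat n U \<longleftrightarrow> U \<in> carrier_mat n n \<and> adj U * U = 1\<^sub>m n \<and> U * adj U = 1\<^sub>m n"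

definition real_diag :: "nat \<Rightarrow> (nat \<Rightarrow> real) \<Rightarrow> complex mat"
  where "real_diag n d = mat n n (\<lambda>(i, j). if i = j then complex_of_real (d i) else 0)"

lemma real_diag_carrier [simp]: "real_diag n d \<in> carrier_mat n n"
  and real_diag_dim [simp]: "dim_row (real_diag n d) = n" "dim_col (real_diag n d) = n"
  and real_diag_index [simp]: "i < n \<Longrightarrow> j < n \<Longrightarrow>
    real_diag n d $$ (i, j) = (if i = j then complex_of_real (d i) else 0)"
  by (auto simp: real_diag_def)

lemma adj_real_diag [simp]: "adj (real_diag n d) = real_diag n d"
  by (rule eq_matI) auto

lemma real_diag_mult: "real_diag n d * real_diag n d' = real_diag n (\<lambda>i. d i * d' i)"
  by (rule eq_matI) (auto simp: index_mult_mat_sum sum.delta if_distrib[of "\<lambda>x. x * _"] cong: if_cong)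

lemma unitary_mat_mult:
  assumes U: "unitary_mat n U" and V: "unitary_mat n V"
  shows "unitary_mat n (U * V)"
proof -
  note c = U[unfolded unitary_mat_def, THEN conjunct1] V[unfolded unitary_mat_def, THEN conjunct1]
  have "adj V * adj U * (U * V) = adj V * (adj U * U) * V"
    "U * V * (adj V * adj U) = U * (V * adj V) * adj U"
    using c by (simp_all add: assoc_mult_mat[of _ n n _ n _ n] mult_square_carrier)
  then show ?thesis
    using U V c by (auto simp: unitary_mat_def adj_mult left_mult_one_mat[of _ n n] right_mult_one_mat[of _ n n])
qed

text \<open>Complete v to a basis and apply Gram-Schmidt, which keeps the first vector. The result
  is orthogonal but not normalized; dividing the columns by their lengths produces the factor
  c.\<close>

lemma unitary_mat_first_col:
  fixes v :: "complex vec"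
  assumes v: "v \<in> carrier_vec n" "v \<noteq> 0\<^sub>v n" and n: "0 < n"
  obtains W c where "unitary_mat n W" "col W 0 = c \<cdot>\<^sub>v v"
proof -
  interpret cof_vec_space n "TYPE(complex)" .
  define b where "b = basis_completion v"
  define ws where "ws = gram_schmidt n b"
  from basis_completion[OF v, folded b_def]
  have dist_b: "distinct b" and indep: "\<not> lin_dep (set b)" and b: "set b \<subseteq> carrier_vec n"
    and hdb: "hd b = v" and len_b: "length b = n" by auto
  from hdb len_b n obtain vs where bv: "b = v # vs" by (cases b) auto
  from gram_schmidt_result[OF b dist_b indep refl, folded ws_def]
  have ws: "set ws \<subseteq> carrier_vec n" "corthogonal ws" "length ws = n"
    by (auto simp: len_b)
  have hdws: "ws ! 0 = v"
    using gram_schmidt_hd[OF v(1), of vs, folded bv] ws(3) n by (metis hd_conv_nth length_0_conv less_irrefl ws_def)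
  have wc: "ws ! j \<in> carrier_vec n" if "j < n" for j
    using ws that by auto
  define r where "r j = sqrt (\<Sum>k<n. (cmod (ws ! j $ k))\<^sup>2)" for j
  have ip: "ws ! i \<bullet>c ws ! j = (\<Sum>k<n. ws ! i $ k * cnj (ws ! j $ k))" if "i < n" "j < n" for i j
    using wc[OF that(1)] wc[OF that(2)] that
    by (auto simp: scalar_prod_def lessThan_atLeast0 intro!: sum.cong)
  have ipr: "(\<Sum>k<n. cnj (ws ! i $ k) * ws ! j $ k) = (if i = j then of_real (r i * r i) else 0)"
    if "i < n" "j < n" for i j
  proof (cases "i = j")
    case True
    have "(\<Sum>k<n. (cmod (ws ! j $ k))\<^sup>2) \<ge> 0" by (simp add: sum_nonneg)
    then have "r j * r j = (\<Sum>k<n. (cmod (ws ! j $ k))\<^sup>2)" by (simp add: r_def)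
    then show ?thesis using True by (simp add: complex_norm_square mult.commute del: of_real_mult of_real_power)
  next
    case False
    then have "ws ! j \<bullet>c ws ! i = 0" using ws(2,3) that by (auto simp: corthogonal_def)
    then show ?thesis using ip[OF that(2,1)] False by (simp add: mult.commute)
  qed
  have r0: "r j \<noteq> 0" if "j < n" for j
  proof
    assume "r j = 0"
    then have "ws ! j \<bullet>c ws ! j = 0" using ip[OF that that] ipr[OF that that] by (simp add: mult.commute)
    then show False using ws(2,3) that by (auto simp: corthogonal_def)
  qed
  define W where "W = mat n n (\<lambda>(i, j). ws ! j $ i / of_real (r j))"
  have W: "W \<in> carrier_mat n n" by (simp add: W_def)
  have "adj W * W = 1\<^sub>m n"
  proof (rule eq_matI)
    fix i j assume ij: "i < dim_row (1\<^sub>m n)" "j < dim_col (1\<^sub>m n)"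
    then have "(adj W * W) $$ (i, j) = (\<Sum>k<n. cnj (ws ! i $ k) * ws ! j $ k) / of_real (r i * r j)"
      using W by (simp add: index_mult_mat_sum W_def sum_divide_distrib)
    then show "(adj W * W) $$ (i, j) = 1\<^sub>m n $$ (i, j)"
      using ij ipr r0 by simp
  qed (use W in auto)
  moreover from this have "W * adj W = 1\<^sub>m n"
    using mat_mult_left_right_inverse[of "adj W" n W] W by simp
  moreover have "col W 0 = (1 / of_real (r 0)) \<cdot>\<^sub>v v"
    using n v(1) hdws by (intro eq_vecI) (auto simp: W_def)
  ultimately show thesis using that W by (auto simp: unitary_mat_def)
qed

text \<open>Deflation: in an orthonormal basis that starts with an eigenvector the first column is a
  multiple of the first unit vector, and by symmetry so is the first row. The remaining block is
  Hermitian of size n.\<close>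

theorem hermitian_spectral:
  fixes A :: "complex mat"
  assumes "A \<in> carrier_mat n n" "adj A = A"
  shows "\<exists>U d. unitary_mat n U \<and> A = U * real_diag n d * adj U"
  using assms
proof (induction n arbitrary: A)
  case 0
  then show ?case
    by (intro exI[of _ "1\<^sub>m 0"] exI) (auto simp: unitary_mat_def intro!: eq_matI)
next
  case (Suc n A)
  let ?m = "Suc n"
  note A = Suc.prems
  have "degree (char_poly A) = ?m" using degree_monic_char_poly[OF A(1)] by simp
  then have "\<not> constant (poly (char_poly A))" by (simp add: constant_degree)
  then obtain e where "poly (char_poly A) e = 0" using fundamental_theorem_of_algebra by blast
  then have "eigenvalue A e" using eigenvalue_root_char_poly[OF A(1)] by simp
  then obtain v where v: "v \<in> carrier_vec ?m" "v \<noteq> 0\<^sub>v ?m" "A *\<^sub>v v = e \<cdot>\<^sub>v v"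
    using A(1) by (auto simp: eigenvalue_def eigenvector_def)
  obtain W c where W: "unitary_mat ?m W" and colW: "col W 0 = c \<cdot>\<^sub>v v"
    using unitary_mat_first_col[OF v(1,2)] by auto
  then have Wc: "W \<in> carrier_mat ?m ?m" and WW: "adj W * W = 1\<^sub>m ?m" "W * adj W = 1\<^sub>m ?m"
    by (auto simp: unitary_mat_def)
  define A' where "A' = adj W * (A * W)"
  have A'c: "A' \<in> carrier_mat ?m ?m" using A Wc by (auto simp: A'_def)
  have A'h: "adj A' = A'"
    using A Wc by (simp add: A'_def adj_mult assoc_mult_mat[of _ ?m ?m _ ?m _ ?m] mult_square_carrier)
  have "(A * W) $$ (k, 0) = e * W $$ (k, 0)" if "k < ?m" for k
  proof -
    have "(A * W) $$ (k, 0) = (A *\<^sub>v col W 0) $ k"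
      using A Wc that by (simp add: index_mult_mat(1))
    also have "A *\<^sub>v col W 0 = e \<cdot>\<^sub>v col W 0"
      unfolding colW using A v by (simp add: mult_mat_vec smult_smult_assoc mult.commute)
    finally show ?thesis using Wc that by simp
  qed
  then have col0: "A' $$ (i, 0) = (if i = 0 then e else 0)" if "i < ?m" for i
  proof -
    have "A' $$ (i, 0) = (\<Sum>k<?m. adj W $$ (i, k) * (e * W $$ (k, 0)))"
      unfolding A'_def using A Wc that \<open>\<And>k. k < ?m \<Longrightarrow> _ k\<close>
      by (subst index_mult_mat_sum) auto
    also have "\<dots> = e * (adj W * W) $$ (i, 0)"
      using Wc that by (subst index_mult_mat_sum) (auto simp: sum_distrib_left mult_ac distrib_left)
    finally show ?thesis using that by (simp add: WW)
  qed
  have row0: "A' $$ (0, i) = (if i = 0 then e else 0)" if "i < ?m" for i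
  proof -
    have "A' $$ (0, i) = cnj (A' $$ (i, 0))"
      using A'h A'c that by (metis adj_index carrier_matD star_complex zero_less_Suc)
    then show ?thesis using col0[OF that] col0[of 0] A'h A'c
      by (metis (no_types) adj_index carrier_matD complex_cnj_zero star_complex zero_less_Suc)
  qed
  have e_real: "complex_of_real (Re e) = e"
  proof -
    have "cnj e = e"
      using col0[of 0] A'h A'c by (metis adj_index carrier_matD star_complex zero_less_Suc)
    then show ?thesis by (simp add: complex_eq_iff)
  qed
  define A3 where "A3 = mat n n (\<lambda>(i, j). A' $$ (Suc i, Suc j))"
  have A3: "A3 \<in> carrier_mat n n" "adj A3 = A3"
  proof -
    show "adj A3 = A3"
    proof (rule eq_matI)
      fix i j assume "i < dim_row A3" "j < dim_col A3"
      then have ij: "i < n" "j < n" by (auto simp: A3_def)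
      then have "adj A' $$ (Suc i, Suc j) = star (A' $$ (Suc j, Suc i))" using A'c by simp
      then show "adj A3 $$ (i, j) = A3 $$ (i, j)" using ij by (simp add: A3_def A'h)
    qed (auto simp: A3_def)
  qed (simp add: A3_def)
  from Suc.IH[OF this] obtain U d where U: "unitary_mat n U" and A3e: "A3 = U * real_diag n d * adj U"
    by blast
  have Uc: "U \<in> carrier_mat n n" and UU: "adj U * U = 1\<^sub>m n" "U * adj U = 1\<^sub>m n"
    using U by (auto simp: unitary_mat_def)
  define d' where "d' i = (case i of 0 \<Rightarrow> Re e | Suc j \<Rightarrow> d j)" for i
  let ?z = "0\<^sub>m 1 n :: complex mat" and ?z' = "0\<^sub>m n 1 :: complex mat"
  define V where "V = four_block_mat (1\<^sub>m 1) ?z ?z' U"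
  have V': "adj V = four_block_mat (1\<^sub>m 1) ?z ?z' (adj U)"
    using Uc by (intro eq_matI) (auto simp: V_def)
  have Vc: "V \<in> carrier_mat ?m ?m" using Uc by (auto simp: V_def)
  have D: "real_diag ?m d' = four_block_mat (real_diag 1 (\<lambda>_. Re e)) ?z ?z' (real_diag n d)"
    by (intro eq_matI) (auto simp: d'_def split: nat.split)
  have A'b: "A' = four_block_mat (real_diag 1 (\<lambda>_. Re e)) ?z ?z' A3"
    using A'c A3(1) col0 row0 by (intro eq_matI) (auto simp: A3_def e_real)
  have one: "four_block_mat (1\<^sub>m 1) ?z ?z' (1\<^sub>m n) = 1\<^sub>m ?m"
    by (intro eq_matI) auto
  have uV: "unitary_mat ?m V"
  proof -
    note four = mult_four_block_mat[of "1\<^sub>m 1" 1 1 ?z n ?z' n _ "1\<^sub>m 1" 1 ?z n ?z']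
    have "adj V * V = four_block_mat (1\<^sub>m 1) ?z ?z' (1\<^sub>m n)"
      unfolding V' unfolding V_def using Uc UU by (subst four) auto
    moreover have "V * adj V = four_block_mat (1\<^sub>m 1) ?z ?z' (1\<^sub>m n)"
      unfolding V' unfolding V_def using Uc UU by (subst four) auto
    ultimately show ?thesis
      unfolding unitary_mat_def one using Vc by blast
  qed
  have A'V: "A' = V * real_diag ?m d' * adj V"
  proof -
    let ?E = "real_diag 1 (\<lambda>_. Re e)"
    have "V * real_diag ?m d' = four_block_mat ?E ?z ?z' (U * real_diag n d)"
      unfolding V_def D using Uc
      by (subst mult_four_block_mat[of "1\<^sub>m 1" 1 1 ?z n ?z' n _ ?E 1 ?z n ?z']) auto
    moreover have "four_block_mat ?E ?z ?z' (U * real_diag n d) * adj V = A'"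
      unfolding V' A'b A3e using Uc
      by (subst mult_four_block_mat[of ?E 1 1 ?z n ?z' n _ "1\<^sub>m 1" 1 ?z n ?z']) auto
    ultimately show ?thesis by simp
  qed
  have "A = (W * adj W) * A * (W * adj W)"
    using A by (simp add: WW)
  also have "\<dots> = W * A' * adj W"
    using A Wc by (simp add: A'_def assoc_mult_mat[of _ ?m ?m _ ?m _ ?m] mult_square_carrier)
  also have "\<dots> = (W * V) * real_diag ?m d' * adj (W * V)"
    using Wc Vc by (simp add: A'V adj_mult assoc_mult_mat[of _ ?m ?m _ ?m _ ?m] mult_square_carrier)
  finally show ?case using unitary_mat_mult[OF W uV] by blast
qed

lemma factor_inverse:
  fixes S T :: "complex mat"
  assumes ST: "S \<in> carrier_mat n n" "T \<in> carrier_mat n n" "S * T = 1\<^sub>m n" "T * S = 1\<^sub>m n"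
  shows "adj S * S * (T * adj T) = 1\<^sub>m n" "T * adj T * (adj S * S) = 1\<^sub>m n"
proof -
  have "adj S * S * (T * adj T) = adj S * (S * T) * adj T" "T * adj T * (adj S * S) = T * (adj T * adj S) * S"
    using ST(1,2) by (simp_all add: assoc_mult_mat[of _ n n _ n _ n] mult_square_carrier)
  moreover have "adj S * adj T = adj (T * S)" "adj T * adj S = adj (S * T)"
    using ST(1,2) by (simp_all add: adj_mult)
  ultimately show "adj S * S * (T * adj T) = 1\<^sub>m n" "T * adj T * (adj S * S) = 1\<^sub>m n"
    using ST(1,2) by (simp_all add: ST(3,4))
qed

text \<open>With A = U D U* take S as the root of D times U*, and T as its inverse. Conjugation by S
  turns a matrix that preserves the form A into an isometric one, which is how conjugate
  representations become unitary; T T* is the inverse of A.\<close>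

lemma positive_definite_factor:
  fixes A :: "complex mat"
  assumes A: "A \<in> carrier_mat n n" "adj A = A"
    and pos: "\<And>\<xi>. \<exists>i<n. \<xi> i \<noteq> 0 \<Longrightarrow> Re (\<Sum>i<n. \<Sum>j<n. cnj (\<xi> i) * A $$ (i, j) * \<xi> j) > 0"
  obtains S T where "S \<in> carrier_mat n n" "T \<in> carrier_mat n n" "S * T = 1\<^sub>m n" "T * S = 1\<^sub>m n"
    "A = adj S * S" "A * (T * adj T) = 1\<^sub>m n" "T * adj T * A = 1\<^sub>m n"
proof -
  from hermitian_spectral[OF A] obtain U d where U: "unitary_mat n U"
    and Ae: "A = U * real_diag n d * adj U" by blast
  have Uc: "U \<in> carrier_mat n n" and UU: "adj U * U = 1\<^sub>m n" "U * adj U = 1\<^sub>m n"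
    using U by (auto simp: unitary_mat_def)
  \<comment> \<open>\<open>d i\<close> is the value of the quadratic form at column i of U, which is
    nonzero by unitarity.\<close>
  have d_pos: "d i > 0" if i: "i < n" for i
  proof -
    have "(adj U * (A * U)) $$ (i, i) = (\<Sum>j<n. cnj (U $$ (j, i)) * (\<Sum>k<n. A $$ (j, k) * U $$ (k, i)))"
      using A Uc i by (simp add: index_mult_mat_sum)
    also have "\<dots> = (\<Sum>j<n. \<Sum>k<n. cnj (U $$ (j, i)) * A $$ (j, k) * U $$ (k, i))"
      by (simp add: sum_distrib_left mult.assoc)
    finally have eq: "(adj U * (A * U)) $$ (i, i) = \<dots>" .
    have "adj U * (A * U) = (adj U * U) * real_diag n d * (adj U * U)"
      using Uc by (simp add: Ae assoc_mult_mat[of _ n n _ n _ n] mult_square_carrier)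
    then have "adj U * (A * U) = real_diag n d"
      by (simp add: UU left_mult_one_mat[of _ n n] right_mult_one_mat[of _ n n])
    then have "(\<Sum>j<n. \<Sum>k<n. cnj (U $$ (j, i)) * A $$ (j, k) * U $$ (k, i)) = of_real (d i)"
      using eq i by simp
    moreover have "\<exists>j<n. U $$ (j, i) \<noteq> 0"
    proof (rule ccontr)
      assume "\<not> ?thesis"
      then have "(adj U * U) $$ (i, i) = 0"
        using Uc i by (simp add: index_mult_mat_sum)
      then show False using i by (simp add: UU)
    qed
    ultimately show ?thesis using pos[of "\<lambda>j. U $$ (j, i)"] by simp
  qed
  define s t where "s i = sqrt (d i)" and "t i = 1 / sqrt (d i)" for i
  have st: "real_diag n s * real_diag n t = 1\<^sub>m n" "real_diag n t * real_diag n s = 1\<^sub>m n"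
    using d_pos by (auto intro!: eq_matI simp: real_diag_mult s_def t_def less_imp_le)
      (metis less_irrefl)+
  have ss: "real_diag n s * real_diag n s = real_diag n d"
    using d_pos by (auto intro!: eq_matI simp: real_diag_mult s_def less_imp_le simp flip: of_real_mult)
  let ?S = "real_diag n s * adj U" and ?T = "U * real_diag n t"
  have "?S * ?T = real_diag n s * (adj U * U) * real_diag n t"
    "?T * ?S = U * (real_diag n t * real_diag n s) * adj U"
    "adj ?S * ?S = U * (real_diag n s * real_diag n s) * adj U"
    using Uc by (simp_all add: adj_mult assoc_mult_mat[of _ n n _ n _ n] mult_square_carrier)
  then have "?S * ?T = 1\<^sub>m n" "?T * ?S = 1\<^sub>m n" "adj ?S * ?S = A"
    using Uc by (simp_all add: UU st ss Ae left_mult_one_mat[of _ n n] right_mult_one_mat[of _ n n])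
  moreover from this have "A * (?T * adj ?T) = 1\<^sub>m n" "?T * adj ?T * A = 1\<^sub>m n"
    using Uc factor_inverse[of ?S n ?T] by (simp_all add: mult_square_carrier)
  ultimately show thesis using that[of ?S ?T] Uc by (simp add: mult_square_carrier)
qed

section \<open>Compact quantum groups with a Haar measure\<close>

text \<open>\<open>L\<close> and \<open>R\<close> are the slice maps \<iota> \<otimes> h and h
  \<otimes> \<iota>. They are parameters because the definition of the Haar measure asserts only
  their existence.\<close>

locale haar_quantum_group =
  fixes ten :: "'a::unital_cstar_algebra \<Rightarrow> 'a \<Rightarrow> 't::unital_cstar_algebra"
    and \<Phi> :: "'a \<Rightarrow> 't" and h :: "'a \<Rightarrow> complex" and L R :: "'t \<Rightarrow> 'a"
  assumes tensor: "min_tensor_product ten"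
    and hom: "unital_star_hom \<Phi>"
    and dense_right: "closure (cspan {\<Phi> a * ten 1 b |a b. True}) = UNIV"
    and dense_left: "closure (cspan {\<Phi> a * ten b 1 |a b. True}) = UNIV"
    and state: "state h"
    and L_tensor: "is_tensor_map ten (\<lambda>a z. z *\<^sub>C a) id h L"
    and R_tensor: "is_tensor_map ten (\<lambda>z a. z *\<^sub>C a) h id R"
    and L_\<Phi>: "L (\<Phi> a) = h a *\<^sub>C 1"
    and R_\<Phi>: "R (\<Phi> a) = h a *\<^sub>C 1"
begin

lemma h_clinear: "clinear h" and h_bounded: "bounded_linear h" and h_one: "h 1 = 1"
  using state_clinear[OF state] bounded_linear_state[OF state] state_one[OF state] by auto

lemmas h_add = clinear_add[OF h_clinear]
  and h_scaleC = clinear_scaleC[OF h_clinear, simplified]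
  and h_sum = clinear_sum[OF h_clinear]
  and h_zero = clinear_zero[OF h_clinear]

lemma ten_clinear: "clinear (ten a)" "clinear (\<lambda>a. ten a b)"
  and ten_mult: "ten a b * ten a' b' = ten (a * a') (b * b')"
  and ten_star: "star (ten a b) = ten (star a) (star b)"
  and ten_dense: "closure (cspan {ten a b |a b. True}) = UNIV"
  using tensor by (auto simp: min_tensor_product_def elementary_span_def)

lemmas ten_sum_right = clinear_sum[OF ten_clinear(1)]
  and ten_sum_left = clinear_sum[OF ten_clinear(2)]
  and ten_scaleC_right = clinear_scaleC[OF ten_clinear(1)]
  and ten_scaleC_left = clinear_scaleC[OF ten_clinear(2)]
  and ten_zero_right = clinear_zero[OF ten_clinear(1)]
  and ten_zero_left = clinear_zero[OF ten_clinear(2)]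

lemma \<Phi>_clinear: "clinear \<Phi>" and \<Phi>_one: "\<Phi> 1 = 1" and \<Phi>_mult: "\<Phi> (x * y) = \<Phi> x * \<Phi> y"
  and \<Phi>_star: "\<Phi> (star x) = star (\<Phi> x)"
  using hom by (auto simp: unital_star_hom_def)

lemmas \<Phi>_sum = clinear_sum[OF \<Phi>_clinear]
  and \<Phi>_scaleC = clinear_scaleC[OF \<Phi>_clinear]

lemma L_clinear: "clinear L" and L_bounded: "bounded_linear L"
  and L_ten: "L (ten a b) = h b *\<^sub>C a"
  using L_tensor by (auto simp: is_tensor_map_def)

lemma R_clinear: "clinear R" and R_bounded: "bounded_linear R"
  and R_ten: "R (ten a b) = h a *\<^sub>C b"
  using R_tensor by (auto simp: is_tensor_map_def)

lemmas L_sum = clinear_sum[OF L_clinear] and L_scaleC = clinear_scaleC[OF L_clinear]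
  and R_sum = clinear_sum[OF R_clinear] and R_scaleC = clinear_scaleC[OF R_clinear]

lemma zero_on_ten:
  assumes "clinear F" "bounded_linear F" "\<And>a b. F (ten a b) = 0"
  shows "F T = 0"
  using clinear_zero_on_dense[OF assms(1,2) ten_dense] assms(3) by blast

lemma eq_on_ten:
  assumes "clinear F" "bounded_linear F" "clinear G" "bounded_linear G"
    and "\<And>a b. F (ten a b) = G (ten a b)"
  shows "F T = G T"
  using zero_on_ten[of "\<lambda>T. F T - G T" T] bounded_linear_sub[OF assms(2,4)] assms
  by (auto simp: clinear_iff algebra_simps cvec.scale_right_diff_distrib)

lemma zero_on_\<Phi>_right:
  assumes "clinear F" "bounded_linear F" "\<And>a b. F (\<Phi> a * ten 1 b) = 0"
  shows "F T = 0"
  using clinear_zero_on_dense[OF assms(1,2) dense_right] assms(3) by blast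

text \<open>Two conjugations cancel, so the map stays linear. This transfers the density of
  \<Phi>(A)(1 \<otimes> A) and \<Phi>(A)(A \<otimes> 1) to the products in reversed order.\<close>

lemma star_conjugate_map:
  assumes "clinear F" "bounded_linear F"
  shows "clinear (\<lambda>T. star (F (star T)))" "bounded_linear (\<lambda>T. star (F (star T)))"
proof -
  show "clinear (\<lambda>T. star (F (star T)))"
    by (simp add: clinear_iff star_add star_scaleC clinear_add[OF assms(1)] clinear_scaleC[OF assms(1)])
  show "bounded_linear (\<lambda>T. star (F (star T)))"
    by (intro bounded_linear_compose[OF bounded_linear_star] bounded_linear_compose[OF assms(2)]
        bounded_linear_star)
qed

lemma zero_on_\<Phi>_right':
  assumes "clinear F" "bounded_linear F" "\<And>a b. F (ten 1 b * \<Phi> a) = 0"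
  shows "F T = 0"
proof -
  have "star (F (star (star T))) = 0"
    by (rule zero_on_\<Phi>_right[OF star_conjugate_map[OF assms(1,2)]])
      (simp add: star_mult ten_star assms(3) flip: \<Phi>_star)
  then show ?thesis by (metis star_star star_zero)
qed

lemma zero_on_\<Phi>_left':
  assumes "clinear F" "bounded_linear F" "\<And>a b. F (ten b 1 * \<Phi> a) = 0"
  shows "F T = 0"
proof -
  have "star (F (star (star T))) = 0"
    by (rule clinear_zero_on_dense[OF star_conjugate_map[OF assms(1,2)] dense_left])
      (auto simp: star_mult ten_star assms(3) simp flip: \<Phi>_star)
  then show ?thesis by (metis star_star star_zero)
qed

lemmas bounded_intros = bounded_linear_compose[OF L_bounded] bounded_linear_compose[OF R_bounded]
  bounded_linear_compose[OF h_bounded] bounded_linear_mult_right bounded_linear_mult_left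
  bounded_linear_const_mult bounded_linear_mult_const L_bounded R_bounded

lemmas clinear_intros = clinear_comp[OF L_clinear] clinear_comp[OF R_clinear]
  clinear_comp[OF h_clinear] clinear_mult_left clinear_mult_right L_clinear R_clinear h_clinear

lemma clinear_mult_of: "clinear f \<Longrightarrow> clinear (\<lambda>x. a * f x)" "clinear f \<Longrightarrow> clinear (\<lambda>x. f x * a)"
  for f :: "'b::unital_cstar_algebra \<Rightarrow> 'c::unital_cstar_algebra"
  by (simp_all add: clinear_iff algebra_simps mult_scaleC_left mult_scaleC_right)

text \<open>The slice maps are bimodule maps over the leg that they keep; boundedness reduces this
  to elementary tensors.\<close>

lemma L_mult_left: "L (ten a 1 * T) = a * L T"
  by (rule eq_on_ten) (auto intro!: bounded_intros clinear_intros clinear_mult_of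
      simp: ten_mult L_ten mult_scaleC_right)

lemma L_mult_right: "L (T * ten a 1) = L T * a"
  by (rule eq_on_ten) (auto intro!: bounded_intros clinear_intros clinear_mult_of
      simp: ten_mult L_ten mult_scaleC_left)

lemma R_mult_left: "R (ten 1 a * T) = a * R T"
  by (rule eq_on_ten) (auto intro!: bounded_intros clinear_intros clinear_mult_of
      simp: ten_mult R_ten mult_scaleC_right)

lemma R_mult_right: "R (T * ten 1 a) = R T * a"
  by (rule eq_on_ten) (auto intro!: bounded_intros clinear_intros clinear_mult_of
      simp: ten_mult R_ten mult_scaleC_left)

text \<open>Fubini for h \<otimes> h. It permits slicing first in the leg where the invariance of
  \<open>h\<close> applies, as in the next two lemmas.\<close>

lemma h_L_eq_h_R: "h (L T) = h (R T)"
  by (rule eq_on_ten) (auto intro!: bounded_intros clinear_intros simp: L_ten R_ten h_scaleC)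

lemma h_L_\<Phi>: "h (L (\<Phi> a * ten 1 b)) = h a * h b"
  by (simp add: h_L_eq_h_R R_mult_right R_\<Phi> mult_scaleC_left h_scaleC)

lemma h_R_\<Phi>: "h (R (ten b 1 * \<Phi> a)) = h b * h a"
  by (simp add: L_mult_left L_\<Phi> mult_scaleC_right h_scaleC flip: h_L_eq_h_R)

subsection \<open>Unitary representations\<close>

definition rep_mat :: "nat \<Rightarrow> (nat \<Rightarrow> nat \<Rightarrow> 'a) \<Rightarrow> 'a mat"
  where "rep_mat m v = mat m m (\<lambda>(p, q). v p q)"

lemma rep_mat_carrier [simp]: "rep_mat m v \<in> carrier_mat m m"
  and rep_mat_dim [simp]: "dim_row (rep_mat m v) = m" "dim_col (rep_mat m v) = m"
  and rep_mat_index [simp]: "p < m \<Longrightarrow> q < m \<Longrightarrow> rep_mat m v $$ (p, q) = v p q"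
  by (auto simp: rep_mat_def)

abbreviation "rep \<equiv> unitary_rep ten \<Phi>"
abbreviation "irrep \<equiv> irreducible_rep ten \<Phi>"

lemma unitary_rep_iff:
  "rep m v \<longleftrightarrow> (\<forall>p<m. \<forall>q<m. \<Phi> (v p q) = (\<Sum>k<m. ten (v p k) (v k q))) \<and>
    unitary_mat m (rep_mat m v)"
proof -
  have "adj (rep_mat m v) * rep_mat m v = 1\<^sub>m m \<longleftrightarrow>
      (\<forall>p<m. \<forall>q<m. (\<Sum>k<m. star (v k p) * v k q) = (if p = q then 1 else 0))"
    by (auto simp: mat_eq_iff index_mult_mat_sum)
  moreover have "rep_mat m v * adj (rep_mat m v) = 1\<^sub>m m \<longleftrightarrow>
      (\<forall>p<m. \<forall>q<m. (\<Sum>k<m. v p k * star (v q k)) = (if p = q then 1 else 0))"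
    by (auto simp: mat_eq_iff index_mult_mat_sum)
  ultimately show ?thesis by (auto simp: unitary_rep_def unitary_mat_def)
qed

context
  fixes m v
  assumes rep: "rep m v"
begin

lemma rep_\<Phi>: "p < m \<Longrightarrow> q < m \<Longrightarrow> \<Phi> (v p q) = (\<Sum>k<m. ten (v p k) (v k q))"
  and rep_unitary_left: "p < m \<Longrightarrow> q < m \<Longrightarrow> (\<Sum>k<m. star (v k p) * v k q) = (if p = q then 1 else 0)"
  and rep_unitary_right: "p < m \<Longrightarrow> q < m \<Longrightarrow> (\<Sum>k<m. v p k * star (v q k)) = (if p = q then 1 else 0)"
  and rep_unitary_mat: "unitary_mat m (rep_mat m v)"
  using rep rep[unfolded unitary_rep_iff] by (auto simp: unitary_rep_def)

text \<open>The Hopf algebra identity a \<otimes> 1 = \<Sum> \<Phi>(a')(1 \<otimes> \<kappa>(a''))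
  for a matrix element, the antipode of \<open>v k q\<close> being \<open>star (v q k)\<close>. The
  next lemma is its mirror image.\<close>

lemma ten_rep_left:
  assumes "p < m" "q < m"
  shows "ten (v p q) 1 = (\<Sum>k<m. \<Phi> (v p k) * ten 1 (star (v q k)))"
proof -
  have "(\<Sum>k<m. \<Phi> (v p k) * ten 1 (star (v q k))) =
      (\<Sum>k<m. \<Sum>l<m. ten (v p l) (v l k * star (v q k)))"
    using assms by (simp add: rep_\<Phi> sum_distrib_right ten_mult)
  also have "\<dots> = (\<Sum>l<m. ten (v p l) (\<Sum>k<m. v l k * star (v q k)))"
    by (subst sum.swap) (simp add: ten_sum_right)
  also have "\<dots> = (\<Sum>l<m. if l = q then ten (v p l) 1 else 0)"
    using assms by (intro sum.cong) (auto simp: rep_unitary_right ten_zero_right)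
  finally show ?thesis using assms by simp
qed

lemma ten_rep_right:
  assumes "p < m" "q < m"
  shows "ten 1 (v p q) = (\<Sum>k<m. ten (star (v k p)) 1 * \<Phi> (v k q))"
proof -
  have "(\<Sum>k<m. ten (star (v k p)) 1 * \<Phi> (v k q)) =
      (\<Sum>k<m. \<Sum>l<m. ten (star (v k p) * v k l) (v l q))"
    using assms by (simp add: rep_\<Phi> sum_distrib_left ten_mult)
  also have "\<dots> = (\<Sum>l<m. ten (\<Sum>k<m. star (v k p) * v k l) (v l q))"
    by (subst sum.swap) (simp add: ten_sum_left)
  also have "\<dots> = (\<Sum>l<m. if p = l then ten 1 (v l q) else 0)"
    using assms by (intro sum.cong) (auto simp: rep_unitary_left ten_zero_left)
  finally show ?thesis using assms by simp
qed

text \<open>Put \<open>v p q\<close> into the first leg and expand it by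
  \<open>ten_rep_left\<close>: \<Phi> absorbs the factors \<open>v p k\<close>, the second leg
  absorbs \<open>star (v q k)\<close>, and then invariance splits the value into a product.\<close>

lemma h_L_rep:
  assumes "p < m" "q < m"
  shows "h (L (\<Phi> x * ten 1 y) * v p q) = (\<Sum>k<m. h (x * v p k) * cnj (h (star y * v q k)))"
proof -
  have "L (\<Phi> x * ten 1 y) * v p q = L (\<Phi> x * (ten (v p q) 1 * ten 1 y))"
    by (simp add: ten_mult mult.assoc flip: L_mult_right)
  also have "\<dots> = (\<Sum>k<m. L (\<Phi> (x * v p k) * ten 1 (star (v q k) * y)))"
    using assms
    by (simp add: ten_rep_left sum_distrib_left sum_distrib_right L_sum \<Phi>_mult mult.assoc ten_mult)
  finally show ?thesis
    by (simp add: h_sum h_L_\<Phi> star_mult star_star flip: state_star[OF state])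
qed

lemma h_R_rep:
  assumes "p < m" "q < m"
  shows "h (v p q * R (ten y 1 * \<Phi> x)) = (\<Sum>k<m. cnj (h (v k p * star y)) * h (v k q * x))"
proof -
  have "v p q * R (ten y 1 * \<Phi> x) = R (ten 1 (v p q) * (ten y 1 * \<Phi> x))"
    by (simp add: R_mult_left)
  also have "\<dots> = R (ten y 1 * ten 1 (v p q) * \<Phi> x)"
    by (simp add: ten_mult flip: mult.assoc)
  also have "\<dots> = (\<Sum>k<m. R (ten (y * star (v k p)) 1 * \<Phi> (v k q * x)))"
    using assms
    by (simp add: ten_rep_right sum_distrib_left sum_distrib_right R_sum \<Phi>_mult ten_mult
        flip: mult.assoc)
  finally show ?thesis
    by (simp add: h_sum h_R_\<Phi> star_mult star_star flip: state_star[OF state])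
qed

text \<open>The matrices \<open>Y x = (h (x * v p q))\<close> satisfy \<open>Y x * adj (Y y) = Y z\<close> for elements \<open>z\<close> that
  span a dense subspace, so they span a *-algebra, which is nondegenerate. The same holds for
  the matrices \<open>(h (v p q * x))\<close>.\<close>

lemma left_slices_nondegenerate:
  assumes null: "\<And>x s. s < m \<Longrightarrow> (\<Sum>r<m. \<xi> r * h (x * v r s)) = 0"
    and r: "r < m"
  shows "\<xi> r = 0"
proof -
  \<comment> \<open>The row vector \<xi> kills every Y x, so its conjugate, as a column, is killed
    by every Y x * adj (Y y), and by density by every Y z.\<close>
  have 0: "(\<Sum>q<m. cnj (\<xi> q) * h (z * v p q)) = 0" if p: "p < m" for z p
  proof -
    have lin: "h (L T * (\<Sum>q<m. cnj (\<xi> q) *\<^sub>C v p q)) = (\<Sum>q<m. cnj (\<xi> q) * h (L T * v p q))" for T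
      by (simp add: sum_distrib_left h_sum mult_scaleC_right h_scaleC)
    have "h (L T * (\<Sum>q<m. cnj (\<xi> q) *\<^sub>C v p q)) = 0" for T
    proof (rule zero_on_\<Phi>_right)
      fix x y
      have "(\<Sum>q<m. cnj (\<xi> q) * h (L (\<Phi> x * ten 1 y) * v p q)) =
          (\<Sum>k<m. h (x * v p k) * cnj (\<Sum>q<m. \<xi> q * h (star y * v q k)))"
        using p by (simp add: h_L_rep sum_distrib_left mult_ac) (rule sum.swap)
      also have "\<dots> = 0"
        by (intro sum.neutral ballI) (simp only: null lessThan_iff complex_cnj_zero mult_zero_right)
      finally show "h (L (\<Phi> x * ten 1 y) * (\<Sum>q<m. cnj (\<xi> q) *\<^sub>C v p q)) = 0"
        by (simp only: lin)
    qed (auto intro!: bounded_intros clinear_intros clinear_mult_of)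
    from this[of "ten z 1"] show ?thesis unfolding lin by (simp add: L_ten h_one)
  qed
  \<comment> \<open>The choice \<open>z = star (v p r)\<close>, summed over p: unitarity isolates
    the component r of \<xi>.\<close>
  have "0 = (\<Sum>p<m. \<Sum>q<m. cnj (\<xi> q) * h (star (v p r) * v p q))"
    by (simp add: 0)
  also have "\<dots> = (\<Sum>q<m. cnj (\<xi> q) * h (\<Sum>p<m. star (v p r) * v p q))"
    by (subst sum.swap) (simp add: h_sum sum_distrib_left)
  also have "\<dots> = (\<Sum>q<m. if r = q then cnj (\<xi> q) else 0)"
    using r by (intro sum.cong) (auto simp: rep_unitary_left h_one h_zero)
  finally show ?thesis using r by simp
qed

lemma right_slices_nondegenerate:
  assumes null: "\<And>x s. s < m \<Longrightarrow> (\<Sum>r<m. \<xi> r * h (v s r * x)) = 0"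
    and r: "r < m"
  shows "\<xi> r = 0"
proof -
  have 0: "(\<Sum>p<m. cnj (\<xi> p) * h (v p q * z)) = 0" if q: "q < m" for z q
  proof -
    have lin: "h ((\<Sum>p<m. cnj (\<xi> p) *\<^sub>C v p q) * R T) = (\<Sum>p<m. cnj (\<xi> p) * h (v p q * R T))" for T
      by (simp add: sum_distrib_right h_sum mult_scaleC_left h_scaleC)
    have "h ((\<Sum>p<m. cnj (\<xi> p) *\<^sub>C v p q) * R T) = 0" for T
    proof (rule zero_on_\<Phi>_left')
      fix x y
      have "(\<Sum>p<m. cnj (\<xi> p) * h (v p q * R (ten y 1 * \<Phi> x))) =
          (\<Sum>k<m. cnj (\<Sum>p<m. \<xi> p * h (v k p * star y)) * h (v k q * x))"
        using q by (simp add: h_R_rep sum_distrib_left sum_distrib_right mult_ac) (rule sum.swap)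
      also have "\<dots> = 0"
        by (intro sum.neutral ballI) (simp only: null lessThan_iff complex_cnj_zero mult_zero_left)
      finally show "h ((\<Sum>p<m. cnj (\<xi> p) *\<^sub>C v p q) * R (ten y 1 * \<Phi> x)) = 0"
        by (simp only: lin)
    qed (auto intro!: bounded_intros clinear_intros clinear_mult_of)
    from this[of "ten 1 z"] show ?thesis unfolding lin by (simp add: R_ten h_one)
  qed
  have "0 = (\<Sum>q<m. \<Sum>p<m. cnj (\<xi> p) * h (v p q * star (v r q)))"
    by (simp add: 0)
  also have "\<dots> = (\<Sum>p<m. cnj (\<xi> p) * h (\<Sum>q<m. v p q * star (v r q)))"
    by (subst sum.swap) (simp add: h_sum sum_distrib_left)
  also have "\<dots> = (\<Sum>p<m. if p = r then cnj (\<xi> p) else 0)"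
    using r by (intro sum.cong) (auto simp: rep_unitary_right h_one h_zero)
  finally show ?thesis using r by simp
qed

end

end

section \<open>Intertwiners and matrices commuting with a Hermitian matrix\<close>

lemma sum_rotate:
  "(\<Sum>b\<in>B. \<Sum>a\<in>A. \<Sum>k\<in>K. f a b k) = (\<Sum>k\<in>K. \<Sum>a\<in>A. \<Sum>b\<in>B. f a b k)"
proof -
  have "(\<Sum>b\<in>B. \<Sum>a\<in>A. \<Sum>k\<in>K. f a b k) = (\<Sum>a\<in>A. \<Sum>b\<in>B. \<Sum>k\<in>K. f a b k)"
    by (rule sum.swap)
  also have "\<dots> = (\<Sum>a\<in>A. \<Sum>k\<in>K. \<Sum>b\<in>B. f a b k)"
    by (intro sum.cong refl sum.swap)
  also have "\<dots> = (\<Sum>k\<in>K. \<Sum>a\<in>A. \<Sum>b\<in>B. f a b k)"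
    by (rule sum.swap)
  finally show ?thesis .
qed

lemma scalar_mat_minus:
  "dim_row A = dim_row B \<Longrightarrow> dim_col A = dim_col B \<Longrightarrow> scalar_mat (A - B) = scalar_mat A - scalar_mat B"
  by (rule eq_matI) (simp_all add: cvec.scale_left_diff_distrib)

text \<open>The adjoint of M W = V M reads W* M* = M* V*; multiplying by W on the left and by V on
  the right removes the stars of V and W by unitarity.\<close>

lemma intertwiner_adj:
  fixes V W :: "'a::unital_cstar_algebra mat"
  assumes V: "unitary_mat m V" and W: "unitary_mat m' W" and M: "M \<in> carrier_mat m m'"
    and "scalar_mat M * W = V * scalar_mat M"
  shows "scalar_mat (adj M) * V = W * scalar_mat (adj M)"
proof -
  define sM :: "'a mat" where "sM = scalar_mat M"
  have c: "sM \<in> carrier_mat m m'" "V \<in> carrier_mat m m" "W \<in> carrier_mat m' m'"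
    using V W M by (auto simp: sM_def unitary_mat_def)
  have "adj W * adj sM = adj sM * adj V"
    using arg_cong[OF assms(4), of adj] c by (simp add: adj_mult flip: sM_def)
  then have "W * (adj W * adj sM) * V = W * (adj sM * adj V) * V" by simp
  also have "W * (adj W * adj sM) * V = (W * adj W) * (adj sM * V)"
    using c by (simp add: assoc_mult_mat[of _ m' m' _ m' _ m] assoc_mult_mat[of _ m' m' _ m _ m]
      assoc_mult_mat[of W m' m' "adj W * adj sM" m V m] mult_carrier_mat[of _ m' m' _ m]
      mult_carrier_mat[of _ m' m _ m])
  also have "W * (adj sM * adj V) * V = W * (adj sM * (adj V * V))"
    using c by (simp add: assoc_mult_mat[of _ m' m' _ m _ m] assoc_mult_mat[of _ m' m _ m _ m]
      mult_carrier_mat[of _ m' m _ m])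
  finally show ?thesis
    using V W c M by (simp add: unitary_mat_def scalar_mat_adj sM_def
      left_mult_one_mat[of _ m' m] right_mult_one_mat[of _ m' m] mult_carrier_mat[of _ m' m _ m])
qed

lemma diag_mult_index:
  assumes "V \<in> carrier_mat m m" "i < m" "j < m"
  shows "(scalar_mat (real_diag m d) * V) $$ (i, j) = of_real (d i) *\<^sub>C V $$ (i, j)"
    and "(V * scalar_mat (real_diag m d)) $$ (i, j) = of_real (d j) *\<^sub>C V $$ (i, j)"
proof -
  have "(scalar_mat (real_diag m d) * V) $$ (i, j) = (\<Sum>k<m. if i = k then of_real (d i) *\<^sub>C V $$ (k, j) else 0)"
    using assms by (subst index_mult_mat_sum)
      (auto simp: mult_scaleC_left simp del: sum.delta sum.delta' intro!: sum.cong)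
  then show "(scalar_mat (real_diag m d) * V) $$ (i, j) = of_real (d i) *\<^sub>C V $$ (i, j)"
    using assms by simp
  have "(V * scalar_mat (real_diag m d)) $$ (i, j) = (\<Sum>k<m. if k = j then of_real (d j) *\<^sub>C V $$ (i, k) else 0)"
    using assms by (subst index_mult_mat_sum)
      (auto simp: mult_scaleC_right simp del: sum.delta sum.delta' intro!: sum.cong)
  then show "(V * scalar_mat (real_diag m d)) $$ (i, j) = of_real (d j) *\<^sub>C V $$ (i, j)"
    using assms by simp
qed

text \<open>Commuting with a diagonal matrix depends only on which diagonal entries coincide. Hence
  it passes from \<open>d\<close> to every function of \<open>d\<close>, in particular to spectral
  projections.\<close>

lemma diag_commuting_iff:
  assumes V: "V \<in> carrier_mat m m"
  shows "scalar_mat (real_diag m d) * V = V * scalar_mat (real_diag m d) \<longleftrightarrow>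
    (\<forall>i<m. \<forall>j<m. d i \<noteq> d j \<longrightarrow> V $$ (i, j) = 0)"
proof -
  have "scalar_mat (real_diag m d) * V = V * scalar_mat (real_diag m d) \<longleftrightarrow>
      (\<forall>i<m. \<forall>j<m. complex_of_real (d i) *\<^sub>C V $$ (i, j) = complex_of_real (d j) *\<^sub>C V $$ (i, j))"
    using V by (simp add: mat_eq_iff diag_mult_index)
  then show ?thesis by auto
qed

text \<open>The change of basis that reduces commuting with a Hermitian matrix to the diagonal
  case.\<close>

lemma unitary_conjugate_commutes:
  fixes V :: "'a::unital_cstar_algebra mat"
  assumes U: "unitary_mat m U" and V: "V \<in> carrier_mat m m" and D: "D \<in> carrier_mat m m"
  shows "scalar_mat (U * D * adj U) * V = V * scalar_mat (U * D * adj U) \<longleftrightarrow>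
    scalar_mat D * (scalar_mat (adj U) * V * scalar_mat U) =
    (scalar_mat (adj U) * V * scalar_mat U) * scalar_mat D"
proof -
  have Uc: "U \<in> carrier_mat m m" using U by (simp add: unitary_mat_def)
  define sU sU' sD where "sU = (scalar_mat U :: 'a mat)" and "sU' = (scalar_mat (adj U) :: 'a mat)"
    and "sD = (scalar_mat D :: 'a mat)"
  have c: "sU \<in> carrier_mat m m" "sU' \<in> carrier_mat m m" "sD \<in> carrier_mat m m"
    using Uc D by (auto simp: sU_def sU'_def sD_def)
  have UU: "sU' * sU = 1\<^sub>m m" "sU * sU' = 1\<^sub>m m"
    using U Uc scalar_mat_mult[of U "adj U", where 'a = 'a] scalar_mat_mult[of "adj U" U, where 'a = 'a]
    by (auto simp: sU_def sU'_def unitary_mat_def)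
  have eq: "scalar_mat (U * D * adj U) = sU * sD * sU'"
    using Uc D by (simp add: scalar_mat_mult mult_square_carrier sU_def sU'_def sD_def)
  note assoc = assoc_mult_mat[of _ m m _ m _ m] mult_square_carrier
  have UU1: "sU' * (sU * X) = X" "sU * (sU' * X) = X" if "X \<in> carrier_mat m m" for X
    using UU c that by (simp_all flip: assoc_mult_mat[of _ m m _ m _ m])
  show ?thesis
    unfolding eq sU_def[symmetric] sU'_def[symmetric] sD_def[symmetric]
  proof
    assume "sU * sD * sU' * V = V * (sU * sD * sU')"
    then have "sU' * (sU * sD * sU' * V) * sU = sU' * (V * (sU * sD * sU')) * sU" by simp
    then show "sD * (sU' * V * sU) = sU' * V * sU * sD"
      using c V UU by (simp add: assoc UU1)
  next
    assume "sD * (sU' * V * sU) = sU' * V * sU * sD"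
    then have "sU * (sD * (sU' * V * sU)) * sU' = sU * (sU' * V * sU * sD) * sU'" by simp
    then show "sU * sD * sU' * V = V * (sU * sD * sU')"
      using c V UU by (simp add: assoc UU1)
  qed
qed

lemma equivalent_repsI:
  fixes s t :: "nat \<Rightarrow> nat \<Rightarrow> complex"
  assumes "m = m'"
    and "\<And>p q. p < m \<Longrightarrow> q < m \<Longrightarrow> (\<Sum>k<m. s p k * t k q) = (if p = q then 1 else 0)"
    and "\<And>p q. p < m \<Longrightarrow> q < m \<Longrightarrow> (\<Sum>k<m. t p k * s k q) = (if p = q then 1 else 0)"
    and "\<And>p q. p < m \<Longrightarrow> q < m \<Longrightarrow> (\<Sum>k<m. s p k *\<^sub>C v k q) = (\<Sum>k<m. s k q *\<^sub>C w p k)"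
  shows "equivalent_reps m v m' w"
  unfolding equivalent_reps_def using assms by blast

context haar_quantum_group
begin

lemma h_mult_clinear: "clinear (\<lambda>a. h (x * a))"
  by (intro clinear_intros)

text \<open>Representations without unitarity, since the entrywise conjugate of a unitary
  representation is in general not unitary.\<close>

definition corep :: "nat \<Rightarrow> 'a mat \<Rightarrow> bool"
  where "corep m V \<longleftrightarrow> V \<in> carrier_mat m m \<and>
    (\<forall>p<m. \<forall>q<m. \<Phi> (V $$ (p, q)) = (\<Sum>k<m. ten (V $$ (p, k)) (V $$ (k, q))))"

lemma rep_iff_corep: "rep m v \<longleftrightarrow> corep m (rep_mat m v) \<and> unitary_mat m (rep_mat m v)"
  by (simp add: unitary_rep_iff corep_def)

lemma corep_rep_mat: "rep m v \<Longrightarrow> corep m (rep_mat m v)"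
  by (simp add: rep_iff_corep)

text \<open>The outer scalar matrices stay in their own legs and nothing is inserted between the two
  copies of V, so A and B may be singular. This matters for a product of complementary
  projections.\<close>

lemma \<Phi>_sandwich:
  assumes V: "corep m V" and AB: "A \<in> carrier_mat m m" "B \<in> carrier_mat m m" and ps: "p < m" "s < m"
  shows "\<Phi> ((scalar_mat A * V * scalar_mat B) $$ (p, s)) =
    (\<Sum>k<m. ten ((scalar_mat A * V) $$ (p, k)) ((V * scalar_mat B) $$ (k, s)))"
proof -
  have Vc: "V \<in> carrier_mat m m"
    and V\<Phi>: "\<And>p q. p < m \<Longrightarrow> q < m \<Longrightarrow> \<Phi> (V $$ (p, q)) = (\<Sum>k<m. ten (V $$ (p, k)) (V $$ (k, q)))"
    using V by (auto simp: corep_def)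
  have 1: "(scalar_mat A * V * scalar_mat B) $$ (p, s) =
      (\<Sum>b<m. \<Sum>a<m. (B $$ (b, s) * A $$ (p, a)) *\<^sub>C V $$ (a, b))"
    using ps Vc AB by (simp add: index_mult_mat_sum sum_distrib_right
        mult_scaleC_left mult_scaleC_right scaleC_scaleC scaleC_sum_right)
  have 2: "(scalar_mat A * V) $$ (p, k) = (\<Sum>a<m. A $$ (p, a) *\<^sub>C V $$ (a, k))"
    "(V * scalar_mat B) $$ (k, s) = (\<Sum>b<m. B $$ (b, s) *\<^sub>C V $$ (k, b))" if "k < m" for k
    using that ps Vc AB by (simp_all add: index_mult_mat_sum mult_scaleC_left mult_scaleC_right)
  have "\<Phi> ((scalar_mat A * V * scalar_mat B) $$ (p, s)) =
      (\<Sum>b<m. \<Sum>a<m. \<Sum>k<m. (B $$ (b, s) * A $$ (p, a)) *\<^sub>C ten (V $$ (a, k)) (V $$ (k, b)))"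
    by (simp add: 1 \<Phi>_sum \<Phi>_scaleC V\<Phi> scaleC_sum_right)
  also have "\<dots> = (\<Sum>k<m. \<Sum>a<m. \<Sum>b<m. (B $$ (b, s) * A $$ (p, a)) *\<^sub>C ten (V $$ (a, k)) (V $$ (k, b)))"
    by (rule sum_rotate)
  also have "\<dots> = (\<Sum>k<m. ten ((scalar_mat A * V) $$ (p, k)) ((V * scalar_mat B) $$ (k, s)))"
    by (intro sum.cong refl, subst sum.swap) (simp add: 2 ten_sum_left ten_sum_right ten_scaleC_left
        ten_scaleC_right scaleC_scaleC scaleC_sum_right mult.commute)
  finally show ?thesis .
qed

text \<open>In \<open>\<Phi>_sandwich\<close> the first leg is S V = W S because T S = 1. Moving
  this S across to the second leg turns V T into W.\<close>

lemma corep_similar: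
  assumes V: "corep m V" and ST: "S \<in> carrier_mat m m" "T \<in> carrier_mat m m" "T * S = 1\<^sub>m m"
  shows "corep m (scalar_mat S * V * scalar_mat T)"
  unfolding corep_def
proof (intro conjI allI impI)
  have Vc: "V \<in> carrier_mat m m" using V by (simp add: corep_def)
  define sS sT where "sS = (scalar_mat S :: 'a mat)" and "sT = (scalar_mat T :: 'a mat)"
  have c: "sS \<in> carrier_mat m m" "sT \<in> carrier_mat m m" using ST by (auto simp: sS_def sT_def)
  have TS: "sT * sS = 1\<^sub>m m"
    using ST scalar_mat_mult[of T S, where 'a = 'a] by (simp add: sS_def sT_def)
  define W where "W = sS * V * sT"
  have Wc: "W \<in> carrier_mat m m" using c Vc by (simp add: W_def mult_square_carrier)
  then show "scalar_mat S * V * scalar_mat T \<in> carrier_mat m m" by (simp add: W_def sS_def sT_def)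
  have SV: "sS * V = W * sS"
    using c Vc by (simp add: W_def mult_square_carrier assoc_mult_mat[of _ m m _ m _ m] TS)
  have WS: "sS * (V * sT) = W"
    using c Vc by (simp add: W_def assoc_mult_mat[of _ m m _ m _ m])
  fix p q assume pq: "p < m" "q < m"
  have "\<Phi> (W $$ (p, q)) = (\<Sum>k<m. ten ((W * sS) $$ (p, k)) ((V * sT) $$ (k, q)))"
    using \<Phi>_sandwich[OF V ST(1,2) pq, folded sS_def sT_def, folded W_def, unfolded SV] .
  also have "\<dots> = (\<Sum>k<m. \<Sum>c<m. ten (S $$ (c, k) *\<^sub>C W $$ (p, c)) ((V * sT) $$ (k, q)))"
    using pq Wc c ST by (intro sum.cong refl) (simp add: index_mult_mat_sum[of p W] sS_def mult_scaleC_right ten_sum_left)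
  also have "\<dots> = (\<Sum>c<m. ten (W $$ (p, c)) (\<Sum>k<m. S $$ (c, k) *\<^sub>C (V * sT) $$ (k, q)))"
    by (subst sum.swap) (simp add: ten_sum_right ten_scaleC_left ten_scaleC_right)
  also have "\<dots> = (\<Sum>c<m. ten (W $$ (p, c)) (W $$ (c, q)))"
  proof (intro sum.cong refl)
    fix k assume "k \<in> {..<m}"
    then have "(sS * (V * sT)) $$ (k, q) = (\<Sum>l<m. S $$ (k, l) *\<^sub>C (V * sT) $$ (l, q))"
      using pq Vc c ST by (subst index_mult_mat_sum) (auto simp: sS_def mult_scaleC_left)
    then show "ten (W $$ (p, k)) (\<Sum>l<m. S $$ (k, l) *\<^sub>C (V * sT) $$ (l, q)) = ten (W $$ (p, k)) (W $$ (k, q))"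
      by (simp add: WS)
  qed
  finally show "\<Phi> ((scalar_mat S * V * scalar_mat T) $$ (p, q)) =
      (\<Sum>k<m. ten ((scalar_mat S * V * scalar_mat T) $$ (p, k)) ((scalar_mat S * V * scalar_mat T) $$ (k, q)))"
    by (simp only: W_def sS_def sT_def)
qed

text \<open>With F = 1 - E the hypothesis is F V E = 0, and D = E V F = 0 has to be shown. The
  matrices \<open>Y x\<close> are closed enough under adjoints that the complex relation F Y E = 0
  can be turned around, which gives E Y F = 0, that is, \<open>h\<close> vanishes on all multiples
  of the entries of D. To obtain D = 0 although \<open>h\<close> may have null vectors, \<Phi> is
  applied to D once more.\<close>

lemma invariant_projection_commutes:
  assumes rep: "rep m v" and E: "E \<in> carrier_mat m m" "adj E = E" "E * E = E"
    and inv: "scalar_mat E * rep_mat m v * scalar_mat E = rep_mat m v * scalar_mat E"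
  shows "scalar_mat E * rep_mat m v = rep_mat m v * scalar_mat E"
proof -
  define V where "V = rep_mat m v"
  define F where "F = 1\<^sub>m m - E"
  have V: "V \<in> carrier_mat m m" and F: "F \<in> carrier_mat m m" and V_index: "\<And>p q. p < m \<Longrightarrow> q < m \<Longrightarrow> V $$ (p, q) = v p q"
    using E by (auto simp: V_def F_def)
  have F_adj: "adj F = F"
  proof (rule eq_matI)
    fix i j assume "i < dim_row F" "j < dim_col F"
    then have ij: "i < m" "j < m" using F by auto
    then have "cnj (E $$ (j, i)) = E $$ (i, j)" using E by (metis adj_index carrier_matD star_complex)
    then show "adj F $$ (i, j) = F $$ (i, j)" using ij E by (auto simp: F_def)
  qed (use F in auto)
  have sF: "scalar_mat F = 1\<^sub>m m - (scalar_mat E :: 'a mat)"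
    using E by (simp add: F_def scalar_mat_minus)
  have EF: "E + F = 1\<^sub>m m"
    using E by (intro eq_matI) (auto simp: F_def)
  define sE sF' where "sE = (scalar_mat E :: 'a mat)" and "sF' = (scalar_mat F :: 'a mat)"
  have sE: "sE \<in> carrier_mat m m" and sF': "sF' \<in> carrier_mat m m"
    using E F by (auto simp: sE_def sF'_def)
  have FVE: "sF' * V * sE = 0\<^sub>m m m"
    using V sE inv by (simp add: sF'_def sF flip: sE_def V_def)
      (simp add: minus_mult_distrib_mat[of _ m m _ _ m])
  define Y where "Y x = map_mat (\<lambda>a. h (x * a)) V" for x
  have Y: "Y x \<in> carrier_mat m m" for x using V by (simp add: Y_def)
  have Y_L: "Y (L (\<Phi> x * ten 1 y)) = Y x * adj (Y (star y))" for x y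
    using V by (intro eq_matI) (simp_all add: Y_def index_mult_mat_sum V_index h_L_rep[OF rep])
  have FYE: "F * Y x * E = 0\<^sub>m m m" for x
  proof -
    have "F * Y x * E = map_mat (\<lambda>a. h (x * a)) (sF' * V * sE)"
      using map_mat_sandwich[OF h_mult_clinear F V E(1), of x] by (simp add: Y_def sE_def sF'_def)
    then show ?thesis by (simp add: FVE) (auto simp: h_zero intro!: eq_matI)
  qed
  define D where "D = sE * V * sF'"
  have D: "D \<in> carrier_mat m m" using sE V sF' by (simp add: D_def mult_square_carrier)
  have EYF: "E * Y z * F = map_mat (\<lambda>a. h (z * a)) D" for z
    using map_mat_sandwich[OF h_mult_clinear E(1) V F, of z] by (simp add: Y_def sE_def sF'_def D_def)
  \<comment> \<open>The adjoint of \<open>Y x * adj (Y (star y))\<close> is a product of the same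
    form and hence again a value of Y, so \<open>FYE\<close> applies to it.\<close>
  have hD_gen: "E * Y (L (\<Phi> x * ten 1 y)) * F = 0\<^sub>m m m" for x y
  proof -
    have "E * Y (L (\<Phi> x * ten 1 y)) * F = E * (Y x * adj (Y (star y))) * F"
      by (simp add: Y_L)
    also have "\<dots> = adj (F * (Y (star y) * adj (Y x)) * E)"
      using E F Y[of x] Y[of "star y"] F_adj
      by (simp add: adj_mult mult_square_carrier assoc_mult_mat[of _ m m _ m _ m])
    also have "Y (star y) * adj (Y x) = Y (L (\<Phi> (star y) * ten 1 (star x)))"
      by (simp add: Y_L star_star)
    finally show ?thesis by (simp add: FYE) (auto intro!: eq_matI)
  qed
  \<comment> \<open>Density extends the relation to all slices, and every z is the slice of
    \<open>ten z 1\<close>.\<close>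
  have hD: "h (z * D $$ (p, s)) = 0" if ps: "p < m" "s < m" for z p s
  proof -
    have "h (L T * D $$ (p, s)) = 0" for T
    proof (rule zero_on_\<Phi>_right)
      fix x y
      have "h (L (\<Phi> x * ten 1 y) * D $$ (p, s)) = (E * Y (L (\<Phi> x * ten 1 y)) * F) $$ (p, s)"
        unfolding EYF using ps D by simp
      then show "h (L (\<Phi> x * ten 1 y) * D $$ (p, s)) = 0" using ps by (simp add: hD_gen)
    qed (auto intro!: bounded_intros clinear_intros clinear_mult_of)
    from this[of "ten z 1"] show ?thesis by (simp add: L_ten h_one)
  qed
  have EY: "E * Y z = Y z * E" for z
  proof -
    have "E * Y z * F = 0\<^sub>m m m"
      unfolding EYF using D hD by (auto intro!: eq_matI)
    then have "E * Y z = E * Y z * E"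
      using E F Y[of z] arg_cong[OF EF, of "\<lambda>X. E * Y z * X"]
      by (simp add: mult_add_distrib_mat[of _ m m _ m] mult_square_carrier right_add_zero_mat[of _ m m])
    moreover have "Y z * E = E * Y z * E"
      using E F Y[of z] arg_cong[OF EF, of "\<lambda>X. X * (Y z * E)"] FYE[of z]
      by (simp add: add_mult_distrib_mat[of _ m m _ _ m] mult_square_carrier right_add_zero_mat[of _ m m]
          assoc_mult_mat[of _ m m _ m _ m])
    ultimately show ?thesis by simp
  qed
  have \<Phi>_D: "\<Phi> (D $$ (p, s)) = (\<Sum>k<m. ten ((sE * V) $$ (p, k)) ((V * sF') $$ (k, s)))"
    if "p < m" "s < m" for p s
    using \<Phi>_sandwich[OF corep_rep_mat[OF rep] E(1) F that] by (simp add: D_def sE_def sF'_def V_def)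
  \<comment> \<open>By \<open>hD\<close> and density, \<open>R (S * \<Phi> (D $$ (i, s)))\<close>
    vanishes for every S. For \<open>S = ten z 1\<close> it is an entry of (E Y z) V F, and since E
    commutes with Y z this product is Y z D.\<close>
  have YD: "(\<Sum>q<m. h (z * v p q) *\<^sub>C D $$ (q, s)) = 0" if ps: "p < m" "s < m" for z p s
  proof -
    have R0: "R (S * \<Phi> (D $$ (i, s))) = 0" if "i < m" for S i
    proof (rule zero_on_\<Phi>_right'[of "\<lambda>S. R (S * \<Phi> (D $$ (i, s)))"])
      fix a b
      show "R (ten 1 b * \<Phi> a * \<Phi> (D $$ (i, s))) = 0"
        using that ps by (simp add: mult.assoc R_mult_left R_\<Phi> hD flip: \<Phi>_mult)
    qed (auto intro!: bounded_intros clinear_intros)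
    have hEV: "h (z * (sE * V) $$ (i, k)) = (E * Y z) $$ (i, k)" if "i < m" "k < m" for i k
    proof -
      have map: "map_mat (\<lambda>a. h (z * a)) (sE * V) = E * Y z"
        using map_mat_sandwich[OF h_mult_clinear E(1) V one_carrier_mat, of z] E V sE Y[of z]
        by (simp add: Y_def sE_def mult_square_carrier right_mult_one_mat[of _ m m])
      show ?thesis using that sE V by (simp flip: map)
    qed
    have "(scalar_mat (E * Y z) * (V * sF')) $$ (i, s) = 0" if "i < m" for i
    proof -
      have "(scalar_mat (E * Y z) * (V * sF')) $$ (i, s) =
          (\<Sum>k<m. (E * Y z) $$ (i, k) *\<^sub>C (V * sF') $$ (k, s))"
        using that ps E V sF' Y[of z] by (subst index_mult_mat_sum) (auto simp: mult_scaleC_left)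
      also have "\<dots> = R (ten z 1 * \<Phi> (D $$ (i, s)))"
        using that ps by (simp add: \<Phi>_D sum_distrib_left R_sum ten_mult R_ten hEV)
      finally show ?thesis using R0[OF that] by simp
    qed
    moreover have "scalar_mat (E * Y z) * (V * sF') = scalar_mat (Y z) * D"
      using E V sE sF' Y[of z]
      by (simp add: EY scalar_mat_mult D_def mult_square_carrier assoc_mult_mat[of _ m m _ m _ m] flip: sE_def)
    ultimately have "(scalar_mat (Y z) * D) $$ (p, s) = 0" using ps by simp
    then show ?thesis
      using ps V D Y[of z] by (subst (asm) index_mult_mat_sum) (auto simp: mult_scaleC_left Y_def V_index)
  qed
  \<comment> \<open>Again \<open>z = star (v p r)\<close>, summed over p: unitarity replaces Y by
    the identity matrix.\<close>
  have D0: "D $$ (r, s) = 0" if rs: "r < m" "s < m" for r s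
  proof -
    have "0 = (\<Sum>p<m. \<Sum>q<m. h (star (v p r) * v p q) *\<^sub>C D $$ (q, s))"
      using rs by (simp add: YD)
    also have "\<dots> = (\<Sum>q<m. h (\<Sum>p<m. star (v p r) * v p q) *\<^sub>C D $$ (q, s))"
      by (subst sum.swap) (simp add: h_sum scaleC_sum_left)
    also have "\<dots> = (\<Sum>q<m. if r = q then D $$ (q, s) else 0)"
      using rs by (intro sum.cong) (auto simp: rep_unitary_left[OF rep] h_one h_zero)
    finally show ?thesis using rs by simp
  qed
  have "sE * V * (sE + sF') = V * sE"
  proof -
    have "sE * V * sF' = 0\<^sub>m m m" using D D0 by (intro eq_matI) (auto simp flip: D_def)
    then show ?thesis
      using sE sF' V inv
      by (simp add: mult_add_distrib_mat[of _ m m _ m] mult_square_carrier right_add_zero_mat[of _ m m]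
          flip: sE_def V_def)
  qed
  moreover have "sE + sF' = 1\<^sub>m m"
    using E by (intro eq_matI) (auto simp: sE_def sF'_def sF)
  ultimately show ?thesis
    using sE V by (simp add: mult_square_carrier right_mult_one_mat[of _ m m] flip: sE_def V_def)
qed

subsection \<open>Schur's lemma and complete reducibility\<close>

lemma irrep_iff:
  "irrep m v \<longleftrightarrow> 0 < m \<and> rep m v \<and> (\<forall>E\<in>carrier_mat m m. adj E = E \<and> E * E = E \<and>
     scalar_mat E * rep_mat m v * scalar_mat E = rep_mat m v * scalar_mat E \<longrightarrow> E = 0\<^sub>m m m \<or> E = 1\<^sub>m m)"
proof -
  define P where "P e \<longleftrightarrow>
      (\<forall>p<m. \<forall>q<m. cnj (e q p) = e p q \<and> (\<Sum>k<m. e p k * e k q) = e p q) \<and>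
      (\<forall>p<m. \<forall>q<m. (\<Sum>k<m. \<Sum>l<m. (e p k * e l q) *\<^sub>C v k l) = (\<Sum>l<m. e l q *\<^sub>C v p l)) \<longrightarrow>
      (\<forall>p<m. \<forall>q<m. e p q = 0) \<or> (\<forall>p<m. \<forall>q<m. e p q = (if p = q then 1 else 0))"
    for e :: "nat \<Rightarrow> nat \<Rightarrow> complex"
  have swap: "(\<Sum>k<m. \<Sum>l<m. (e p k * e l q) *\<^sub>C v k l) = (\<Sum>l<m. \<Sum>k<m. (e l q * e p k) *\<^sub>C v k l)"
    for e :: "nat \<Rightarrow> nat \<Rightarrow> complex" and p q
    by (subst sum.swap) (simp add: mult.commute)
  have P_mat: "P (\<lambda>p q. E $$ (p, q)) \<longleftrightarrow> (adj E = E \<and> E * E = E \<and>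
      scalar_mat E * rep_mat m v * scalar_mat E = rep_mat m v * scalar_mat E \<longrightarrow> E = 0\<^sub>m m m \<or> E = 1\<^sub>m m)"
    if E: "E \<in> carrier_mat m m" for E
  proof -
    have "adj E = E \<longleftrightarrow> (\<forall>p<m. \<forall>q<m. cnj (E $$ (q, p)) = E $$ (p, q))"
      "E * E = E \<longleftrightarrow> (\<forall>p<m. \<forall>q<m. (\<Sum>k<m. E $$ (p, k) * E $$ (k, q)) = E $$ (p, q))"
      "E = 0\<^sub>m m m \<longleftrightarrow> (\<forall>p<m. \<forall>q<m. E $$ (p, q) = 0)"
      "E = 1\<^sub>m m \<longleftrightarrow> (\<forall>p<m. \<forall>q<m. E $$ (p, q) = (if p = q then 1 else 0))"
      using E by (simp_all add: mat_eq_iff index_mult_mat_sum)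
    moreover have "scalar_mat E * rep_mat m v * scalar_mat E = rep_mat m v * scalar_mat E \<longleftrightarrow>
        (\<forall>p<m. \<forall>q<m. (\<Sum>k<m. \<Sum>l<m. (E $$ (p, k) * E $$ (l, q)) *\<^sub>C v k l) = (\<Sum>l<m. E $$ (l, q) *\<^sub>C v p l))"
      unfolding swap[of "\<lambda>p q. E $$ (p, q)"] using E
      by (simp add: mat_eq_iff index_mult_mat_sum sum_distrib_right mult_scaleC_left mult_scaleC_right
          scaleC_scaleC scaleC_sum_right)
    ultimately show ?thesis unfolding P_def by blast
  qed
  have "(\<forall>e. P e) \<longleftrightarrow> (\<forall>E\<in>carrier_mat m m. P (\<lambda>p q. E $$ (p, q)))"
  proof (intro iffI allI ballI)
    fix e assume "\<forall>E\<in>carrier_mat m m. P (\<lambda>p q. E $$ (p, q))"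
    then have "P (\<lambda>p q. mat m m (\<lambda>(p, q). e p q) $$ (p, q))" by simp
    then show "P e" by (simp add: P_def)
  qed simp
  then show ?thesis using P_mat by (simp add: irreducible_rep_def P_def conj_assoc)
qed

lemma irrep_projection:
  assumes v: "irrep m v" and E: "E \<in> carrier_mat m m" "adj E = E" "E * E = E"
    and comm: "scalar_mat E * rep_mat m v = rep_mat m v * scalar_mat E"
  shows "E = 0\<^sub>m m m \<or> E = 1\<^sub>m m"
proof -
  have "scalar_mat E * scalar_mat E = (scalar_mat E :: 'a mat)"
    using E scalar_mat_mult[of E E, where 'a = 'a] by simp
  then have "scalar_mat E * rep_mat m v * scalar_mat E = rep_mat m v * scalar_mat E"
    unfolding comm using E by (simp add: assoc_mult_mat[of _ m m _ m _ m])
  then show ?thesis using v E by (auto simp: irrep_iff)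
qed

text \<open>The spectral projection E of M for one eigenvalue also commutes with the representation,
  so it is 0 or 1. It is not 0 because the eigenvalue occurs; hence it is the only one.\<close>

lemma irrep_commuting_hermitian:
  assumes v: "irrep m v" and M: "M \<in> carrier_mat m m" "adj M = M"
    and comm: "scalar_mat M * rep_mat m v = rep_mat m v * scalar_mat M"
  obtains c where "M = real_diag m (\<lambda>_. c)"
proof -
  obtain U d where U: "unitary_mat m U" and Me: "M = U * real_diag m d * adj U"
    using hermitian_spectral[OF M] by blast
  have Uc: "U \<in> carrier_mat m m" and UU: "adj U * U = 1\<^sub>m m" "U * adj U = 1\<^sub>m m"
    using U by (auto simp: unitary_mat_def)
  have m: "0 < m" using v by (simp add: irrep_iff)
  \<comment> \<open>The indicator of the eigenvalue \<open>d 0\<close>, which exists because an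
    irreducible representation has positive dimension.\<close>
  define g :: "nat \<Rightarrow> real" where "g i = (if d i = d 0 then 1 else 0)" for i
  define E where "E = U * real_diag m g * adj U"
  define V where "V = scalar_mat (adj U) * rep_mat m v * scalar_mat U"
  have V: "V \<in> carrier_mat m m" using Uc by (simp add: V_def mult_square_carrier)
  note assoc = assoc_mult_mat[of _ m m _ m _ m] mult_square_carrier
  have UU1: "adj U * (U * X) = X" "U * (adj U * X) = X" if "X \<in> carrier_mat m m" for X
    using UU Uc that by (simp_all flip: assoc_mult_mat[of _ m m _ m _ m])
  have "scalar_mat (real_diag m d) * V = V * scalar_mat (real_diag m d)"
    using comm unfolding Me V_def by (subst (asm) unitary_conjugate_commutes[OF U]) auto
  then have "scalar_mat (real_diag m g) * V = V * scalar_mat (real_diag m g)"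
    unfolding diag_commuting_iff[OF V] by (auto simp: g_def)
  then have "scalar_mat E * rep_mat m v = rep_mat m v * scalar_mat E"
    unfolding E_def V_def by (subst unitary_conjugate_commutes[OF U]) auto
  moreover have E: "E \<in> carrier_mat m m" "adj E = E"
    using Uc by (simp_all add: E_def adj_mult assoc)
  moreover have "E * E = E"
  proof -
    have "real_diag m g * real_diag m g = real_diag m g"
      unfolding real_diag_mult by (rule arg_cong[of _ _ "real_diag m"]) (auto simp: g_def)
    then have gg: "real_diag m g * (real_diag m g * X) = real_diag m g * X" if "X \<in> carrier_mat m m" for X
      using that by (simp flip: assoc_mult_mat[of _ m m _ m _ m])
    show ?thesis using Uc by (simp add: E_def assoc UU1 gg)
  qed
  ultimately have "E = 0\<^sub>m m m \<or> E = 1\<^sub>m m"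
    using irrep_projection[OF v] by blast
  moreover have g_eq: "real_diag m g = adj U * E * U"
    using Uc by (simp add: E_def assoc UU UU1)
  moreover have "real_diag m g \<noteq> 0\<^sub>m m m"
    using m by (auto simp: mat_eq_iff g_def intro!: exI[of _ 0])
  ultimately have "real_diag m g = 1\<^sub>m m"
    using Uc UU by (auto simp: right_mult_zero_mat[of _ m m] left_mult_zero_mat[of _ m m])
  then have g1: "complex_of_real (g i) = 1" if "i < m" for i
    using that real_diag_index[of i m i g] by simp
  define c where "c = d 0"
  have "d i = c" if "i < m" for i
    using g1[OF that] by (auto simp: g_def c_def split: if_splits)
  then have "real_diag m d = real_diag m (\<lambda>_. c)" by (intro eq_matI) auto
  moreover have "U * real_diag m (\<lambda>_. c) * adj U = real_diag m (\<lambda>_. c)"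
  proof -
    have eq: "U * real_diag m (\<lambda>_. c) = real_diag m (\<lambda>_. c) * U"
      using diag_commuting_iff[OF Uc, of "\<lambda>_. c"] by simp
    show ?thesis unfolding eq using Uc UU by (simp add: assoc_mult_mat[of _ m m _ m _ m])
  qed
  ultimately show thesis using that Me by simp
qed

lemma irrep_commuting_scalar:
  assumes v: "irrep m v" and M: "M \<in> carrier_mat m m"
    and comm: "scalar_mat M * rep_mat m v = rep_mat m v * scalar_mat M"
  obtains c where "\<And>p q. p < m \<Longrightarrow> q < m \<Longrightarrow> M $$ (p, q) = (if p = q then c else 0)"
proof -
  have u: "unitary_mat m (rep_mat m v)" using v by (simp add: irrep_iff unitary_rep_iff)
  have comm': "scalar_mat (adj M) * rep_mat m v = rep_mat m v * scalar_mat (adj M)"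
    by (rule intertwiner_adj[OF u u M comm])
  have V: "rep_mat m v \<in> carrier_mat m m" by simp
  have lin: "scalar_mat (a \<cdot>\<^sub>m M + b \<cdot>\<^sub>m adj M) * rep_mat m v =
      rep_mat m v * scalar_mat (a \<cdot>\<^sub>m M + b \<cdot>\<^sub>m adj M)" for a b
  proof -
    have s: "scalar_mat (a \<cdot>\<^sub>m M + b \<cdot>\<^sub>m adj M) =
        (scalar_mat (a \<cdot>\<^sub>m 1\<^sub>m m) * scalar_mat M + scalar_mat (b \<cdot>\<^sub>m 1\<^sub>m m) * scalar_mat (adj M) :: 'a mat)"
      using M by (intro eq_matI) (simp_all add: scaleC_add_left mult_smult_assoc_mat[of _ m m _ m] flip: scalar_mat_mult)
    have c: "scalar_mat (a \<cdot>\<^sub>m 1\<^sub>m m) * X = X * (scalar_mat (a \<cdot>\<^sub>m 1\<^sub>m m) :: 'a mat)"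
      if "X \<in> carrier_mat m m" for X and a :: complex
      using that by (intro eq_matI) (auto simp: index_mult_mat_sum mult_scaleC_left mult_scaleC_right
          if_distrib[of "\<lambda>x. _ * x"] if_distrib[of "\<lambda>x. x * _"] if_distrib[of "\<lambda>x. x *\<^sub>C _"] cong: if_cong)
    have cc: "scalar_mat (a \<cdot>\<^sub>m 1\<^sub>m m) * (scalar_mat N * rep_mat m v) =
        rep_mat m v * (scalar_mat (a \<cdot>\<^sub>m 1\<^sub>m m) * scalar_mat N)"
      if "scalar_mat N * rep_mat m v = rep_mat m v * scalar_mat N" "N \<in> carrier_mat m m" for N and a :: complex
    proof -
      have "scalar_mat (a \<cdot>\<^sub>m 1\<^sub>m m) * (rep_mat m v * scalar_mat N) =
          (scalar_mat (a \<cdot>\<^sub>m 1\<^sub>m m) * rep_mat m v) * scalar_mat N"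
        using that(2) by (simp add: assoc_mult_mat[of _ m m _ m _ m])
      then show ?thesis
        unfolding that(1) c[OF V] using that(2) by (simp add: assoc_mult_mat[of _ m m _ m _ m])
    qed
    show ?thesis
      unfolding s using M cc[OF comm M, of a] cc[OF comm' , of b]
      by (simp add: add_mult_distrib_mat[of _ m m _ _ m] mult_add_distrib_mat[of _ m m _ m]
          mult_square_carrier assoc_mult_mat[of _ m m _ m _ m])
  qed
  have "adj (1 \<cdot>\<^sub>m M + 1 \<cdot>\<^sub>m adj M) = 1 \<cdot>\<^sub>m M + 1 \<cdot>\<^sub>m adj M"
    "adj (\<i> \<cdot>\<^sub>m M + (- \<i>) \<cdot>\<^sub>m adj M) = \<i> \<cdot>\<^sub>m M + (- \<i>) \<cdot>\<^sub>m adj M"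
    using M by (intro eq_matI; auto simp: algebra_simps)+
  then obtain c1 c2 where c: "1 \<cdot>\<^sub>m M + 1 \<cdot>\<^sub>m adj M = real_diag m (\<lambda>_. c1)"
    "\<i> \<cdot>\<^sub>m M + (- \<i>) \<cdot>\<^sub>m adj M = real_diag m (\<lambda>_. c2)"
    using irrep_commuting_hermitian[OF v _ _ lin] M
    by (metis add_carrier_mat adj_carrier smult_carrier_mat)
  have "M $$ (p, q) = (if p = q then (of_real c1 - \<i> * of_real c2) / 2 else 0)" if "p < m" "q < m" for p q
    using arg_cong[OF c(1), of "\<lambda>A. A $$ (p, q)"] arg_cong[OF c(2), of "\<lambda>A. A $$ (p, q)"] that M
    by (auto simp: complex_eq_iff)
  then show thesis using that by blast
qed

text \<open>By Schur's lemma M M* = a and M* M = b are scalars. The nonzero entry of M gives a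
  \<noteq> 0 and, through M M* M, also a = b; comparing traces then gives equal dimensions, and M*/a
  is the inverse of M.\<close>

lemma irrep_intertwiner_equivalent:
  assumes v: "irrep m v" and w: "irrep m' w" and M: "M \<in> carrier_mat m m'"
    and comm: "scalar_mat M * rep_mat m' w = rep_mat m v * scalar_mat M"
    and nz: "i < m" "j < m'" "M $$ (i, j) \<noteq> 0"
  shows "equivalent_reps m' w m v"
proof -
  define V W where "V = rep_mat m v" and "W = rep_mat m' w"
  have u: "unitary_mat m V" "unitary_mat m' W"
    using v w by (simp_all add: V_def W_def irrep_iff unitary_rep_iff)
  have c: "V \<in> carrier_mat m m" "W \<in> carrier_mat m' m'" "adj M \<in> carrier_mat m' m"
    "(scalar_mat M :: 'a mat) \<in> carrier_mat m m'" "(scalar_mat (adj M) :: 'a mat) \<in> carrier_mat m' m"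
    using M by (auto simp: V_def W_def)
  have comm: "scalar_mat M * W = V * scalar_mat M" using comm by (simp add: V_def W_def)
  have comm': "scalar_mat (adj M) * V = W * scalar_mat (adj M)"
    by (rule intertwiner_adj[OF u M comm])
  note assoc = assoc_mult_mat[of "scalar_mat M" m m' "scalar_mat (adj M)" m V m]
    assoc_mult_mat[of "scalar_mat M" m m' W m' "scalar_mat (adj M)" m]
    assoc_mult_mat[of V m m "scalar_mat M" m' "scalar_mat (adj M)" m]
    assoc_mult_mat[of "scalar_mat (adj M)" m' m "scalar_mat M" m' W m']
    assoc_mult_mat[of "scalar_mat (adj M)" m' m V m "scalar_mat M" m']
    assoc_mult_mat[of W m' m' "scalar_mat (adj M)" m "scalar_mat M" m']
  have 1: "scalar_mat (M * adj M) * V = V * scalar_mat (M * adj M)"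
  proof -
    have "scalar_mat (M * adj M) * V = scalar_mat M * (scalar_mat (adj M) * V)"
      using c M by (simp add: scalar_mat_mult assoc)
    also have "\<dots> = (scalar_mat M * W) * scalar_mat (adj M)"
      using c by (simp add: comm' assoc)
    also have "\<dots> = V * scalar_mat (M * adj M)"
      unfolding comm using c M by (simp add: scalar_mat_mult assoc)
    finally show ?thesis .
  qed
  have 2: "scalar_mat (adj M * M) * W = W * scalar_mat (adj M * M)"
  proof -
    have "scalar_mat (adj M * M) * W = scalar_mat (adj M) * (scalar_mat M * W)"
      using c M by (simp add: scalar_mat_mult assoc)
    also have "\<dots> = (scalar_mat (adj M) * V) * scalar_mat M"
      using c by (simp add: comm assoc)
    also have "\<dots> = W * scalar_mat (adj M * M)"
      unfolding comm' using c M by (simp add: scalar_mat_mult assoc)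
    finally show ?thesis .
  qed
  obtain a where a: "\<And>p q. p < m \<Longrightarrow> q < m \<Longrightarrow> (M * adj M) $$ (p, q) = (if p = q then a else 0)"
    using irrep_commuting_scalar[OF v _ 1[unfolded V_def]] M c by (metis mult_carrier_mat)
  obtain b where b: "\<And>p q. p < m' \<Longrightarrow> q < m' \<Longrightarrow> (adj M * M) $$ (p, q) = (if p = q then b else 0)"
    using irrep_commuting_scalar[OF w _ 2[unfolded W_def]] M c by (metis mult_carrier_mat)
  have a_sum: "(\<Sum>k<m'. M $$ (p, k) * cnj (M $$ (q, k))) = (if p = q then a else 0)" if "p < m" "q < m" for p q
    using a[OF that] that M by (simp add: index_mult_mat_sum)
  have b_sum: "(\<Sum>k<m. cnj (M $$ (k, p)) * M $$ (k, q)) = (if p = q then b else 0)" if "p < m'" "q < m'" for p q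
    using b[OF that] that M by (simp add: index_mult_mat_sum)
  have a0: "a \<noteq> 0"
  proof
    assume "a = 0"
    then have "(\<Sum>k<m'. complex_of_real ((cmod (M $$ (i, k)))\<^sup>2)) = 0"
      unfolding complex_norm_square using a_sum[OF nz(1) nz(1)] by simp
    then have "(\<Sum>k<m'. (cmod (M $$ (i, k)))\<^sup>2) = 0"
      by (metis of_real_eq_0_iff of_real_sum)
    then show False using nz by (simp add: sum_nonneg_eq_0_iff)
  qed
  have ab: "a = b"
  proof -
    have "a * M $$ (i, j) = (\<Sum>k<m. (\<Sum>l<m'. M $$ (i, l) * cnj (M $$ (k, l))) * M $$ (k, j))"
      using nz by (simp add: a_sum if_distrib[of "\<lambda>x. x * _"] cong: if_cong)
    also have "\<dots> = (\<Sum>l<m'. M $$ (i, l) * (\<Sum>k<m. cnj (M $$ (k, l)) * M $$ (k, j)))"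
      by (simp add: sum_distrib_left sum_distrib_right mult.assoc) (rule sum.swap)
    also have "\<dots> = b * M $$ (i, j)"
      using nz by (simp add: b_sum if_distrib[of "\<lambda>x. _ * x"] cong: if_cong)
    finally show ?thesis using nz by simp
  qed
  have "of_nat m * a = (\<Sum>p<m. \<Sum>k<m'. M $$ (p, k) * cnj (M $$ (p, k)))"
    by (simp add: a_sum)
  also have "\<dots> = (\<Sum>k<m'. \<Sum>p<m. cnj (M $$ (p, k)) * M $$ (p, k))"
    by (subst sum.swap) (simp add: mult.commute)
  also have "\<dots> = of_nat m' * a" by (simp add: b_sum ab)
  finally have mm: "m' = m" using a0 by simp
  have inv: "(\<Sum>k<m'. M $$ (p, k) * (cnj (M $$ (q, k)) / a)) = (if p = q then 1 else 0)"
    "(\<Sum>k<m'. cnj (M $$ (k, p)) / a * M $$ (k, q)) = (if p = q then 1 else 0)"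
    if "p < m'" "q < m'" for p q
    using a_sum[of p q] b_sum[of p q] that a0 by (simp_all add: mm ab flip: sum_divide_distrib)
  have "(\<Sum>k<m'. M $$ (p, k) *\<^sub>C w k q) = (\<Sum>k<m'. M $$ (k, q) *\<^sub>C v p k)"
    if "p < m'" "q < m'" for p q
  proof -
    have "(scalar_mat M * W) $$ (p, q) = (V * scalar_mat M) $$ (p, q)"
      by (simp add: comm)
    then show ?thesis
      using that M by (simp add: index_mult_mat_sum V_def W_def mm mult_scaleC_left mult_scaleC_right)
  qed
  then show ?thesis
    by (intro equivalent_repsI[where s = "\<lambda>p q. M $$ (p, q)" and t = "\<lambda>p q. cnj (M $$ (q, p)) / a"] mm inv)
qed

text \<open>Since V has no entries between J and its complement, every sum over all indices reduces
  to one over J; \<open>f\<close> renumbers J as an initial segment.\<close>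

lemma rep_block:
  assumes V: "corep m V" "unitary_mat m V" and J: "J \<subseteq> {..<m}"
    and block: "\<And>i j. i < m \<Longrightarrow> j < m \<Longrightarrow> (i \<in> J) \<noteq> (j \<in> J) \<Longrightarrow> V $$ (i, j) = 0"
    and f: "bij_betw f {..<k} J"
  shows "rep k (\<lambda>p q. V $$ (f p, f q))"
proof -
  have Vc: "V \<in> carrier_mat m m" using V by (simp add: corep_def)
  have fJ: "f p \<in> J" "f p < m" if "p < k" for p
    using f J that by (auto simp: bij_betw_def)
  have f_eq: "f p = f q \<longleftrightarrow> p = q" if "p < k" "q < k" for p q
    using f that by (auto simp: bij_betw_def inj_on_def)
  have red: "(\<Sum>l<m. g l) = (\<Sum>l<k. g (f l))" if "\<And>l. l < m \<Longrightarrow> l \<notin> J \<Longrightarrow> g l = 0"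
    for g :: "nat \<Rightarrow> 'z::comm_monoid_add"
  proof -
    have "(\<Sum>l<m. g l) = (\<Sum>l\<in>J. g l)"
      by (rule sum.mono_neutral_right) (use J that in auto)
    then show ?thesis by (simp add: sum.reindex_bij_betw[OF f])
  qed
  show ?thesis
    unfolding unitary_rep_def
  proof (intro conjI allI impI)
    fix p q assume pq: "p < k" "q < k"
    have "\<Phi> (V $$ (f p, f q)) = (\<Sum>l<m. ten (V $$ (f p, l)) (V $$ (l, f q)))"
      using V fJ pq by (simp add: corep_def)
    also have "\<dots> = (\<Sum>l<k. ten (V $$ (f p, f l)) (V $$ (f l, f q)))"
      by (rule red) (use fJ[OF pq(1)] block in \<open>simp add: ten_zero_left\<close>)
    finally show "\<Phi> (V $$ (f p, f q)) = (\<Sum>l<k. ten (V $$ (f p, f l)) (V $$ (f l, f q)))" .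
    have "(\<Sum>l<k. star (V $$ (f l, f p)) * V $$ (f l, f q)) = (\<Sum>l<m. star (V $$ (l, f p)) * V $$ (l, f q))"
      by (rule red[symmetric]) (use fJ[OF pq(1)] block in simp)
    also have "\<dots> = (adj V * V) $$ (f p, f q)"
      using Vc fJ pq by (simp add: index_mult_mat_sum)
    finally show "(\<Sum>l<k. star (V $$ (f l, f p)) * V $$ (f l, f q)) = (if p = q then 1 else 0)"
      using V fJ pq by (simp add: unitary_mat_def f_eq)
    have "(\<Sum>l<k. V $$ (f p, f l) * star (V $$ (f q, f l))) = (\<Sum>l<m. V $$ (f p, l) * star (V $$ (f q, l)))"
      by (rule red[symmetric]) (use fJ[OF pq(1)] block in simp)
    also have "\<dots> = (V * adj V) $$ (f p, f q)"
      using Vc fJ pq by (simp add: index_mult_mat_sum)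
    finally show "(\<Sum>l<k. V $$ (f p, f l) * star (V $$ (f q, f l))) = (if p = q then 1 else 0)"
      using V fJ pq by (simp add: unitary_mat_def f_eq)
  qed
qed

lemma span_sandwich:
  assumes V: "V \<in> carrier_mat m m" and A: "A \<in> carrier_mat m m" and B: "B \<in> carrier_mat m m"
    and sp: "\<And>p q. p < m \<Longrightarrow> q < m \<Longrightarrow> V $$ (p, q) \<in> cspan S" and pq: "p < m" "q < m"
  shows "(scalar_mat A * V * scalar_mat B) $$ (p, q) \<in> cspan S"
proof -
  have "(scalar_mat A * V * scalar_mat B) $$ (p, q) =
      (\<Sum>l<m. B $$ (l, q) *\<^sub>C (\<Sum>k<m. A $$ (p, k) *\<^sub>C V $$ (k, l)))"
    using V A B pq by (simp add: index_mult_mat_sum mult_scaleC_left mult_scaleC_right)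
  also have "\<dots> \<in> cspan S"
    using sp by (intro cvec.span_sum cvec.span_scale) auto
  finally show ?thesis .
qed

lemma unitary_mat_similar:
  fixes V :: "'a mat"
  assumes V: "unitary_mat m V" and U: "unitary_mat m U"
  shows "unitary_mat m (scalar_mat (adj U) * V * scalar_mat U)"
proof -
  have Uc: "U \<in> carrier_mat m m" using U by (simp add: unitary_mat_def)
  have "unitary_mat m (scalar_mat U :: 'a mat)"
    using U Uc scalar_mat_mult[of U "adj U", where 'a = 'a] scalar_mat_mult[of "adj U" U, where 'a = 'a]
    by (auto simp: unitary_mat_def scalar_mat_adj)
  moreover from this have "unitary_mat m (scalar_mat (adj U) :: 'a mat)"
    by (simp add: unitary_mat_def flip: scalar_mat_adj)
  ultimately show ?thesis using V by (intro unitary_mat_mult)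
qed

text \<open>In an eigenbasis of an invariant projection the representation is block diagonal with
  two smaller unitary blocks. Only membership in a span is recorded, which is the form of complete
  reducibility that an induction on the dimension can use.\<close>

lemma reducible_rep_decomposition:
  assumes v: "rep m v" and m: "0 < m" and red: "\<not> irrep m v"
    and smaller: "\<And>k w p q. k < m \<Longrightarrow> rep k w \<Longrightarrow> p < k \<Longrightarrow> q < k \<Longrightarrow> w p q \<in> cspan S"
    and pq: "p < m" "q < m"
  shows "v p q \<in> cspan S"
proof -
  obtain E where E: "E \<in> carrier_mat m m" "adj E = E" "E * E = E" "E \<noteq> 0\<^sub>m m m" "E \<noteq> 1\<^sub>m m"
    and inv: "scalar_mat E * rep_mat m v * scalar_mat E = rep_mat m v * scalar_mat E"
    using v m red unfolding irrep_iff by blast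
  have comm: "scalar_mat E * rep_mat m v = rep_mat m v * scalar_mat E"
    by (rule invariant_projection_commutes[OF v E(1-3) inv])
  obtain U d where U: "unitary_mat m U" and Ee: "E = U * real_diag m d * adj U"
    using hermitian_spectral[OF E(1,2)] by blast
  have Uc: "U \<in> carrier_mat m m" and UU: "adj U * U = 1\<^sub>m m" "U * adj U = 1\<^sub>m m"
    using U by (auto simp: unitary_mat_def)
  note assoc = assoc_mult_mat[of _ m m _ m _ m] mult_square_carrier
  have UU1: "adj U * (U * X) = X" "U * (adj U * X) = X" if "X \<in> carrier_mat m m" for X
    using UU Uc that by (simp_all flip: assoc_mult_mat[of _ m m _ m _ m])
  have De: "real_diag m d = adj U * E * U"
    using Uc by (simp add: Ee assoc UU UU1)
  have "real_diag m d * real_diag m d = adj U * (E * E) * U"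
    unfolding De using Uc E(1) by (simp add: assoc UU1 del: E(3))
  then have dd: "real_diag m d * real_diag m d = real_diag m d" by (simp add: E(3) De)
  have d01: "d i = 0 \<or> d i = 1" if "i < m" for i
  proof -
    have "complex_of_real (d i * d i) = of_real (d i)"
      using that arg_cong[OF dd, of "\<lambda>A. A $$ (i, i)"] by (simp add: real_diag_mult)
    then have "d i * d i = d i" by (simp only: of_real_eq_iff)
    then show ?thesis by simp
  qed
  define W where "W = scalar_mat (adj U) * rep_mat m v * scalar_mat U"
  have W: "corep m W" "unitary_mat m W"
    using corep_similar[OF corep_rep_mat[OF v], of "adj U" U] unitary_mat_similar[OF _ U] v Uc UU
    by (auto simp: W_def unitary_rep_iff)
  then have Wc: "W \<in> carrier_mat m m" by (simp add: corep_def)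
  have "scalar_mat (real_diag m d) * W = W * scalar_mat (real_diag m d)"
    using comm unfolding Ee W_def by (subst (asm) unitary_conjugate_commutes[OF U]) auto
  then have W0: "W $$ (i, j) = 0" if "i < m" "j < m" "d i \<noteq> d j" for i j
    using that unfolding diag_commuting_iff[OF Wc] by blast
  have W_span: "W $$ (i, j) \<in> cspan S" if ij: "i < m" "j < m" for i j
  proof (cases "d i = d j")
    case True
    define J where "J = {l. l < m \<and> d l = d i}"
    have JM: "J \<subseteq> {..<m}" and fin: "finite J" by (auto simp: J_def)
    obtain f where f: "bij_betw f {..<card J} J"
      using ex_bij_betw_nat_finite[OF fin] by (auto simp: lessThan_atLeast0)
    \<comment> \<open>Were \<open>d\<close> constant, then E would be 0 or 1, as \<open>d\<close>
      takes only these two values.\<close>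
    have "J \<noteq> {..<m}"
    proof
      assume "J = {..<m}"
      then have all: "d l = d i" if "l < m" for l using that by (auto simp: J_def)
      have "real_diag m d = 0\<^sub>m m m \<or> real_diag m d = 1\<^sub>m m"
        using d01[OF ij(1)] all by (auto simp: mat_eq_iff)
      moreover have "E = U * real_diag m d * adj U" by (rule Ee)
      ultimately show False
        using E(4,5) Uc UU by (auto simp: right_mult_zero_mat[of _ m m] left_mult_zero_mat[of _ m m])
    qed
    then have card: "card J < m"
      using psubset_card_mono[of "{..<m}" J] JM by auto
    obtain a b where ab: "a < card J" "b < card J" "f a = i" "f b = j"
    proof -
      have "i \<in> f ` {..<card J}" "j \<in> f ` {..<card J}"
        using f ij True by (auto simp: bij_betw_def J_def)
      then show ?thesis using that by blast
    qed
    have "rep (card J) (\<lambda>p q. W $$ (f p, f q))"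
      by (rule rep_block[OF W JM _ f]) (use W0 in \<open>auto simp: J_def\<close>)
    from smaller[OF card this ab(1,2)] show ?thesis by (simp add: ab)
  next
    case False
    then show ?thesis using W0 ij by (simp add: cvec.span_zero)
  qed
  have "rep_mat m v = scalar_mat U * W * scalar_mat (adj U)"
  proof -
    have s: "scalar_mat U * scalar_mat (adj U) = (1\<^sub>m m :: 'a mat)"
      using UU Uc scalar_mat_mult[of U "adj U", where 'a = 'a] by simp
    have "scalar_mat U * W * scalar_mat (adj U) =
        (scalar_mat U * scalar_mat (adj U)) * rep_mat m v * (scalar_mat U * scalar_mat (adj U))"
      using Uc by (simp add: W_def assoc)
    then show ?thesis unfolding s by simp
  qed
  then have "v p q = (scalar_mat U * W * scalar_mat (adj U)) $$ (p, q)"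
    using pq by (metis rep_mat_index)
  then show ?thesis
    using span_sandwich[OF Wc Uc _ W_span pq, of "adj U"] Uc by simp
qed

end

section \<open>Matrix elements of the irreducible representations\<close>

locale haar_quantum_group_irreps = haar_quantum_group ten \<Phi> h L R
  for ten :: "'a::unital_cstar_algebra \<Rightarrow> 'a \<Rightarrow> 't::unital_cstar_algebra"
    and \<Phi> :: "'a \<Rightarrow> 't" and h :: "'a \<Rightarrow> complex" and L R :: "'t \<Rightarrow> 'a" +
  fixes I :: "'i set" and n :: "'i \<Rightarrow> nat" and u :: "'i \<Rightarrow> nat \<Rightarrow> nat \<Rightarrow> 'a"
  assumes irreps: "complete_irreps ten \<Phi> I n u"
begin

abbreviation "A\<^sub>0 \<equiv> hopf_algebra_of ten \<Phi>"

definition U where "U = {u \<alpha> p q |\<alpha> p q. \<alpha> \<in> I \<and> p < n \<alpha> \<and> q < n \<alpha>}"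

lemma irrep_u: "\<alpha> \<in> I \<Longrightarrow> irrep (n \<alpha>) (u \<alpha>)"
  and inequivalent_u: "\<alpha> \<in> I \<Longrightarrow> \<beta> \<in> I \<Longrightarrow> \<alpha> \<noteq> \<beta> \<Longrightarrow> \<not> equivalent_reps (n \<alpha>) (u \<alpha>) (n \<beta>) (u \<beta>)"
  and complete_u: "irrep m v \<Longrightarrow> \<exists>\<alpha>\<in>I. equivalent_reps m v (n \<alpha>) (u \<alpha>)"
  using irreps by (auto simp: complete_irreps_def)

lemma rep_u: "\<alpha> \<in> I \<Longrightarrow> rep (n \<alpha>) (u \<alpha>)" and n_pos: "\<alpha> \<in> I \<Longrightarrow> 0 < n \<alpha>"
  using irrep_u by (auto simp: irrep_iff)

text \<open>Strong induction on the dimension: an irreducible representation is similar to some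
  \<open>u \<alpha>\<close>, any other one splits into smaller blocks.\<close>

lemma rep_in_span_U: "rep m v \<Longrightarrow> p < m \<Longrightarrow> q < m \<Longrightarrow> v p q \<in> cspan U"
proof (induction m arbitrary: v p q rule: less_induct)
  case (less m)
  show ?case
  proof (cases "irrep m v")
    case True
    then obtain \<alpha> where \<alpha>: "\<alpha> \<in> I" "equivalent_reps m v (n \<alpha>) (u \<alpha>)"
      using complete_u by blast
    then obtain s t :: "nat \<Rightarrow> nat \<Rightarrow> complex" where m: "m = n \<alpha>"
      and ts: "\<And>p q. p < m \<Longrightarrow> q < m \<Longrightarrow> (\<Sum>k<m. t p k * s k q) = (if p = q then 1 else 0)"
      and sv: "\<And>p q. p < m \<Longrightarrow> q < m \<Longrightarrow> (\<Sum>k<m. s p k *\<^sub>C v k q) = (\<Sum>k<m. s k q *\<^sub>C u \<alpha> p k)"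
      unfolding equivalent_reps_def by blast
    have "(\<Sum>k<m. t p k *\<^sub>C (\<Sum>l<m. s l q *\<^sub>C u \<alpha> k l)) = (\<Sum>k<m. t p k *\<^sub>C (\<Sum>l<m. s k l *\<^sub>C v l q))"
      using less.prems by (intro sum.cong refl) (simp add: sv)
    also have "\<dots> = (\<Sum>l<m. (\<Sum>k<m. t p k * s k l) *\<^sub>C v l q)"
      by (simp add: scaleC_sum_left scaleC_sum_right scaleC_scaleC) (rule sum.swap)
    also have "\<dots> = (\<Sum>l<m. if p = l then v l q else 0)"
      using less.prems by (intro sum.cong) (auto simp: ts)
    also have "\<dots> = v p q" using less.prems by simp
    finally have "v p q = (\<Sum>k<m. t p k *\<^sub>C (\<Sum>l<m. s l q *\<^sub>C u \<alpha> k l))" ..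
    also have "\<dots> \<in> cspan U"
      using \<alpha> m by (intro cvec.span_sum cvec.span_scale cvec.span_base) (auto simp: U_def)
    finally show ?thesis .
  next
    case False
    show ?thesis
    proof (rule reducible_rep_decomposition[OF less.prems(1) _ False _ less.prems(2,3)])
      show "w p q \<in> cspan U" if "k < m" "rep k w" "p < k" "q < k" for k w p q
        using less.IH that by blast
    qed (use less.prems in auto)
  qed
qed

lemma A0_eq: "A\<^sub>0 = cspan U"
proof
  show "A\<^sub>0 \<subseteq> cspan U"
    unfolding hopf_algebra_of_def
    by (rule cvec.span_minimal) (auto simp: rep_in_span_U cvec.subspace_span)
  show "cspan U \<subseteq> A\<^sub>0"
    unfolding hopf_algebra_of_def U_def
    by (rule cvec.span_mono) (use rep_u in blast)
qed

lemma rep_in_A0: "rep m v \<Longrightarrow> p < m \<Longrightarrow> q < m \<Longrightarrow> v p q \<in> A\<^sub>0"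
  by (simp add: A0_eq rep_in_span_U)

lemma u_in_A0: "\<alpha> \<in> I \<Longrightarrow> p < n \<alpha> \<Longrightarrow> q < n \<alpha> \<Longrightarrow> u \<alpha> p q \<in> A\<^sub>0"
  using rep_in_A0[OF rep_u] .

lemma A0_zero: "0 \<in> A\<^sub>0" and A0_add: "x \<in> A\<^sub>0 \<Longrightarrow> y \<in> A\<^sub>0 \<Longrightarrow> x + y \<in> A\<^sub>0"
  and A0_scaleC: "x \<in> A\<^sub>0 \<Longrightarrow> c *\<^sub>C x \<in> A\<^sub>0"
  and A0_sum: "(\<And>i. i \<in> K \<Longrightarrow> g i \<in> A\<^sub>0) \<Longrightarrow> (\<Sum>i\<in>K. g i) \<in> A\<^sub>0"
  by (auto simp: A0_eq intro: cvec.span_zero cvec.span_add cvec.span_scale cvec.span_sum)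

end

section \<open>Tensor products of representations, and intertwiners from the Haar state\<close>

lemma sum_lessThan_mult_div_mod:
  "(\<Sum>K<m * m'. f (K div m') (K mod m')) = (\<Sum>a<m. \<Sum>b<m'. f a (b :: nat))"
proof (cases "m' = 0")
  case False
  have "(\<Sum>K<m * m'. f (K div m') (K mod m')) = (\<Sum>a<m. \<Sum>K\<in>{a * m'..<a * m' + m'}. f (K div m') (K mod m'))"
    by (simp add: sum.nat_group)
  also have "\<dots> = (\<Sum>a<m. \<Sum>b<m'. f a b)"
  proof (rule sum.cong[OF refl])
    fix a
    have "(\<Sum>K\<in>{a * m'..<a * m' + m'}. f (K div m') (K mod m')) =
        (\<Sum>b\<in>{0..<m'}. f ((b + a * m') div m') ((b + a * m') mod m'))"
      using sum.shift_bounds_nat_ivl[of "\<lambda>K. f (K div m') (K mod m')" 0 "a * m'" m']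
      by (simp add: add.commute)
    also have "\<dots> = (\<Sum>b<m'. f a b)"
      using False by (intro sum.cong) (auto simp: lessThan_atLeast0)
    finally show "(\<Sum>K\<in>{a * m'..<a * m' + m'}. f (K div m') (K mod m')) = (\<Sum>b<m'. f a b)" .
  qed
  finally show ?thesis .
qed simp

lemma nonneg_Reals_Re_pos: "z \<in> \<real>\<^sub>\<ge>\<^sub>0 \<Longrightarrow> z \<noteq> 0 \<Longrightarrow> 0 < Re z"
  by (auto simp: nonneg_Reals_def)

context haar_quantum_group
begin

text \<open>Rows and columns are numbered, so the pair (p, r) is encoded as p * m' + r.\<close>

definition tensor_rep :: "nat \<Rightarrow> (nat \<Rightarrow> nat \<Rightarrow> 'a) \<Rightarrow> (nat \<Rightarrow> nat \<Rightarrow> 'a) \<Rightarrow> nat \<Rightarrow> nat \<Rightarrow> 'a"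
  where "tensor_rep m' v w = (\<lambda>P Q. v (P div m') (Q div m') * w (P mod m') (Q mod m'))"

lemma rep_tensor_rep:
  assumes v: "rep m v" and w: "rep m' w"
  shows "rep (m * m') (tensor_rep m' v w)"
  unfolding unitary_rep_def
proof (intro conjI allI impI)
  fix P Q assume PQ: "P < m * m'" "Q < m * m'"
  define p r q s where "p = P div m'" and "r = P mod m'" and "q = Q div m'" and "s = Q mod m'"
  have "m' > 0" using PQ by (cases m') auto
  then have b: "p < m" "r < m'" "q < m" "s < m'"
    using PQ by (auto simp: p_def r_def q_def s_def less_mult_imp_div_less)
  have eq: "P = Q \<longleftrightarrow> p = q \<and> r = s"
    unfolding p_def q_def r_def s_def by (metis div_mult_mod_eq)
  note red = sum_lessThan_mult_div_mod[where m = m and m' = m']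
  show "\<Phi> (tensor_rep m' v w P Q) = (\<Sum>k<m * m'. ten (tensor_rep m' v w P k) (tensor_rep m' v w k Q))"
    using b unfolding tensor_rep_def p_def[symmetric] q_def[symmetric] r_def[symmetric] s_def[symmetric]
    by (simp add: red[of "\<lambda>a b. ten (v p a * w r b) (v a q * w b s)"] \<Phi>_mult rep_\<Phi>[OF v] rep_\<Phi>[OF w]
        sum_product ten_mult)
  have "(\<Sum>k<m * m'. star (tensor_rep m' v w k P) * tensor_rep m' v w k Q) =
      (\<Sum>a<m. \<Sum>b<m'. star (v a p * w b r) * (v a q * w b s))"
    unfolding tensor_rep_def p_def[symmetric] q_def[symmetric] r_def[symmetric] s_def[symmetric]
    by (rule red)
  \<comment> \<open>The entries do not commute: here the factors of v stand inside and are summed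
    first, for the other unitarity relation those of w.\<close>
  also have "\<dots> = (\<Sum>b<m'. star (w b r) * (\<Sum>a<m. star (v a p) * v a q) * w b s)"
    by (subst sum.swap) (simp add: star_mult sum_distrib_left sum_distrib_right mult.assoc)
  also have "\<dots> = (if P = Q then 1 else 0)"
    using b by (simp add: rep_unitary_left[OF v] rep_unitary_left[OF w] eq)
  finally show "(\<Sum>k<m * m'. star (tensor_rep m' v w k P) * tensor_rep m' v w k Q) = (if P = Q then 1 else 0)" .
  have "(\<Sum>k<m * m'. tensor_rep m' v w P k * star (tensor_rep m' v w Q k)) =
      (\<Sum>a<m. \<Sum>b<m'. (v p a * w r b) * star (v q a * w s b))"
    unfolding tensor_rep_def p_def[symmetric] q_def[symmetric] r_def[symmetric] s_def[symmetric]
    by (rule red)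
  also have "\<dots> = (\<Sum>a<m. v p a * (\<Sum>b<m'. w r b * star (w s b)) * star (v q a))"
    by (simp add: star_mult sum_distrib_left sum_distrib_right mult.assoc)
  also have "\<dots> = (if P = Q then 1 else 0)"
    using b by (simp add: rep_unitary_right[OF v] rep_unitary_right[OF w] eq)
  finally show "(\<Sum>k<m * m'. tensor_rep m' v w P k * star (tensor_rep m' v w Q k)) = (if P = Q then 1 else 0)" .
qed

lemma tensor_rep_entry:
  assumes "p < m" "q < m" "r < m'" "s < m'"
  shows "p * m' + r < m * m'" "q * m' + s < m * m'"
    "tensor_rep m' v w (p * m' + r) (q * m' + s) = v p q * w r s"
proof -
  have bound: "a * m' + b < m * m'" if "a < m" "b < m'" for a b
  proof -
    have "a * m' + b < Suc a * m'" using that by simp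
    also have "\<dots> \<le> m * m'" using that by (intro mult_le_mono) auto
    finally show ?thesis .
  qed
  then show "p * m' + r < m * m'" "q * m' + s < m * m'" using assms by auto
  show "tensor_rep m' v w (p * m' + r) (q * m' + s) = v p q * w r s"
    using assms by (simp add: tensor_rep_def)
qed

text \<open>Slicing \<Phi> of \<open>star (v p q) * w r s\<close> by \<open>R\<close> turns
  invariance into V* M W = M; multiplication by V gives the intertwining relation.\<close>

lemma haar_intertwiner_left:
  assumes v: "rep m v" and w: "rep m' w" and pr: "p < m" "r < m'"
  shows "scalar_mat (mat m m' (\<lambda>(q, s). h (star (v p q) * w r s))) * rep_mat m' w =
    rep_mat m v * scalar_mat (mat m m' (\<lambda>(q, s). h (star (v p q) * w r s)))" (is "scalar_mat ?M * ?W = ?V * _")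
proof -
  have M: "?M \<in> carrier_mat m m'" by simp
  have "adj ?V * (scalar_mat ?M * ?W) = scalar_mat ?M"
  proof (rule eq_matI)
    fix q s assume "q < dim_row (scalar_mat ?M :: 'a mat)" "s < dim_col (scalar_mat ?M :: 'a mat)"
    then have qs: "q < m" "s < m'" by auto
    have "(adj ?V * (scalar_mat ?M * ?W)) $$ (q, s) =
        (\<Sum>k<m. \<Sum>l<m'. h (star (v p k) * w r l) *\<^sub>C (star (v k q) * w l s))"
      using qs by (simp add: index_mult_mat_sum sum_distrib_left mult_scaleC_left mult_scaleC_right)
    also have "\<dots> = R (\<Phi> (star (v p q) * w r s))"
      using qs pr by (simp add: \<Phi>_mult \<Phi>_star rep_\<Phi>[OF v] rep_\<Phi>[OF w] star_sum ten_star
          sum_product ten_mult R_sum R_ten)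
    also have "\<dots> = scalar_mat ?M $$ (q, s)"
      using qs by (simp add: R_\<Phi>)
    finally show "(adj ?V * (scalar_mat ?M * ?W)) $$ (q, s) = scalar_mat ?M $$ (q, s)" .
  qed auto
  then have "?V * scalar_mat ?M = ?V * (adj ?V * (scalar_mat ?M * ?W))" by simp
  also have "\<dots> = (?V * adj ?V) * (scalar_mat ?M * ?W)"
    using M by (subst assoc_mult_mat[of _ m m _ m _ m']) (auto intro!: mult_carrier_mat[of _ m m'])
  also have "\<dots> = scalar_mat ?M * ?W"
    using M rep_unitary_mat[OF v] by (simp add: unitary_mat_def left_mult_one_mat[of _ m m'] mult_carrier_mat[of _ m m'])
  finally show ?thesis ..
qed

text \<open>Here the slice \<open>L\<close> gives V M W* = M, with the column indices fixed and the
  row indices running.\<close>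

lemma haar_intertwiner_right:
  assumes v: "rep m v" and w: "rep m' w" and qs: "q < m" "s < m'"
  shows "scalar_mat (mat m m' (\<lambda>(p, r). h (v p q * star (w r s)))) * rep_mat m' w =
    rep_mat m v * scalar_mat (mat m m' (\<lambda>(p, r). h (v p q * star (w r s))))" (is "scalar_mat ?M * ?W = ?V * _")
proof -
  have M: "?M \<in> carrier_mat m m'" by simp
  have "?V * scalar_mat ?M * adj ?W = scalar_mat ?M"
  proof (rule eq_matI)
    fix p r assume "p < dim_row (scalar_mat ?M :: 'a mat)" "r < dim_col (scalar_mat ?M :: 'a mat)"
    then have pr: "p < m" "r < m'" by auto
    have "(?V * scalar_mat ?M * adj ?W) $$ (p, r) =
        (\<Sum>k<m'. \<Sum>l<m. h (v l q * star (w k s)) *\<^sub>C (v p l * star (w r k)))"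
      using pr by (simp add: index_mult_mat_sum sum_distrib_right mult_scaleC_left mult_scaleC_right)
    also have "\<dots> = L (\<Phi> (v p q * star (w r s)))"
      using qs pr by (subst sum.swap) (simp add: \<Phi>_mult \<Phi>_star rep_\<Phi>[OF v] rep_\<Phi>[OF w] star_sum ten_star
          sum_product ten_mult L_sum L_ten)
    also have "\<dots> = scalar_mat ?M $$ (p, r)"
      using pr by (simp add: L_\<Phi>)
    finally show "(?V * scalar_mat ?M * adj ?W) $$ (p, r) = scalar_mat ?M $$ (p, r)" .
  qed auto
  then have "scalar_mat ?M * ?W = ?V * scalar_mat ?M * adj ?W * ?W" by simp
  also have "\<dots> = ?V * scalar_mat ?M * (adj ?W * ?W)"
    using M by (subst assoc_mult_mat[of _ m m' _ m' _ m']) (auto intro!: mult_carrier_mat[of _ m m])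
  also have "\<dots> = ?V * scalar_mat ?M"
    using M rep_unitary_mat[OF w] by (simp add: unitary_mat_def right_mult_one_mat[of _ m m'] mult_carrier_mat[of _ m m])
  finally show ?thesis .
qed

end

lemma mat_mult_ind_tensor:
  "mat_mult (ind_tensor J1 J2) x y (k, l) i j =
    (\<Sum>c\<in>J1 k. \<Sum>d\<in>J2 l. x (k, l) i (c, d) * y (k, l) (c, d) j)"
  by (simp add: mat_mult_def ind_tensor_def sum.cartesian_product')

lemma finite_mat_sum_supp:
  assumes "x \<in> mat_sum K J" "\<And>k. finite (J k)"
  shows "finite {(k, i, j). x k i j \<noteq> 0}"
proof (rule finite_subset)
  show "{(k, i, j). x k i j \<noteq> 0} \<subseteq> (SIGMA k:{k. x k \<noteq> (\<lambda>i j. 0)}. J k \<times> J k)"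
    using assms by (auto simp: mat_sum_def mat_prod_def)
  show "finite (SIGMA k:{k. x k \<noteq> (\<lambda>i j. 0)}. J k \<times> J k)"
    using assms by (auto simp: mat_sum_def)
qed

lemma mat_unit_index: "mat_unit k i j k' i' j' = (if k' = k \<and> i' = i \<and> j' = j then 1 else 0)"
  by (simp add: mat_unit_def)

section \<open>Orthogonality relations and closure under the involution\<close>

context haar_quantum_group_irreps
begin

text \<open>By Schur's lemma the second index does not matter as long as it is the same in both
  factors, so 0 represents all of them; for \<open>Q'\<close> this holds for the first
  index.\<close>

definition Q where "Q \<alpha> p r = h (star (u \<alpha> p 0) * u \<alpha> r 0)"
definition Q' where "Q' \<alpha> q s = h (u \<alpha> 0 q * star (u \<alpha> 0 s))"
abbreviation "Q_mat \<alpha> \<equiv> mat (n \<alpha>) (n \<alpha>) (\<lambda>(p, r). Q \<alpha> p r)"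
abbreviation "Q'_mat \<alpha> \<equiv> mat (n \<alpha>) (n \<alpha>) (\<lambda>(q, s). Q' \<alpha> q s)"

lemma intertwiner_u_scalar:
  assumes \<alpha>\<beta>: "\<alpha> \<in> I" "\<beta> \<in> I" and M: "M \<in> carrier_mat (n \<alpha>) (n \<beta>)"
    and comm: "scalar_mat M * rep_mat (n \<beta>) (u \<beta>) = rep_mat (n \<alpha>) (u \<alpha>) * scalar_mat M"
    and pq: "p < n \<alpha>" "q < n \<beta>"
  shows "M $$ (p, q) = (if \<alpha> = \<beta> \<and> p = q then M $$ (0, 0) else 0)"
proof (cases "\<alpha> = \<beta>")
  case True
  obtain c where "\<And>p q. p < n \<alpha> \<Longrightarrow> q < n \<alpha> \<Longrightarrow> M $$ (p, q) = (if p = q then c else 0)"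
    using irrep_commuting_scalar[OF irrep_u[OF \<alpha>\<beta>(1)]] M comm True by blast
  then show ?thesis using True pq n_pos[OF \<alpha>\<beta>(1)] by simp
next
  case False
  then show ?thesis
    using irrep_intertwiner_equivalent[OF irrep_u[OF \<alpha>\<beta>(1)] irrep_u[OF \<alpha>\<beta>(2)] M comm pq]
      inequivalent_u[OF \<alpha>\<beta>(2,1)] by auto
qed

lemma orthogonality_left:
  assumes "\<alpha> \<in> I" "\<beta> \<in> I" "p < n \<alpha>" "q < n \<alpha>" "r < n \<beta>" "s < n \<beta>"
  shows "h (star (u \<alpha> p q) * u \<beta> r s) = (if \<alpha> = \<beta> \<and> q = s then Q \<alpha> p r else 0)"
  using intertwiner_u_scalar[OF assms(1,2) _ haar_intertwiner_left[OF rep_u rep_u], of p r q s] assms n_pos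
  by (auto simp: Q_def)

lemma orthogonality_right:
  assumes "\<alpha> \<in> I" "\<beta> \<in> I" "p < n \<alpha>" "q < n \<alpha>" "r < n \<beta>" "s < n \<beta>"
  shows "h (u \<alpha> p q * star (u \<beta> r s)) = (if \<alpha> = \<beta> \<and> p = r then Q' \<alpha> q s else 0)"
  using intertwiner_u_scalar[OF assms(1,2) _ haar_intertwiner_right[OF rep_u rep_u], of q s p r] assms n_pos
  by (auto simp: Q'_def)

text \<open>The quadratic form at \<xi> is \<open>h (star (b s) * b s)\<close> for the combination
  \<open>b s\<close> of column s, with the same value for all s. If it vanished, then by
  Cauchy-Schwarz \<open>h (x * b s) = 0\<close> for all x and all columns at once, against the
  nondegeneracy of the slices.\<close>

lemma Q_factor:
  assumes \<alpha>: "\<alpha> \<in> I"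
  obtains S T where "S \<in> carrier_mat (n \<alpha>) (n \<alpha>)" "T \<in> carrier_mat (n \<alpha>) (n \<alpha>)"
    "S * T = 1\<^sub>m (n \<alpha>)" "T * S = 1\<^sub>m (n \<alpha>)" "Q_mat \<alpha> = adj S * S"
    "Q_mat \<alpha> * (T * adj T) = 1\<^sub>m (n \<alpha>)"
    "T * adj T * Q_mat \<alpha> = 1\<^sub>m (n \<alpha>)"
proof (rule positive_definite_factor)
  let ?Q = "Q_mat \<alpha>"
  show "adj ?Q = ?Q"
    by (intro eq_matI) (auto simp: Q_def state_hermitian[OF state, symmetric])
  fix \<xi> :: "nat \<Rightarrow> complex" assume nz: "\<exists>i<n \<alpha>. \<xi> i \<noteq> 0"
  let ?q = "\<Sum>i<n \<alpha>. \<Sum>j<n \<alpha>. cnj (\<xi> i) * ?Q $$ (i, j) * \<xi> j"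
  define b where "b s = (\<Sum>r<n \<alpha>. \<xi> r *\<^sub>C u \<alpha> r s)" for s
  have hb: "h (star (b s) * b s) = ?q" if "s < n \<alpha>" for s
    using that \<alpha> by (simp add: b_def star_sum star_scaleC sum_product h_sum mult_scaleC_left
        mult_scaleC_right scaleC_scaleC h_scaleC orthogonality_left mult_ac)
  have "?q \<noteq> 0"
  proof
    assume "?q = 0"
    then have "h (x * b s) = 0" if "s < n \<alpha>" for x s
      using state_null_right[OF state, of "b s" x] hb[OF that] by simp
    then have "(\<Sum>r<n \<alpha>. \<xi> r * h (x * u \<alpha> r s)) = 0" if "s < n \<alpha>" for x s
      using that by (simp add: b_def sum_distrib_left mult_scaleC_right h_sum h_scaleC)
    then show False using left_slices_nondegenerate[OF rep_u[OF \<alpha>]] nz by blast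
  qed
  moreover have "?q \<in> \<real>\<^sub>\<ge>\<^sub>0"
    using state_pos[OF state, of "b 0"] hb[OF n_pos[OF \<alpha>]] by simp
  ultimately show "Re ?q > 0" by (intro nonneg_Reals_Re_pos)
qed (use that in auto)

text \<open>The argument of \<open>Q_factor\<close> for rows. Now \<open>star (b s)\<close> is the
  null vector, so the coefficients of \<open>b s\<close> are conjugated.\<close>

lemma Q'_factor:
  assumes \<alpha>: "\<alpha> \<in> I"
  obtains S T where "S \<in> carrier_mat (n \<alpha>) (n \<alpha>)" "T \<in> carrier_mat (n \<alpha>) (n \<alpha>)"
    "S * T = 1\<^sub>m (n \<alpha>)" "T * S = 1\<^sub>m (n \<alpha>)" "Q'_mat \<alpha> = adj S * S"
    "Q'_mat \<alpha> * (T * adj T) = 1\<^sub>m (n \<alpha>)"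
proof (rule positive_definite_factor)
  let ?Q = "Q'_mat \<alpha>"
  have "cnj (h (u \<alpha> 0 j * star (u \<alpha> 0 i))) = h (u \<alpha> 0 i * star (u \<alpha> 0 j))" for i j
    by (simp add: star_mult star_star flip: state_star[OF state])
  then show "adj ?Q = ?Q"
    by (intro eq_matI) (auto simp: Q'_def)
  fix \<xi> :: "nat \<Rightarrow> complex" assume nz: "\<exists>i<n \<alpha>. \<xi> i \<noteq> 0"
  let ?q = "\<Sum>i<n \<alpha>. \<Sum>j<n \<alpha>. cnj (\<xi> i) * ?Q $$ (i, j) * \<xi> j"
  define b where "b s = (\<Sum>r<n \<alpha>. cnj (\<xi> r) *\<^sub>C u \<alpha> s r)" for s
  have hb: "h (star (star (b s)) * star (b s)) = ?q" if "s < n \<alpha>" for s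
    using that \<alpha> by (simp add: b_def star_sum star_star star_scaleC sum_product h_sum mult_scaleC_left
        mult_scaleC_right scaleC_scaleC h_scaleC orthogonality_right mult_ac)
  have "?q \<noteq> 0"
  proof
    assume "?q = 0"
    then have "h (b s * x) = 0" if "s < n \<alpha>" for x s
      using state_null_left[OF state, of "star (b s)" x] hb[OF that] by (simp add: star_star)
    then have "(\<Sum>r<n \<alpha>. cnj (\<xi> r) * h (u \<alpha> s r * x)) = 0" if "s < n \<alpha>" for x s
      using that by (simp add: b_def sum_distrib_right mult_scaleC_left h_sum h_scaleC)
    then have "cnj (\<xi> r) = 0" if "r < n \<alpha>" for r
      using right_slices_nondegenerate[OF rep_u[OF \<alpha>], of "\<lambda>r. cnj (\<xi> r)"] that by blast
    then show False using nz by auto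
  qed
  moreover have "?q \<in> \<real>\<^sub>\<ge>\<^sub>0"
    using state_pos[OF state, of "star (b 0)"] hb[OF n_pos[OF \<alpha>]] by simp
  ultimately show "Re ?q > 0" by (intro nonneg_Reals_Re_pos)
qed (use that in auto)

text \<open>The conjugate matrix V is a corepresentation for which invariance gives V* Q' V = Q' and
  V Q V* = Q. With Q' = S* S the first relation makes W = S V T isometric, and the second makes it
  invertible. So W is a unitary representation, and the entries of V are combinations of its
  entries.\<close>

lemma star_u_in_A0:
  assumes \<alpha>: "\<alpha> \<in> I" and pq: "p < n \<alpha>" "q < n \<alpha>"
  shows "star (u \<alpha> p q) \<in> A\<^sub>0"
proof -
  let ?m = "n \<alpha>" and ?u = "u \<alpha>"
  note rep = rep_u[OF \<alpha>] and n0 = n_pos[OF \<alpha>]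
  obtain S T where ST: "S \<in> carrier_mat ?m ?m" "T \<in> carrier_mat ?m ?m" "S * T = 1\<^sub>m ?m" "T * S = 1\<^sub>m ?m"
    and Q': "Q'_mat \<alpha> = adj S * S"
    using Q'_factor[OF \<alpha>] by blast
  obtain S2 T2 where ST2: "S2 \<in> carrier_mat ?m ?m" "T2 \<in> carrier_mat ?m ?m" "S2 * T2 = 1\<^sub>m ?m" "T2 * S2 = 1\<^sub>m ?m"
    and Q: "Q_mat \<alpha> = adj S2 * S2"
    and Q_inv: "Q_mat \<alpha> * (T2 * adj T2) = 1\<^sub>m ?m"
    using Q_factor[OF \<alpha>] by blast
  define V where "V = mat ?m ?m (\<lambda>(p, q). star (?u p q))"
  have V: "V \<in> carrier_mat ?m ?m" by (simp add: V_def)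
  have corepV: "corep ?m V"
    using V by (auto simp: corep_def V_def \<Phi>_star rep_\<Phi>[OF rep] star_sum ten_star)
  define sQ sQ' :: "'a mat" where "sQ = scalar_mat (adj S2 * S2)" and "sQ' = scalar_mat (adj S * S)"
  have Qc: "sQ \<in> carrier_mat ?m ?m" "sQ' \<in> carrier_mat ?m ?m"
    using ST ST2 by (auto simp: sQ_def sQ'_def mult_square_carrier)
  \<comment> \<open>Invariance at \<open>?u 0 q * star (?u 0 s)\<close>, sliced by \<open>R\<close>;
    the coefficients that appear are those of \<open>Q'\<close> by definition. The relation for
    \<open>Q\<close> comes from \<open>L\<close> in the same way.\<close>
  have left: "adj V * sQ' * V = sQ'"
  proof (rule eq_matI)
    fix q s assume "q < dim_row sQ'" "s < dim_col sQ'"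
    then have qs: "q < ?m" "s < ?m" using Qc by auto
    have "(adj V * sQ' * V) $$ (q, s) = (\<Sum>l<?m. \<Sum>k<?m. Q' \<alpha> k l *\<^sub>C (?u k q * star (?u l s)))"
      using qs V ST by (simp add: sQ'_def index_mult_mat_sum V_def star_star sum_distrib_right
          mult_scaleC_left mult_scaleC_right flip: Q')
    also have "\<dots> = R (\<Phi> (?u 0 q * star (?u 0 s)))"
      using qs n0 by (subst sum.swap) (simp add: \<Phi>_mult \<Phi>_star rep_\<Phi>[OF rep] star_sum ten_star
          sum_product ten_mult R_sum R_ten Q'_def)
    also have "\<dots> = sQ' $$ (q, s)"
      using qs by (simp add: R_\<Phi> sQ'_def Q'_def flip: Q')
    finally show "(adj V * sQ' * V) $$ (q, s) = sQ' $$ (q, s)" .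
  qed (use V Qc in auto)
  have right: "V * sQ * adj V = sQ"
  proof (rule eq_matI)
    fix p r assume "p < dim_row sQ" "r < dim_col sQ"
    then have pr: "p < ?m" "r < ?m" using Qc by auto
    have "(V * sQ * adj V) $$ (p, r) = (\<Sum>l<?m. \<Sum>k<?m. Q \<alpha> k l *\<^sub>C (star (?u p k) * ?u r l))"
      using pr V ST2 by (simp add: sQ_def index_mult_mat_sum V_def star_star sum_distrib_right
          mult_scaleC_left mult_scaleC_right flip: Q)
    also have "\<dots> = L (\<Phi> (star (?u p 0) * ?u r 0))"
      using pr n0 by (subst sum.swap) (simp add: \<Phi>_mult \<Phi>_star rep_\<Phi>[OF rep] star_sum ten_star
          sum_product ten_mult L_sum L_ten Q_def)
    also have "\<dots> = sQ $$ (p, r)"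
      using pr by (simp add: L_\<Phi> sQ_def Q_def flip: Q)
    finally show "(V * sQ * adj V) $$ (p, r) = sQ $$ (p, r)" .
  qed (use V Qc in auto)
  define sS sT sQi :: "'a mat" where "sS = scalar_mat S" and "sT = scalar_mat T"
    and "sQi = scalar_mat (T2 * adj T2)"
  have c: "sS \<in> carrier_mat ?m ?m" "sT \<in> carrier_mat ?m ?m" "sQi \<in> carrier_mat ?m ?m"
    using ST ST2 by (auto simp: sS_def sT_def sQi_def mult_square_carrier)
  note assoc = assoc_mult_mat[of _ ?m ?m _ ?m _ ?m] mult_square_carrier
  have sST: "sS * sT = 1\<^sub>m ?m" "sT * sS = 1\<^sub>m ?m"
    using ST scalar_mat_mult[of S T, where 'a = 'a] scalar_mat_mult[of T S, where 'a = 'a]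
    by (simp_all add: sS_def sT_def)
  have sQ'_eq: "sQ' = adj sS * sS"
    using ST by (simp add: sQ'_def sS_def scalar_mat_mult scalar_mat_adj)
  have QQi: "sQ * sQi = 1\<^sub>m ?m"
    using ST2 Q_inv scalar_mat_mult[of "adj S2 * S2" "T2 * adj T2", where 'a = 'a]
    by (simp add: Q sQ_def sQi_def)
  define W where "W = sS * V * sT"
  have Wc: "W \<in> carrier_mat ?m ?m" using c V by (simp add: W_def assoc)
  have WW: "adj W * W = 1\<^sub>m ?m"
  proof -
    have "adj W * W = adj sT * (adj V * sQ' * V) * sT"
      using c V by (simp add: W_def sQ'_eq adj_mult assoc)
    also have "\<dots> = adj (sS * sT) * (sS * sT)"
      unfolding left using c by (simp add: sQ'_eq adj_mult assoc)
    finally show ?thesis by (simp add: sST)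
  qed
  \<comment> \<open>By the second relation \<open>sQ * adj V * sQi\<close> is a right inverse of V;
    X is its conjugate by S.\<close>
  define X where "X = sS * (sQ * adj V * sQi) * sT"
  have Xc: "X \<in> carrier_mat ?m ?m" using c V Qc by (simp add: X_def assoc)
  have WX: "W * X = 1\<^sub>m ?m"
  proof -
    have "W * X = sS * V * (sT * sS) * (sQ * adj V * sQi) * sT"
      using c V Qc by (simp add: W_def X_def assoc)
    also have "\<dots> = sS * ((V * sQ * adj V) * sQi) * sT"
      unfolding sST using c V Qc by (simp add: assoc)
    also have "\<dots> = 1\<^sub>m ?m"
      unfolding right QQi using c by (simp add: sST)
    finally show ?thesis .
  qed
  \<comment> \<open>The left inverse \<open>adj W\<close> equals the right inverse X. Over an
    infinite-dimensional algebra an isometric square matrix need not be unitary, so both relations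
    enter.\<close>
  have "adj W = adj W * (W * X)" using Wc by (simp add: WX right_mult_one_mat[of _ ?m ?m])
  also have "\<dots> = (adj W * W) * X" using Wc Xc by (simp add: assoc)
  also have "\<dots> = X" using Xc by (simp add: WW)
  finally have "W * adj W = 1\<^sub>m ?m" by (simp add: WX)
  with WW have "unitary_mat ?m W" using Wc by (simp add: unitary_mat_def)
  moreover have "corep ?m W"
    unfolding W_def sS_def sT_def by (rule corep_similar[OF corepV ST(1,2,4)])
  moreover have "rep_mat ?m (\<lambda>p q. W $$ (p, q)) = W"
    using Wc by (intro eq_matI) auto
  ultimately have "rep ?m (\<lambda>p q. W $$ (p, q))" by (simp add: rep_iff_corep)
  then have Wspan: "W $$ (p, q) \<in> cspan U" if "p < ?m" "q < ?m" for p q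
    using rep_in_span_U[of ?m "\<lambda>p q. W $$ (p, q)" p q] that by simp
  have "V = sT * W * sS"
  proof -
    have "sT * W * sS = (sT * sS) * V * (sT * sS)"
      unfolding W_def using c V by (simp add: assoc)
    then show ?thesis using V by (simp add: sST)
  qed
  moreover have "(sT * W * sS) $$ (p, q) \<in> cspan U"
    unfolding sT_def sS_def by (rule span_sandwich[OF Wc ST(2,1) Wspan pq])
  ultimately have "V $$ (p, q) \<in> cspan U" by simp
  then show ?thesis using pq by (simp add: A0_eq V_def)
qed

lemma A0_induct [consumes 1, case_names zero step]:
  assumes "x \<in> A\<^sub>0" "P 0"
    and "\<And>c \<alpha> p q y. \<alpha> \<in> I \<Longrightarrow> p < n \<alpha> \<Longrightarrow> q < n \<alpha> \<Longrightarrow> y \<in> A\<^sub>0 \<Longrightarrow> P y \<Longrightarrow> P (c *\<^sub>C u \<alpha> p q + y)"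
  shows "P x"
proof -
  have "x \<in> cspan U" using assms(1) by (simp add: A0_eq)
  then have "x \<in> A\<^sub>0 \<and> P x"
  proof (induction rule: cvec.span_induct_alt)
    case base
    then show ?case using assms(2) by (simp add: A0_zero)
  next
    case (step c x y)
    then show ?case using assms(3) by (auto simp: U_def intro!: A0_add A0_scaleC u_in_A0)
  qed
  then show ?thesis ..
qed

lemma A0_star: "x \<in> A\<^sub>0 \<Longrightarrow> star x \<in> A\<^sub>0"
  by (induction rule: A0_induct) (auto simp: star_add star_scaleC intro!: A0_zero A0_add A0_scaleC star_u_in_A0)

lemma u_mult_in_A0:
  assumes "\<alpha> \<in> I" "\<beta> \<in> I" "p < n \<alpha>" "q < n \<alpha>" "r < n \<beta>" "s < n \<beta>"
  shows "u \<alpha> p q * u \<beta> r s \<in> A\<^sub>0"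
  using rep_in_A0[OF rep_tensor_rep[OF rep_u rep_u] tensor_rep_entry(1,2), OF assms(1,2,3,4,5,6)]
    assms by (simp add: tensor_rep_entry(3))

lemma A0_mult: "x \<in> A\<^sub>0 \<Longrightarrow> y \<in> A\<^sub>0 \<Longrightarrow> x * y \<in> A\<^sub>0"
proof (induction x rule: A0_induct)
  case (step c \<alpha> p q x)
  from step.prems have "u \<alpha> p q * y \<in> A\<^sub>0"
    by (induction y rule: A0_induct)
      (use step.hyps in \<open>auto simp: distrib_left mult_scaleC_right intro!: A0_zero A0_add A0_scaleC u_mult_in_A0\<close>)
  then show ?case using step by (auto simp: distrib_right mult_scaleC_left intro!: A0_add A0_scaleC)
qed (simp add: A0_zero)

lemma Q_inverse:
  assumes \<alpha>: "\<alpha> \<in> I"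
  obtains X where "\<And>p r. p < n \<alpha> \<Longrightarrow> r < n \<alpha> \<Longrightarrow> (\<Sum>k<n \<alpha>. X p k * Q \<alpha> k r) = (if p = r then 1 else 0)"
proof -
  let ?m = "n \<alpha>"
  obtain T where T: "T \<in> carrier_mat ?m ?m" and eq: "T * adj T * Q_mat \<alpha> = 1\<^sub>m ?m"
    using Q_factor[OF \<alpha>] by metis
  show thesis
  proof (rule that[of "\<lambda>p k. (T * adj T) $$ (p, k)"])
    fix p r assume "p < ?m" "r < ?m"
    then show "(\<Sum>k<?m. (T * adj T) $$ (p, k) * Q \<alpha> k r) = (if p = r then 1 else 0)"
      using arg_cong[OF eq, of "\<lambda>A. A $$ (p, r)"] T by (simp add: index_mult_mat_sum[of p "T * adj T"])
  qed
qed

lemma Q'_inverse: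
  assumes \<alpha>: "\<alpha> \<in> I"
  obtains X where "\<And>p r. p < n \<alpha> \<Longrightarrow> r < n \<alpha> \<Longrightarrow> (\<Sum>k<n \<alpha>. Q' \<alpha> p k * X k r) = (if p = r then 1 else 0)"
proof -
  let ?m = "n \<alpha>"
  obtain T where T: "T \<in> carrier_mat ?m ?m" and eq: "Q'_mat \<alpha> * (T * adj T) = 1\<^sub>m ?m"
    using Q'_factor[OF \<alpha>] by metis
  show thesis
  proof (rule that[of "\<lambda>k r. (T * adj T) $$ (k, r)"])
    fix p r assume "p < ?m" "r < ?m"
    then show "(\<Sum>k<?m. Q' \<alpha> p k * (T * adj T) $$ (k, r)) = (if p = r then 1 else 0)"
      using arg_cong[OF eq, of "\<lambda>A. A $$ (p, r)"] T by (simp add: index_mult_mat_sum[of p _ r "T * adj T"])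
  qed
qed

subsection \<open>Finitely supported functionals\<close>

abbreviation "J \<equiv> (\<lambda>\<alpha>. {..<n \<alpha>})"
abbreviation "B \<equiv> mat_sum I J"

definition fin_supp :: "('a \<Rightarrow> complex) \<Rightarrow> bool"
  where "fin_supp g \<longleftrightarrow> finite {\<alpha> \<in> I. \<exists>p<n \<alpha>. \<exists>q<n \<alpha>. g (u \<alpha> p q) \<noteq> 0}"

lemma fin_supp_zero: "fin_supp (\<lambda>x. 0)"
  by (simp add: fin_supp_def)

lemma fin_supp_add:
  assumes "fin_supp f" "fin_supp g"
  shows "fin_supp (\<lambda>x. c * f x + g x)"
proof -
  let ?S = "\<lambda>f. {\<alpha> \<in> I. \<exists>p<n \<alpha>. \<exists>q<n \<alpha>. f (u \<alpha> p q) \<noteq> (0 :: complex)}"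
  have "?S (\<lambda>x. c * f x + g x) \<subseteq> ?S f \<union> ?S g"
    by (auto, metis add_0 mult_zero_right)
  then show ?thesis
    using assms unfolding fin_supp_def by (blast intro: finite_subset)
qed

lemma fin_supp_eq: "fin_supp f \<Longrightarrow> (\<And>\<alpha> p q. \<alpha> \<in> I \<Longrightarrow> p < n \<alpha> \<Longrightarrow> q < n \<alpha> \<Longrightarrow> f (u \<alpha> p q) = g (u \<alpha> p q)) \<Longrightarrow> fin_supp g"
  unfolding fin_supp_def by (simp cong: conj_cong)

lemma coords_in_B: "fin_supp g \<Longrightarrow> dual_coords I n u g \<in> B"
  unfolding fin_supp_def mat_sum_def mat_prod_def dual_coords_def
  by (auto elim!: rev_finite_subset split: if_splits) (metis (mono_tags, lifting))

text \<open>Since \<open>A\<^sub>0\<close> is closed under \<open>star\<close>, c may be written as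
  \<open>star y\<close>; by orthogonality each matrix element in y then contributes a single
  block.\<close>

lemma fin_supp_left: "c \<in> A\<^sub>0 \<Longrightarrow> fin_supp (\<lambda>x. h (c * x))"
proof -
  have "fin_supp (\<lambda>x. h (star y * x))" if "y \<in> A\<^sub>0" for y
    using that
  proof (induction y rule: A0_induct)
    case (step c \<alpha> p q y)
    have "fin_supp (\<lambda>x. h (star (u \<alpha> p q) * x))"
      unfolding fin_supp_def by (rule finite_subset[of _ "{\<alpha>}"]) (use step in \<open>auto simp: orthogonality_left split: if_splits\<close>)
    from fin_supp_add[OF this step.IH, of "cnj c"] show ?case
      by (simp add: star_add star_scaleC distrib_right mult_scaleC_left h_add h_scaleC)
  qed (simp add: h_zero fin_supp_zero)
  from this[of "star c"] show "c \<in> A\<^sub>0 \<Longrightarrow> fin_supp (\<lambda>x. h (c * x))"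
    by (simp add: A0_star star_star)
qed

lemma fin_supp_right: "c \<in> A\<^sub>0 \<Longrightarrow> fin_supp (\<lambda>x. h (x * c))"
proof -
  have "fin_supp (\<lambda>x. h (x * star y))" if "y \<in> A\<^sub>0" for y
    using that
  proof (induction y rule: A0_induct)
    case (step c \<alpha> p q y)
    have "fin_supp (\<lambda>x. h (x * star (u \<alpha> p q)))"
      unfolding fin_supp_def by (rule finite_subset[of _ "{\<alpha>}"]) (use step in \<open>auto simp: orthogonality_right split: if_splits\<close>)
    from fin_supp_add[OF this step.IH, of "cnj c"] show ?case
      by (simp add: star_add star_scaleC distrib_left mult_scaleC_right h_add h_scaleC)
  qed (simp add: h_zero fin_supp_zero)
  from this[of "star c"] show "c \<in> A\<^sub>0 \<Longrightarrow> fin_supp (\<lambda>x. h (x * c))"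
    by (simp add: A0_star star_star)
qed

lemma B_sum:
  assumes x: "x \<in> B" and \<beta>: "\<beta> \<in> I" "r < n \<beta>" "s < n \<beta>"
  shows "(\<Sum>\<alpha>\<in>{\<alpha>. x \<alpha> \<noteq> (\<lambda>i j. 0)}. \<Sum>p<n \<alpha>. \<Sum>q<n \<alpha>. x \<alpha> p q * (if \<alpha> = \<beta> \<and> p = r \<and> q = s then 1 else 0)) = x \<beta> r s"
proof -
  let ?F = "{\<alpha>. x \<alpha> \<noteq> (\<lambda>i j. 0)}"
  have fin: "finite ?F" using x by (simp add: mat_sum_def)
  have "(\<Sum>p<n \<alpha>. \<Sum>q<n \<alpha>. x \<alpha> p q * (if \<alpha> = \<beta> \<and> p = r \<and> q = s then 1 else 0)) =
      (if \<alpha> = \<beta> then x \<beta> r s else 0)" for \<alpha>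
  proof (cases "\<alpha> = \<beta>")
    case True
    have "(\<Sum>q<n \<beta>. x \<beta> p q * (if p = r \<and> q = s then 1 else 0)) = (if p = r then x \<beta> p s else 0)" for p
      using \<beta> by (cases "p = r") (simp_all add: if_distrib[of "\<lambda>z. _ * z"] cong: if_cong)
    then show ?thesis using True \<beta> by simp
  qed simp
  then show ?thesis using fin by simp
qed

text \<open>The orthogonality relations pair \<open>star (u \<alpha> k q)\<close> with
  \<open>u \<alpha> r q\<close> through \<open>Q\<close>; the inverse of this matrix corrects them
  to a dual basis.\<close>

lemma left_dual_unit:
  assumes \<alpha>: "\<alpha> \<in> I" "p < n \<alpha>" "q < n \<alpha>"
  shows "\<exists>c\<in>A\<^sub>0. \<forall>\<beta>\<in>I. \<forall>r<n \<beta>. \<forall>s<n \<beta>. h (c * u \<beta> r s) = (if \<alpha> = \<beta> \<and> p = r \<and> q = s then 1 else 0)"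
proof -
  obtain X where X: "\<And>p r. p < n \<alpha> \<Longrightarrow> r < n \<alpha> \<Longrightarrow> (\<Sum>k<n \<alpha>. X p k * Q \<alpha> k r) = (if p = r then 1 else 0)"
    using Q_inverse[OF \<alpha>(1)] by blast
  let ?c = "\<Sum>k<n \<alpha>. X p k *\<^sub>C star (u \<alpha> k q)"
  have "?c \<in> A\<^sub>0" using \<alpha> by (intro A0_sum A0_scaleC star_u_in_A0) auto
  moreover have "h (?c * u \<beta> r s) = (if \<alpha> = \<beta> \<and> p = r \<and> q = s then 1 else 0)"
    if "\<beta> \<in> I" "r < n \<beta>" "s < n \<beta>" for \<beta> r s
  proof -
    have "h (?c * u \<beta> r s) = (\<Sum>k<n \<alpha>. X p k * (if \<alpha> = \<beta> \<and> q = s then Q \<alpha> k r else 0))"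
      using \<alpha> that by (simp add: sum_distrib_right mult_scaleC_left h_sum h_scaleC orthogonality_left)
    then show ?thesis using \<alpha> that X[of p r] by (cases "\<alpha> = \<beta> \<and> q = s") auto
  qed
  ultimately show ?thesis by blast
qed

lemma right_dual_unit:
  assumes \<alpha>: "\<alpha> \<in> I" "p < n \<alpha>" "q < n \<alpha>"
  shows "\<exists>c\<in>A\<^sub>0. \<forall>\<beta>\<in>I. \<forall>r<n \<beta>. \<forall>s<n \<beta>. h (u \<beta> r s * c) = (if \<alpha> = \<beta> \<and> p = r \<and> q = s then 1 else 0)"
proof -
  obtain X where X: "\<And>p r. p < n \<alpha> \<Longrightarrow> r < n \<alpha> \<Longrightarrow> (\<Sum>k<n \<alpha>. Q' \<alpha> p k * X k r) = (if p = r then 1 else 0)"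
    using Q'_inverse[OF \<alpha>(1)] by blast
  let ?c = "\<Sum>k<n \<alpha>. X k q *\<^sub>C star (u \<alpha> p k)"
  have "?c \<in> A\<^sub>0" using \<alpha> by (intro A0_sum A0_scaleC star_u_in_A0) auto
  moreover have "h (u \<beta> r s * ?c) = (if \<alpha> = \<beta> \<and> p = r \<and> q = s then 1 else 0)"
    if "\<beta> \<in> I" "r < n \<beta>" "s < n \<beta>" for \<beta> r s
  proof -
    have "h (u \<beta> r s * ?c) = (\<Sum>k<n \<alpha>. (if \<beta> = \<alpha> \<and> r = p then Q' \<beta> s k else 0) * X k q)"
      using \<alpha> that by (simp add: sum_distrib_left mult_scaleC_right h_sum h_scaleC orthogonality_right mult.commute)
    then show ?thesis using \<alpha> that X[of s q] by (cases "\<alpha> = \<beta> \<and> p = r") auto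
  qed
  ultimately show ?thesis by blast
qed

text \<open>\<open>F\<close> stands for either of the pairings h (c a) and h (a c).\<close>

lemma realize:
  assumes x: "x \<in> B" and F: "\<And>a. clinear (\<lambda>c. F c a)"
    and unit: "\<And>\<alpha> p q. \<alpha> \<in> I \<Longrightarrow> p < n \<alpha> \<Longrightarrow> q < n \<alpha> \<Longrightarrow> \<exists>c\<in>A\<^sub>0. \<forall>\<beta>\<in>I. \<forall>r<n \<beta>. \<forall>s<n \<beta>.
      F c (u \<beta> r s) = (if \<alpha> = \<beta> \<and> p = r \<and> q = s then 1 else 0 :: complex)"
  shows "\<exists>c\<in>A\<^sub>0. \<forall>\<beta>\<in>I. \<forall>r<n \<beta>. \<forall>s<n \<beta>. F c (u \<beta> r s) = x \<beta> r s"
proof -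
  obtain c where c: "\<And>\<alpha> p q. \<alpha> \<in> I \<Longrightarrow> p < n \<alpha> \<Longrightarrow> q < n \<alpha> \<Longrightarrow> c \<alpha> p q \<in> A\<^sub>0 \<and>
      (\<forall>\<beta>\<in>I. \<forall>r<n \<beta>. \<forall>s<n \<beta>. F (c \<alpha> p q) (u \<beta> r s) = (if \<alpha> = \<beta> \<and> p = r \<and> q = s then 1 else 0))"
    using unit by metis
  let ?K = "{\<alpha>. x \<alpha> \<noteq> (\<lambda>i j. 0)}"
  have K: "\<alpha> \<in> I" if "\<alpha> \<in> ?K" for \<alpha>
    using x that by (fastforce simp: mat_sum_def mat_prod_def fun_eq_iff)
  let ?c = "\<Sum>\<alpha>\<in>?K. \<Sum>p<n \<alpha>. \<Sum>q<n \<alpha>. x \<alpha> p q *\<^sub>C c \<alpha> p q"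
  have "?c \<in> A\<^sub>0" using c K by (intro A0_sum A0_scaleC) auto
  moreover have "F ?c (u \<beta> r s) = x \<beta> r s" if "\<beta> \<in> I" "r < n \<beta>" "s < n \<beta>" for \<beta> r s
  proof -
    have "F ?c (u \<beta> r s) = (\<Sum>\<alpha>\<in>?K. \<Sum>p<n \<alpha>. \<Sum>q<n \<alpha>. x \<alpha> p q * F (c \<alpha> p q) (u \<beta> r s))"
      by (simp add: clinear_sum[OF F] clinear_scaleC[OF F])
    also have "\<dots> = (\<Sum>\<alpha>\<in>?K. \<Sum>p<n \<alpha>. \<Sum>q<n \<alpha>. x \<alpha> p q * (if \<alpha> = \<beta> \<and> p = r \<and> q = s then 1 else 0))"
      using c K that by (intro sum.cong refl) simp
    finally show ?thesis using B_sum[OF x that] by simp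
  qed
  ultimately show ?thesis by blast
qed

lemma realize_left: "x \<in> B \<Longrightarrow> \<exists>c\<in>A\<^sub>0. \<forall>\<beta>\<in>I. \<forall>r<n \<beta>. \<forall>s<n \<beta>. h (c * u \<beta> r s) = x \<beta> r s"
  by (rule realize[OF _ clinear_mult_right[OF h_clinear] left_dual_unit])

lemma realize_right: "x \<in> B \<Longrightarrow> \<exists>c\<in>A\<^sub>0. \<forall>\<beta>\<in>I. \<forall>r<n \<beta>. \<forall>s<n \<beta>. h (u \<beta> r s * c) = x \<beta> r s"
  by (rule realize[OF _ clinear_mult_left[OF h_clinear] right_dual_unit])

lemma A0_eqI:
  assumes "clinear f" "clinear g" "x \<in> A\<^sub>0"
    and "\<And>\<alpha> p q. \<alpha> \<in> I \<Longrightarrow> p < n \<alpha> \<Longrightarrow> q < n \<alpha> \<Longrightarrow> f (u \<alpha> p q) = g (u \<alpha> p q)"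
  shows "f x = g x"
  using assms(3)
  by (induction x rule: A0_induct)
    (simp_all add: clinear_zero[OF assms(1)] clinear_zero[OF assms(2)] clinear_add[OF assms(1)]
      clinear_add[OF assms(2)] clinear_scaleC[OF assms(1)] clinear_scaleC[OF assms(2)] assms(4))

text \<open>Both families of functionals exhaust the finitely supported ones, so every c on the left
  can be traded for some c' on the right. Algebraically, c' is the image of c under the modular
  automorphism of \<open>h\<close>.\<close>

lemma modular:
  assumes c: "c \<in> A\<^sub>0"
  obtains c' where "c' \<in> A\<^sub>0" "\<And>x. x \<in> A\<^sub>0 \<Longrightarrow> h (c * x) = h (x * c')"
proof -
  have "dual_coords I n u (\<lambda>x. h (c * x)) \<in> B" by (rule coords_in_B[OF fin_supp_left[OF c]])
  from realize_right[OF this] obtain c' where c': "c' \<in> A\<^sub>0"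
    and eq: "\<And>\<beta> r s. \<beta> \<in> I \<Longrightarrow> r < n \<beta> \<Longrightarrow> s < n \<beta> \<Longrightarrow> h (u \<beta> r s * c') = h (c * u \<beta> r s)"
    by (auto simp: dual_coords_def)
  have "h (c * x) = h (x * c')" if "x \<in> A\<^sub>0" for x
    by (rule A0_eqI[OF _ _ that]) (auto intro!: clinear_intros simp: eq)
  with c' show thesis using that by blast
qed

subsection \<open>The dual space\<close>

abbreviation "D \<equiv> dual_space ten \<Phi> h"
abbreviation "\<theta> \<equiv> dual_coords I n u"

lemma D_clinear: "\<omega> \<in> D \<Longrightarrow> clinear \<omega>"
  by (auto simp: dual_space_def intro!: clinear_intros)

lemma D_I: "a \<in> A\<^sub>0 \<Longrightarrow> (\<lambda>x. h (a * x)) \<in> D"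
  by (auto simp: dual_space_def)

lemma D_coords: "\<omega> \<in> D \<Longrightarrow> \<theta> \<omega> \<in> B"
  by (auto simp: dual_space_def intro!: coords_in_B fin_supp_left)

lemma D_fin_supp_left:
  assumes "\<omega> \<in> D" "b \<in> A\<^sub>0"
  shows "fin_supp (\<lambda>x. \<omega> (b * x))"
proof -
  obtain a where "a \<in> A\<^sub>0" "\<omega> = (\<lambda>x. h (a * x))" using assms(1) by (auto simp: dual_space_def)
  then show ?thesis using fin_supp_left[OF A0_mult, of a b] assms(2) by (simp add: mult.assoc)
qed

text \<open>In h (a x b) the factor a stands on the wrong side; \<open>modular\<close> moves it
  behind b.\<close>

lemma D_fin_supp_right:
  assumes "\<omega> \<in> D" "b \<in> A\<^sub>0"
  shows "fin_supp (\<lambda>x. \<omega> (x * b))"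
proof -
  obtain a where a: "a \<in> A\<^sub>0" "\<omega> = (\<lambda>x. h (a * x))" using assms(1) by (auto simp: dual_space_def)
  obtain c where c: "c \<in> A\<^sub>0" "\<And>x. x \<in> A\<^sub>0 \<Longrightarrow> h (a * x) = h (x * c)"
    using modular[OF a(1)] by blast
  show ?thesis
    by (rule fin_supp_eq[OF fin_supp_right[OF A0_mult[OF assms(2) c(1)]]])
      (use assms in \<open>simp add: a c A0_mult u_in_A0 mult.assoc\<close>)
qed

lemma coords_eq_iff:
  "\<theta> f = \<theta> g \<longleftrightarrow> (\<forall>\<alpha>\<in>I. \<forall>p<n \<alpha>. \<forall>q<n \<alpha>. f (u \<alpha> p q) = g (u \<alpha> p q))"
  by (auto simp: dual_coords_def fun_eq_iff)

text \<open>Members of \<open>D\<close> are functionals on all of A, while coordinates see only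
  \<open>A\<^sub>0\<close>. The difference is h (d x) with d in \<open>A\<^sub>0\<close>; vanishing
  at \<open>star d\<close> makes \<open>star d\<close> a null vector, and Cauchy-Schwarz does the
  rest.\<close>

lemma D_eqI:
  assumes "\<omega> \<in> D" "\<psi> \<in> D" and eq: "\<theta> \<omega> = \<theta> \<psi>"
  shows "\<omega> = \<psi>"
proof -
  obtain a b where a: "a \<in> A\<^sub>0" "\<omega> = (\<lambda>x. h (a * x))" and b: "b \<in> A\<^sub>0" "\<psi> = (\<lambda>x. h (b * x))"
    using assms by (auto simp: dual_space_def)
  define d where "d = a + (-1) *\<^sub>C b"
  have d: "d \<in> A\<^sub>0" unfolding d_def using a b by (intro A0_add A0_scaleC)
  have hd: "h (d * x) = \<omega> x - \<psi> x" for x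
    by (simp add: d_def a b left_diff_distrib clinear_diff[OF h_clinear])
  have "h (d * x) = 0" if "x \<in> A\<^sub>0" for x
    using A0_eqI[OF D_clinear[OF assms(1)] D_clinear[OF assms(2)] that] eq by (simp add: hd coords_eq_iff)
  from this[OF A0_star[OF d]] have "h (star (star d) * star d) = 0" by (simp add: star_star)
  then have "h (d * x) = 0" for x
    using state_null_left[OF state, of "star d" x] by (simp add: star_star)
  then show ?thesis by (auto simp: hd fun_eq_iff)
qed

lemma coords_bij: "bij_betw \<theta> D B"
  unfolding bij_betw_def
proof
  show "inj_on \<theta> D" by (auto intro: inj_onI D_eqI)
  show "\<theta> ` D = B"
  proof
    show "B \<subseteq> \<theta> ` D"
    proof
      fix x assume x: "x \<in> B"
      from realize_left[OF x] obtain c where c: "c \<in> A\<^sub>0"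
        and eq: "\<And>\<beta> r s. \<beta> \<in> I \<Longrightarrow> r < n \<beta> \<Longrightarrow> s < n \<beta> \<Longrightarrow> h (c * u \<beta> r s) = x \<beta> r s" by blast
      have "x \<beta> r s = 0" if "\<not> (\<beta> \<in> I \<and> r < n \<beta> \<and> s < n \<beta>)" for \<beta> r s
        using x that by (auto simp: mat_sum_def mat_prod_def)
      then have "x = \<theta> (\<lambda>x. h (c * x))"
        by (auto simp: dual_coords_def fun_eq_iff eq)
      then show "x \<in> \<theta> ` D" using D_I[OF c] by blast
    qed
  qed (use D_coords in auto)
qed

lemma D_add: "\<omega> \<in> D \<Longrightarrow> \<psi> \<in> D \<Longrightarrow> (\<lambda>x. \<omega> x + \<psi> x) \<in> D"
  unfolding dual_space_def by (auto simp: h_add distrib_right intro!: A0_add simp flip: h_add distrib_right)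

lemma D_scale: "\<omega> \<in> D \<Longrightarrow> (\<lambda>x. c * \<omega> x) \<in> D"
proof -
  assume "\<omega> \<in> D"
  then obtain a where "a \<in> A\<^sub>0" "\<omega> = (\<lambda>x. h (a * x))" by (auto simp: dual_space_def)
  then show ?thesis using D_I[OF A0_scaleC, of a c] by (simp add: mult_scaleC_left h_scaleC)
qed

lemma coords_add: "\<theta> (\<lambda>x. \<omega> x + \<psi> x) = mat_add (\<theta> \<omega>) (\<theta> \<psi>)"
  and coords_scale: "\<theta> (\<lambda>x. c * \<omega> x) = mat_scale c (\<theta> \<omega>)"
  by (auto simp: dual_coords_def mat_add_def mat_scale_def fun_eq_iff)

text \<open>An explicit bounded formula for the product functional; its uniqueness comes from the
  density of the elementary tensors.\<close>

lemma tensor_functional_D: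
  assumes "a \<in> A\<^sub>0" "b \<in> A\<^sub>0"
  shows "tensor_functional ten (\<lambda>x. h (a * x)) (\<lambda>x. h (b * x)) = (\<lambda>T. h (a * L (ten 1 b * T)))"
  unfolding tensor_functional_def
proof (rule the_equality)
  have lin: "clinear (\<lambda>T. h (a * L (ten 1 b * T)))" "bounded_linear (\<lambda>T. h (a * L (ten 1 b * T)))"
    by (auto intro!: bounded_intros clinear_intros clinear_mult_of)
  have val: "h (a * L (ten 1 b * ten x y)) = h (a * x) * h (b * y)" for x y
    by (simp add: ten_mult L_ten mult_scaleC_right h_scaleC)
  show "is_tensor_map ten (*) (\<lambda>x. h (a * x)) (\<lambda>x. h (b * x)) (\<lambda>T. h (a * L (ten 1 b * T)))"
    unfolding is_tensor_map_def using lin val by blast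
  fix F assume "is_tensor_map ten (*) (\<lambda>x. h (a * x)) (\<lambda>x. h (b * x)) F"
  then have F: "clinear F" "bounded_linear F" "\<And>x y. F (ten x y) = h (a * x) * h (b * y)"
    by (auto simp: is_tensor_map_def)
  show "F = (\<lambda>T. h (a * L (ten 1 b * T)))"
    by (rule ext, rule eq_on_ten[OF F(1,2) lin]) (simp add: F(3) val)
qed

text \<open>Coordinates would determine the product only on \<open>A\<^sub>0\<close>, so a
  representing element is constructed, by induction on the one of the second factor.\<close>

lemma dual_mult_D:
  assumes "\<omega> \<in> D" "\<psi> \<in> D"
  shows "dual_mult ten \<Phi> \<omega> \<psi> \<in> D"
proof -
  obtain a b where a: "a \<in> A\<^sub>0" "\<omega> = (\<lambda>x. h (a * x))" and b: "b \<in> A\<^sub>0" "\<psi> = (\<lambda>x. h (b * x))"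
    using assms by (auto simp: dual_space_def)
  have "\<exists>c\<in>A\<^sub>0. \<forall>x. h (a * L (ten 1 b * \<Phi> x)) = h (c * x)"
    using b(1)
  proof (induction b rule: A0_induct)
    case zero
    then show ?case
      by (intro bexI[of _ 0]) (simp_all add: ten_zero_right clinear_zero[OF L_clinear] h_zero A0_zero)
  next
    case (step c \<alpha> p q y)
    then obtain d where d: "d \<in> A\<^sub>0" "\<And>x. h (a * L (ten 1 y * \<Phi> x)) = h (d * x)" by blast
    \<comment> \<open>Expanding \<open>ten 1 (u \<alpha> p q)\<close> by
      \<open>ten_rep_right\<close> lets \<Phi> absorb \<open>u \<alpha> k q\<close>. Invariance
      leaves \<open>h (u \<alpha> k q * x)\<close> times \<open>star (u \<alpha> k p)\<close>, to
      which h (a \<cdot>) is applied.\<close>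
    let ?e = "\<Sum>k<n \<alpha>. h (a * star (u \<alpha> k p)) *\<^sub>C u \<alpha> k q"
    have "?e \<in> A\<^sub>0" using step by (intro A0_sum A0_scaleC u_in_A0) auto
    moreover have "h (a * L (ten 1 (u \<alpha> p q) * \<Phi> x)) = h (?e * x)" for x
    proof -
      have "L (ten 1 (u \<alpha> p q) * \<Phi> x) = (\<Sum>k<n \<alpha>. h (u \<alpha> k q * x) *\<^sub>C star (u \<alpha> k p))"
        using step by (simp add: ten_rep_right[OF rep_u] sum_distrib_right L_sum mult.assoc L_mult_left L_\<Phi>
            mult_scaleC_right flip: \<Phi>_mult)
      then show ?thesis
        by (simp add: sum_distrib_left sum_distrib_right mult_scaleC_left mult_scaleC_right h_sum h_scaleC mult.commute)
    qed
    ultimately have "c *\<^sub>C ?e + d \<in> A\<^sub>0" "\<forall>x. h (a * L (ten 1 (c *\<^sub>C u \<alpha> p q + y) * \<Phi> x)) = h ((c *\<^sub>C ?e + d) * x)"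
      using d by (auto intro!: A0_add A0_scaleC simp: clinear_add[OF ten_clinear(1)] ten_scaleC_right distrib_left
          distrib_right clinear_add[OF L_clinear] L_scaleC mult_scaleC_left mult_scaleC_right h_add h_scaleC)
    then show ?case by blast
  qed
  then show ?thesis
    using D_I by (auto simp: dual_mult_def a(2) b(2) tensor_functional_D[OF a(1) b(1)])
qed

text \<open>Stated for arbitrary unitary representations in order to cover tensor products, whose
  entries are products of matrix elements.\<close>

lemma dual_mult_rep:
  assumes "\<omega> \<in> D" "\<psi> \<in> D" and v: "rep m v" and pq: "p < m" "q < m"
  shows "dual_mult ten \<Phi> \<omega> \<psi> (v p q) = (\<Sum>k<m. \<omega> (v p k) * \<psi> (v k q))"
proof -
  obtain a b where a: "a \<in> A\<^sub>0" "\<omega> = (\<lambda>x. h (a * x))" and b: "b \<in> A\<^sub>0" "\<psi> = (\<lambda>x. h (b * x))"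
    using assms by (auto simp: dual_space_def)
  show ?thesis
    using pq by (simp add: dual_mult_def a(2) b(2) tensor_functional_D[OF a(1) b(1)] rep_\<Phi>[OF v] sum_distrib_left
        L_sum h_sum ten_mult L_ten mult_scaleC_right h_scaleC mult.commute)
qed

lemma coords_dual_mult:
  assumes "\<omega> \<in> D" "\<psi> \<in> D"
  shows "\<theta> (dual_mult ten \<Phi> \<omega> \<psi>) = mat_mult J (\<theta> \<omega>) (\<theta> \<psi>)"
  by (auto simp: fun_eq_iff dual_coords_def mat_mult_def dual_mult_rep[OF assms rep_u] intro!: sum.cong)

text \<open>The conjugate transposed coordinates belong to some \<psi> in \<open>D\<close>. The
  prescribed values of \<omega>* are linear in x, the two conjugations cancelling, and agree with
  \<psi> on the \<open>u \<alpha> p q\<close>; \<open>D_eqI\<close> gives uniqueness.\<close>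

lemma dual_star_props:
  assumes \<kappa>: "antipode ten \<Phi> \<kappa>" and \<omega>: "\<omega> \<in> D"
  shows "dual_star ten \<Phi> h \<kappa> \<omega> \<in> D"
    and "x \<in> A\<^sub>0 \<Longrightarrow> dual_star ten \<Phi> h \<kappa> \<omega> x = cnj (\<omega> (star (\<kappa> x)))"
proof -
  have \<kappa>_add: "\<kappa> (x + y) = \<kappa> x + \<kappa> y" if "x \<in> A\<^sub>0" "y \<in> A\<^sub>0" for x y
    using \<kappa> that by (auto simp: antipode_def)
  have \<kappa>_scaleC: "\<kappa> (c *\<^sub>C x) = c *\<^sub>C \<kappa> x" if "x \<in> A\<^sub>0" for c x
    using \<kappa> that by (auto simp: antipode_def)
  have \<kappa>_u: "\<kappa> (u \<alpha> p q) = star (u \<alpha> q p)" if "\<alpha> \<in> I" "p < n \<alpha>" "q < n \<alpha>" for \<alpha> p q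
    using \<kappa> rep_u[OF that(1)] that unfolding antipode_def by blast
  have \<kappa>_0: "\<kappa> 0 = 0" using \<kappa>_scaleC[OF A0_zero, of 0] by simp
  note \<omega>_lin = D_clinear[OF \<omega>]
  have "mat_star (\<theta> \<omega>) \<in> B"
  proof -
    have "{\<alpha>. mat_star (\<theta> \<omega>) \<alpha> \<noteq> (\<lambda>i j. 0)} \<subseteq> {\<alpha>. \<theta> \<omega> \<alpha> \<noteq> (\<lambda>i j. 0)}"
      by (auto simp: mat_star_def fun_eq_iff)
    then show ?thesis
      using D_coords[OF \<omega>] by (auto simp: mat_sum_def mat_prod_def mat_star_def intro: finite_subset)
  qed
  then obtain \<psi> where \<psi>: "\<psi> \<in> D" "\<theta> \<psi> = mat_star (\<theta> \<omega>)"
    using coords_bij by (metis bij_betw_imp_surj_on imageE)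
  have \<psi>_u: "\<psi> (u \<alpha> p q) = cnj (\<omega> (u \<alpha> q p))" if "\<alpha> \<in> I" "p < n \<alpha>" "q < n \<alpha>" for \<alpha> p q
    using fun_cong[OF fun_cong[OF fun_cong[OF \<psi>(2), of \<alpha>], of p], of q] that
    by (simp add: dual_coords_def mat_star_def)
  note \<psi>_lin = D_clinear[OF \<psi>(1)]
  have \<psi>_eq: "\<psi> x = cnj (\<omega> (star (\<kappa> x)))" if "x \<in> A\<^sub>0" for x
    using that
  proof (induction x rule: A0_induct)
    case zero
    then show ?case by (simp add: \<kappa>_0 clinear_zero[OF \<omega>_lin] clinear_zero[OF \<psi>_lin])
  next
    case (step c \<alpha> p q y)
    then show ?case
      by (simp add: \<kappa>_add \<kappa>_scaleC \<kappa>_u A0_scaleC u_in_A0 star_add star_scaleC star_star \<psi>_u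
          clinear_add[OF \<omega>_lin] clinear_add[OF \<psi>_lin] clinear_scaleC[OF \<omega>_lin] clinear_scaleC[OF \<psi>_lin])
  qed
  have "dual_star ten \<Phi> h \<kappa> \<omega> = \<psi>"
    unfolding dual_star_def
  proof (rule the_equality)
    show "\<psi> \<in> D \<and> (\<forall>x\<in>A\<^sub>0. \<psi> x = cnj (\<omega> (star (\<kappa> x))))" using \<psi>(1) \<psi>_eq by blast
    fix \<psi>' assume "\<psi>' \<in> D \<and> (\<forall>x\<in>A\<^sub>0. \<psi>' x = cnj (\<omega> (star (\<kappa> x))))"
    then show "\<psi>' = \<psi>"
      by (intro D_eqI) (auto simp: \<psi>(1) coords_eq_iff \<psi>_eq u_in_A0)
  qed
  with \<psi>(1) \<psi>_eq show "dual_star ten \<Phi> h \<kappa> \<omega> \<in> D"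
    and "x \<in> A\<^sub>0 \<Longrightarrow> dual_star ten \<Phi> h \<kappa> \<omega> x = cnj (\<omega> (star (\<kappa> x)))" by simp_all
qed

lemma dual_star_rep:
  assumes \<kappa>: "antipode ten \<Phi> \<kappa>" and \<omega>: "\<omega> \<in> D" and v: "rep m v" and pq: "p < m" "q < m"
  shows "dual_star ten \<Phi> h \<kappa> \<omega> (v p q) = cnj (\<omega> (v q p))"
proof -
  have "\<kappa> (v p q) = star (v q p)" using \<kappa> v pq by (auto simp: antipode_def)
  then show ?thesis using dual_star_props(2)[OF \<kappa> \<omega> rep_in_A0[OF v pq]] by (simp add: star_star)
qed

lemma coords_dual_star:
  assumes "antipode ten \<Phi> \<kappa>" "\<omega> \<in> D"
  shows "\<theta> (dual_star ten \<Phi> h \<kappa> \<omega>) = mat_star (\<theta> \<omega>)"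
  by (auto simp: fun_eq_iff dual_coords_def mat_star_def dual_star_rep[OF assms rep_u])

theorem dual_star_isomorphism:
  assumes "antipode ten \<Phi> \<kappa>"
  shows "star_isomorphism D (dual_mult ten \<Phi>) (dual_star ten \<Phi> h \<kappa>) I n \<theta>"
  unfolding star_isomorphism_def Let_def
  using coords_bij D_add D_scale dual_mult_D dual_star_props(1)[OF assms] coords_add coords_scale
    coords_dual_mult coords_dual_star[OF assms]
  by auto

section \<open>Functionals recovered from coordinates, and slices of tensors\<close>

abbreviation "W x \<equiv> inv_into D \<theta> x"
abbreviation "in_range \<alpha> \<beta> p q r s \<equiv>
  \<alpha> \<in> I \<and> \<beta> \<in> I \<and> p < n \<alpha> \<and> q < n \<alpha> \<and> r < n \<beta> \<and> s < n \<beta>"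
abbreviation "J2 \<equiv> ind_tensor J J"
abbreviation "J3 \<equiv> ind_tensor J J2"
abbreviation "BB \<equiv> mat_sum (I \<times> I) J2"
abbreviation "eB \<equiv> mat_one I J"
abbreviation "eBB \<equiv> mat_one (I \<times> I) J2"
abbreviation "\<Delta> \<equiv> (\<lambda>x. dual_coords2 I n u (dual_comult (W x)))"

lemma W_D: "x \<in> B \<Longrightarrow> W x \<in> D" and W_coords: "x \<in> B \<Longrightarrow> \<theta> (W x) = x"
  using coords_bij by (metis bij_betw_def inv_into_into, metis bij_betw_def f_inv_into_f)

lemma W_u: "x \<in> B \<Longrightarrow> \<alpha> \<in> I \<Longrightarrow> p < n \<alpha> \<Longrightarrow> q < n \<alpha> \<Longrightarrow> W x (u \<alpha> p q) = x \<alpha> p q"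
  using fun_cong[OF fun_cong[OF fun_cong[OF W_coords, of x \<alpha>], of p], of q] by (simp add: dual_coords_def)

lemma W_coords_D: "\<omega> \<in> D \<Longrightarrow> W (\<theta> \<omega>) = \<omega>"
  using coords_bij by (simp add: bij_betw_def inv_into_f_f)

lemma W_clinear: "x \<in> B \<Longrightarrow> clinear (W x)"
  by (intro D_clinear W_D)

text \<open>The standard way to evaluate \<open>W x\<close>: guess a linear functional and check it
  on the basis.\<close>

lemma W_eqI:
  assumes "clinear f" "x \<in> B" "a \<in> A\<^sub>0"
    and "\<And>\<alpha> p q. \<alpha> \<in> I \<Longrightarrow> p < n \<alpha> \<Longrightarrow> q < n \<alpha> \<Longrightarrow> f (u \<alpha> p q) = x \<alpha> p q"
  shows "W x a = f a"
  by (rule A0_eqI[OF W_clinear[OF assms(2)] assms(1,3)]) (simp add: W_u assms)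

lemma B_range: "x \<in> B \<Longrightarrow> x k i j \<noteq> 0 \<Longrightarrow> k \<in> I \<and> i < n k \<and> j < n k"
  by (simp add: mat_sum_def mat_prod_def)

lemma BB_range: "t \<in> BB \<Longrightarrow> t (k, l) (i, i') (j, j') \<noteq> 0 \<Longrightarrow>
    in_range k l i j i' j'"
  by (fastforce simp: mat_sum_def mat_prod_def ind_tensor_def)

lemma finite_J2: "finite (J2 kl)"
  by (cases kl) (simp add: ind_tensor_def)

lemma mat_unit_in_B: "k \<in> I \<Longrightarrow> i < n k \<Longrightarrow> j < n k \<Longrightarrow> mat_unit k i j \<in> B"
  unfolding mat_sum_def mat_prod_def mat_unit_def
  by (auto intro: finite_subset[of _ "{k}"] simp: fun_eq_iff split: if_splits)

lemma clinear_sum_fun: "(\<And>i. i \<in> K \<Longrightarrow> clinear (f i)) \<Longrightarrow> clinear (\<lambda>x. \<Sum>i\<in>K. f i x)"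
  for f :: "_ \<Rightarrow> 'a \<Rightarrow> complex"
  by (simp add: clinear_iff sum.distrib sum_distrib_left)

lemma clinear_scale_fun: "clinear f \<Longrightarrow> clinear (\<lambda>x. c * f x)"
  for f :: "'a \<Rightarrow> complex"
  by (simp add: clinear_iff algebra_simps)

lemma W_expand:
  assumes z: "z \<in> B" and a: "a \<in> A\<^sub>0"
  shows "W z a = (\<Sum>(k, i, j)\<in>{(k, i, j). z k i j \<noteq> 0}. z k i j * W (mat_unit k i j) a)"
proof (rule W_eqI[OF _ z a])
  let ?S = "{(k, i, j). z k i j \<noteq> 0}"
  have fin: "finite ?S" by (rule finite_mat_sum_supp[OF z]) simp
  have unit: "mat_unit k i j \<in> B" if "(k, i, j) \<in> ?S" for k i j
    using that z B_range by (intro mat_unit_in_B) auto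
  have eq: "(\<lambda>a. \<Sum>(k, i, j)\<in>?S. z k i j * W (mat_unit k i j) a) =
      (\<lambda>a. \<Sum>\<tau>\<in>?S. z (fst \<tau>) (fst (snd \<tau>)) (snd (snd \<tau>)) * W (mat_unit (fst \<tau>) (fst (snd \<tau>)) (snd (snd \<tau>))) a)"
    by (simp add: case_prod_beta)
  show "clinear (\<lambda>a. \<Sum>(k, i, j)\<in>?S. z k i j * W (mat_unit k i j) a)"
    unfolding eq using unit by (intro clinear_sum_fun clinear_scale_fun W_clinear) auto
  fix \<alpha> p q assume \<alpha>: "\<alpha> \<in> I" "p < n \<alpha>" "q < n \<alpha>"
  have "(\<Sum>(k, i, j)\<in>?S. z k i j * W (mat_unit k i j) (u \<alpha> p q)) =
      (\<Sum>\<tau>\<in>?S. if \<tau> = (\<alpha>, p, q) then z \<alpha> p q else 0)"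
    using unit \<alpha> by (intro sum.cong refl) (auto simp: W_u mat_unit_def split: if_splits)
  also have "\<dots> = z \<alpha> p q" using fin by simp
  finally show "(\<Sum>(k, i, j)\<in>?S. z k i j * W (mat_unit k i j) (u \<alpha> p q)) = z \<alpha> p q" .
qed

text \<open>The functional on the first leg that remains of t when the second leg is evaluated at
  \<open>u \<beta> d s\<close>.\<close>

definition slice_right where "slice_right t \<beta> d s = (\<lambda>k i j. t (k, \<beta>) (i, d) (j, s))"
definition slice_left where "slice_left t \<alpha> p c = (\<lambda>l i j. t (\<alpha>, l) (p, i) (c, j))"

lemma slice_right_in_B: "t \<in> BB \<Longrightarrow> slice_right t \<beta> d s \<in> B"
proof -
  assume t: "t \<in> BB"
  have "{k. slice_right t \<beta> d s k \<noteq> (\<lambda>i j. 0)} \<subseteq> fst ` {kl. t kl \<noteq> (\<lambda>i j. 0)}"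
    by (force simp: slice_right_def fun_eq_iff)
  moreover have "finite {kl. t kl \<noteq> (\<lambda>i j. 0)}" using t by (simp add: mat_sum_def)
  ultimately show ?thesis
    using BB_range[OF t] by (auto simp: mat_sum_def mat_prod_def slice_right_def intro: finite_subset)
qed

lemma slice_left_in_B: "t \<in> BB \<Longrightarrow> slice_left t \<alpha> p c \<in> B"
proof -
  assume t: "t \<in> BB"
  have "{k. slice_left t \<alpha> p c k \<noteq> (\<lambda>i j. 0)} \<subseteq> snd ` {kl. t kl \<noteq> (\<lambda>i j. 0)}"
    by (force simp: slice_left_def fun_eq_iff)
  moreover have "finite {kl. t kl \<noteq> (\<lambda>i j. 0)}" using t by (simp add: mat_sum_def)
  ultimately show ?thesis
    using BB_range[OF t] by (auto simp: mat_sum_def mat_prod_def slice_left_def intro: finite_subset)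
qed

text \<open>Common core of the right and the left version. \<open>\<phi> d\<close> embeds the
  coordinates of the d-th slice into those of t, and outside its range the d-th summand vanishes. So
  the sum over the support of t can be regrouped by slices, each of which \<open>W_expand\<close>
  reassembles into one functional.\<close>

lemma tensor_lift_slices:
  fixes N :: nat
  assumes t: "t \<in> BB" and y: "\<And>d. d < N \<Longrightarrow> y d \<in> A\<^sub>0" and z: "\<And>d. z d \<in> B"
    and inj: "\<And>d. inj (\<phi> d)"
    and z_eq: "\<And>d k i j. z d k i j = (case \<phi> d (k, i, j) of (kl, ii, jj) \<Rightarrow> t kl ii jj)"
    and f: "\<And>k l i i' j j'. in_range k l i j i' j' \<Longrightarrow>
      f (mat_unit k i j) (mat_unit l i' j') m a b = (\<Sum>d<N. G d ((k, l), (i, i'), (j, j')))"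
    and G: "\<And>d k i j. G d (\<phi> d (k, i, j)) = W (mat_unit k i j) (y d)"
    and G_zero: "\<And>d w. w \<notin> range (\<phi> d) \<Longrightarrow> G d w = 0"
  shows "tensor_lift f t m a b = (\<Sum>d<N. W (z d) (y d))"
proof -
  let ?T = "{(kl, ii, jj). t kl ii jj \<noteq> 0}"
  define F where "F d w = (case w of (kl, ii, jj) \<Rightarrow> t kl ii jj) * G d w" for d :: nat and w
  have fin: "finite ?T" by (rule finite_mat_sum_supp[OF t finite_J2])
  have "tensor_lift f t m a b = (\<Sum>w\<in>?T. \<Sum>d<N. F d w)"
    unfolding tensor_lift_def
  proof (rule sum.cong[OF refl])
    fix w assume w: "w \<in> ?T"
    obtain k l i i' j j' where w_eq: "w = ((k, l), (i, i'), (j, j'))" by (metis prod.exhaust)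
    then have "in_range k l i j i' j'"
      using BB_range[OF t] w by auto
    then show "(case w of (x, xa) \<Rightarrow> (case x of (k, l) \<Rightarrow> \<lambda>(ii, jj). (case ii of (i, i') \<Rightarrow> \<lambda>(j, j').
        t (k, l) (i, i') (j, j') * f (mat_unit k i j) (mat_unit l i' j') m a b) jj) xa) = (\<Sum>d<N. F d w)"
      by (simp add: w_eq f F_def sum_distrib_left)
  qed
  also have "\<dots> = (\<Sum>d<N. \<Sum>w\<in>?T. F d w)" by (rule sum.swap)
  also have "\<dots> = (\<Sum>d<N. W (z d) (y d))"
  proof (intro sum.cong refl)
    fix d assume d: "d \<in> {..<N}"
    let ?S = "{(k, i, j). z d k i j \<noteq> 0}"
    have mem: "\<phi> d x \<in> ?T \<longleftrightarrow> x \<in> ?S" for x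
    proof -
      obtain k i j where x: "x = (k, i, j)" by (metis prod.exhaust)
      obtain kl ii jj where "\<phi> d (k, i, j) = (kl, ii, jj)" by (metis prod.exhaust)
      then show ?thesis by (simp add: x z_eq)
    qed
    have "(\<Sum>w\<in>?T. F d w) = (\<Sum>w\<in>\<phi> d ` ?S. F d w)"
    proof (rule sum.mono_neutral_right[OF fin])
      show "\<phi> d ` ?S \<subseteq> ?T" by (rule image_subsetI) (rule mem[THEN iffD2])
      show "\<forall>w\<in>?T - \<phi> d ` ?S. F d w = 0"
      proof
        fix w assume w: "w \<in> ?T - \<phi> d ` ?S"
        have "w \<notin> range (\<phi> d)"
        proof
          assume "w \<in> range (\<phi> d)"
          then obtain x where x: "w = \<phi> d x" by (rule rangeE)
          have S: "x \<in> ?S" by (rule mem[THEN iffD1, OF DiffD1[OF w[unfolded x]]])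
          show False by (rule DiffD2[OF w[unfolded x] imageI[OF S]])
        qed
        then show "F d w = 0" by (simp add: F_def G_zero)
      qed
    qed
    also have "\<dots> = (\<Sum>x\<in>?S. F d (\<phi> d x))"
      by (rule sum.reindex_cong[of "\<phi> d"]) (auto intro: inj_on_subset[OF inj])
    also have "\<dots> = W (z d) (y d)"
    proof -
      have "F d (\<phi> d x) = (case x of (k, i, j) \<Rightarrow> z d k i j * W (mat_unit k i j) (y d))" for x
        by (cases x) (simp add: F_def G z_eq)
      then show ?thesis using d by (subst W_expand[OF z y]) simp_all
    qed
    finally show "(\<Sum>w\<in>?T. F d w) = W (z d) (y d)" .
  qed
  finally show ?thesis .
qed

lemma tensor_lift_right:
  fixes N :: nat
  assumes t: "t \<in> BB" and y: "\<And>d. d < N \<Longrightarrow> y d \<in> A\<^sub>0"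
    and f: "\<And>k l i i' j j'. in_range k l i j i' j' \<Longrightarrow>
      f (mat_unit k i j) (mat_unit l i' j') m a b =
      (\<Sum>d<N. if l = \<beta> \<and> i' = g d \<and> j' = s then W (mat_unit k i j) (y d) else 0)"
  shows "tensor_lift f t m a b = (\<Sum>d<N. W (slice_right t \<beta> (g d) s) (y d))"
  by (rule tensor_lift_slices[OF t y slice_right_in_B[OF t], where
        \<phi> = "\<lambda>d (k, i, j). ((k, \<beta>), (i, g d), (j, s))" and
        G = "\<lambda>d ((k, l), (i, i'), (j, j')). if l = \<beta> \<and> i' = g d \<and> j' = s then W (mat_unit k i j) (y d) else 0"])
    (auto simp: f slice_right_def inj_def image_iff split_paired_All)

lemma tensor_lift_left:
  fixes N :: nat
  assumes t: "t \<in> BB" and y: "\<And>c. c < N \<Longrightarrow> y c \<in> A\<^sub>0"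
    and f: "\<And>k l i i' j j'. in_range k l i j i' j' \<Longrightarrow>
      f (mat_unit k i j) (mat_unit l i' j') m a b =
      (\<Sum>c<N. if k = \<alpha> \<and> i = p \<and> j = g c then W (mat_unit l i' j') (y c) else 0)"
  shows "tensor_lift f t m a b = (\<Sum>c<N. W (slice_left t \<alpha> p (g c)) (y c))"
  by (rule tensor_lift_slices[OF t y slice_left_in_B[OF t], where
        \<phi> = "\<lambda>c (l, i, j). ((\<alpha>, l), (p, i), (g c, j))" and
        G = "\<lambda>c ((k, l), (i, i'), (j, j')). if k = \<alpha> \<and> i = p \<and> j = g c then W (mat_unit l i' j') (y c) else 0"])
    (auto simp: f slice_left_def inj_def image_iff split_paired_All)

text \<open>As a linear functional on \<open>A\<^sub>0 \<odot> A\<^sub>0\<close>, \<open>\<Phi>(x)(1 \<otimes> y)\<close> is \<open>x \<otimes> y\<close> composed with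
  \<open>a \<otimes> b \<mapsto> (a \<otimes> 1) \<Phi>(b)\<close>, whose inverse is \<open>a \<otimes> b \<mapsto> (a \<otimes> 1) (\<kappa> \<otimes> \<iota>) \<Phi>(b)\<close>. The operator
  \<open>right_op e\<close> is the first transposed map for \<open>e = u\<close>, and the second for \<open>e = \<kappa>(u)\<close>.\<close>

definition right_op where
  "right_op e t = (\<lambda>(\<alpha>, \<beta>) (p, r) (q, s).
     if in_range \<alpha> \<beta> p q r s then \<Sum>d<n \<beta>. W (slice_right t \<beta> d s) (u \<alpha> p q * e \<beta> r d) else 0)"

definition left_op where
  "left_op e t = (\<lambda>(\<alpha>, \<beta>) (p, r) (q, s).
     if in_range \<alpha> \<beta> p q r s then \<Sum>c<n \<alpha>. W (slice_left t \<alpha> p c) (e \<alpha> c q * u \<beta> r s) else 0)"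

definition A0_entries where
  "A0_entries e \<longleftrightarrow> (\<forall>\<alpha>\<in>I. \<forall>p<n \<alpha>. \<forall>q<n \<alpha>. e \<alpha> p q \<in> A\<^sub>0)"

definition \<kappa>u where "\<kappa>u \<alpha> p q = star (u \<alpha> q p)"

lemma A0_entries_u: "A0_entries u" and A0_entries_\<kappa>u: "A0_entries \<kappa>u"
  by (auto simp: A0_entries_def \<kappa>u_def u_in_A0 star_u_in_A0)

lemma W_zero: "a \<in> A\<^sub>0 \<Longrightarrow> W (\<lambda>k i j. 0) a = 0"
  by (rule W_eqI) (auto simp: clinear_iff mat_sum_def mat_prod_def)

lemma BB_I:
  assumes nz: "\<And>\<alpha> \<beta> p r q s. T (\<alpha>, \<beta>) (p, r) (q, s) \<noteq> 0 \<Longrightarrow> in_range \<alpha> \<beta> p q r s \<and> (\<alpha>, \<beta>) \<in> Z"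
    and Z: "finite Z"
  shows "T \<in> BB"
proof -
  have "{kl. T kl \<noteq> (\<lambda>i j. 0)} \<subseteq> Z"
    using nz by (fastforce simp: fun_eq_iff)
  then show ?thesis
    using nz finite_subset[OF _ Z] by (fastforce simp: mat_sum_def mat_prod_def ind_tensor_def)
qed

text \<open>The second block index is confined to the blocks of t, since other slices are 0. For
  each such \<beta> finitely many \<alpha> remain by \<open>D_fin_supp_right\<close>; here the
  equality of left and right functionals enters.\<close>

lemma right_op_in_BB:
  assumes t: "t \<in> BB" and e: "A0_entries e"
  shows "right_op e t \<in> BB"
proof -
  define F where "F = snd ` {kl. t kl \<noteq> (\<lambda>i j. 0)}"
  have F: "finite F" using t by (auto simp: F_def mat_sum_def)
  define Z where "Z \<beta> = (\<Union>d<n \<beta>. \<Union>r<n \<beta>. \<Union>s<n \<beta>.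
      {\<alpha> \<in> I. \<exists>p<n \<alpha>. \<exists>q<n \<alpha>. W (slice_right t \<beta> d s) (u \<alpha> p q * e \<beta> r d) \<noteq> 0})" for \<beta>
  have Z: "finite (Z \<beta>)" if "\<beta> \<in> I" for \<beta>
    using D_fin_supp_right[OF W_D[OF slice_right_in_B[OF t]]] e that
    by (auto simp: Z_def fin_supp_def A0_entries_def)
  show ?thesis
  proof (rule BB_I)
    show "finite (\<Union>\<beta>\<in>F \<inter> I. Z \<beta> \<times> {\<beta>})" using F Z by auto
    fix \<alpha> \<beta> p r q s assume nz: "right_op e t (\<alpha>, \<beta>) (p, r) (q, s) \<noteq> 0"
    then have rng: "\<alpha> \<in> I" "\<beta> \<in> I" "p < n \<alpha>" "q < n \<alpha>" "r < n \<beta>" "s < n \<beta>"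
      by (auto simp: right_op_def split: if_splits)
    with nz have "(\<Sum>d<n \<beta>. W (slice_right t \<beta> d s) (u \<alpha> p q * e \<beta> r d)) \<noteq> 0"
      by (simp add: right_op_def)
    then obtain d where d: "d < n \<beta>" "W (slice_right t \<beta> d s) (u \<alpha> p q * e \<beta> r d) \<noteq> 0"
      by (metis (no_types, lifting) lessThan_iff sum.neutral)
    have "\<alpha> \<in> Z \<beta>"
      using rng d unfolding Z_def UN_iff lessThan_iff Bex_def mem_Collect_eq by blast
    moreover have "\<beta> \<in> F"
    proof (rule ccontr)
      assume "\<beta> \<notin> F"
      then have "t (k, \<beta>) = (\<lambda>i j. 0)" for k by (force simp: F_def)
      then have "slice_right t \<beta> d s = (\<lambda>k i j. 0)" by (simp add: slice_right_def)
      then show False using d rng e by (simp add: W_zero A0_mult u_in_A0 A0_entries_def)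
    qed
    ultimately show "in_range \<alpha> \<beta> p q r s \<and> (\<alpha>, \<beta>) \<in> (\<Union>\<beta>\<in>F \<inter> I. Z \<beta> \<times> {\<beta>})"
      using rng by auto
  qed
qed

lemma left_op_in_BB:
  assumes t: "t \<in> BB" and e: "A0_entries e"
  shows "left_op e t \<in> BB"
proof -
  define F where "F = fst ` {kl. t kl \<noteq> (\<lambda>i j. 0)}"
  have F: "finite F" using t by (auto simp: F_def mat_sum_def)
  define Z where "Z \<alpha> = (\<Union>c<n \<alpha>. \<Union>p<n \<alpha>. \<Union>q<n \<alpha>.
      {\<beta> \<in> I. \<exists>r<n \<beta>. \<exists>s<n \<beta>. W (slice_left t \<alpha> p c) (e \<alpha> c q * u \<beta> r s) \<noteq> 0})" for \<alpha>
  have Z: "finite (Z \<alpha>)" if "\<alpha> \<in> I" for \<alpha>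
    using D_fin_supp_left[OF W_D[OF slice_left_in_B[OF t]]] e that
    by (auto simp: Z_def fin_supp_def A0_entries_def)
  show ?thesis
  proof (rule BB_I)
    show "finite (\<Union>\<alpha>\<in>F \<inter> I. {\<alpha>} \<times> Z \<alpha>)" using F Z by auto
    fix \<alpha> \<beta> p r q s assume nz: "left_op e t (\<alpha>, \<beta>) (p, r) (q, s) \<noteq> 0"
    then have rng: "\<alpha> \<in> I" "\<beta> \<in> I" "p < n \<alpha>" "q < n \<alpha>" "r < n \<beta>" "s < n \<beta>"
      by (auto simp: left_op_def split: if_splits)
    with nz have "(\<Sum>c<n \<alpha>. W (slice_left t \<alpha> p c) (e \<alpha> c q * u \<beta> r s)) \<noteq> 0"
      by (simp add: left_op_def)
    then obtain c where c: "c < n \<alpha>" "W (slice_left t \<alpha> p c) (e \<alpha> c q * u \<beta> r s) \<noteq> 0"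
      by (metis (no_types, lifting) lessThan_iff sum.neutral)
    have "\<beta> \<in> Z \<alpha>"
      using rng c unfolding Z_def UN_iff lessThan_iff Bex_def mem_Collect_eq by blast
    moreover have "\<alpha> \<in> F"
    proof (rule ccontr)
      assume "\<alpha> \<notin> F"
      then have "t (\<alpha>, l) = (\<lambda>i j. 0)" for l by (force simp: F_def)
      then have "slice_left t \<alpha> p c = (\<lambda>k i j. 0)" by (simp add: slice_left_def)
      then show False using c rng e by (simp add: W_zero A0_mult u_in_A0 A0_entries_def)
    qed
    ultimately show "in_range \<alpha> \<beta> p q r s \<and> (\<alpha>, \<beta>) \<in> (\<Union>\<alpha>\<in>F \<inter> I. {\<alpha>} \<times> Z \<alpha>)"
      using rng by auto
  qed
qed

text \<open>\<open>right_op\<close> prescribes the slices at basis elements only. By linearity the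
  formula holds at products too, which is what a second application needs.\<close>

lemma W_slice_right_op:
  assumes t: "t \<in> BB" and e: "A0_entries e" and rng: "\<beta> \<in> I" "r < n \<beta>" "s < n \<beta>" and a: "a \<in> A\<^sub>0"
  shows "W (slice_right (right_op e t) \<beta> r s) a = (\<Sum>d<n \<beta>. W (slice_right t \<beta> d s) (a * e \<beta> r d))"
proof (rule W_eqI[OF _ slice_right_in_B[OF right_op_in_BB[OF t e]] a])
  show "clinear (\<lambda>a. \<Sum>d<n \<beta>. W (slice_right t \<beta> d s) (a * e \<beta> r d))"
    by (intro clinear_sum_fun clinear_mult_right W_clinear slice_right_in_B t)
qed (simp add: slice_right_def right_op_def rng)

lemma W_slice_left_op:
  assumes t: "t \<in> BB" and e: "A0_entries e" and rng: "\<alpha> \<in> I" "p < n \<alpha>" "q < n \<alpha>" and a: "a \<in> A\<^sub>0"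
  shows "W (slice_left (left_op e t) \<alpha> p q) a = (\<Sum>c<n \<alpha>. W (slice_left t \<alpha> p c) (e \<alpha> c q * a))"
proof (rule W_eqI[OF _ slice_left_in_B[OF left_op_in_BB[OF t e]] a])
  show "clinear (\<lambda>a. \<Sum>c<n \<alpha>. W (slice_left t \<alpha> p c) (e \<alpha> c q * a))"
    by (intro clinear_sum_fun clinear_mult_left W_clinear slice_left_in_B t)
qed (simp add: slice_left_def left_op_def rng)

text \<open>A second application puts the entries of e' to the left of those of e, whence the order
  in \<open>inv\<close>. For \<open>left_op\<close> the new factor lands on the right.\<close>

lemma right_op_inverse:
  assumes t: "t \<in> BB" and e: "A0_entries e" "A0_entries e'"
    and inv: "\<And>\<beta> r c. \<beta> \<in> I \<Longrightarrow> r < n \<beta> \<Longrightarrow> c < n \<beta> \<Longrightarrow>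
      (\<Sum>d<n \<beta>. e' \<beta> r d * e \<beta> d c) = (if r = c then 1 else 0)"
  shows "right_op e' (right_op e t) = t"
proof -
  have "right_op e' (right_op e t) (\<alpha>, \<beta>) (p, r) (q, s) = t (\<alpha>, \<beta>) (p, r) (q, s)" for \<alpha> \<beta> p r q s
  proof (cases "in_range \<alpha> \<beta> p q r s")
    case True
    then have "right_op e' (right_op e t) (\<alpha>, \<beta>) (p, r) (q, s) =
        (\<Sum>d<n \<beta>. \<Sum>c<n \<beta>. W (slice_right t \<beta> c s) (u \<alpha> p q * e' \<beta> r d * e \<beta> d c))"
      using e(2) by (simp add: right_op_def[of e'])
        (auto intro!: sum.cong W_slice_right_op[OF t e(1)] A0_mult u_in_A0 simp: A0_entries_def)
    also have "\<dots> = (\<Sum>c<n \<beta>. W (slice_right t \<beta> c s) (u \<alpha> p q * (\<Sum>d<n \<beta>. e' \<beta> r d * e \<beta> d c)))"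
      by (subst sum.swap) (simp add: sum_distrib_left mult.assoc clinear_sum[OF W_clinear[OF slice_right_in_B[OF t]]])
    also have "\<dots> = (\<Sum>c<n \<beta>. if r = c then W (slice_right t \<beta> c s) (u \<alpha> p q) else 0)"
      using True by (intro sum.cong refl) (auto simp: inv clinear_zero[OF W_clinear[OF slice_right_in_B[OF t]]])
    also have "\<dots> = t (\<alpha>, \<beta>) (p, r) (q, s)"
      using True by (simp add: W_u slice_right_in_B[OF t]) (simp add: slice_right_def)
    finally show ?thesis .
  next
    case False
    then have "t (\<alpha>, \<beta>) (p, r) (q, s) = 0" using BB_range[OF t] by blast
    then show ?thesis using False by (auto simp: right_op_def[of e'])
  qed
  then show ?thesis by (auto simp: fun_eq_iff)
qed

lemma left_op_inverse:
  assumes t: "t \<in> BB" and e: "A0_entries e" "A0_entries e'"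
    and inv: "\<And>\<beta> r c. \<beta> \<in> I \<Longrightarrow> r < n \<beta> \<Longrightarrow> c < n \<beta> \<Longrightarrow>
      (\<Sum>d<n \<beta>. e \<beta> r d * e' \<beta> d c) = (if r = c then 1 else 0)"
  shows "left_op e' (left_op e t) = t"
proof -
  have "left_op e' (left_op e t) (\<alpha>, \<beta>) (p, r) (q, s) = t (\<alpha>, \<beta>) (p, r) (q, s)" for \<alpha> \<beta> p r q s
  proof (cases "in_range \<alpha> \<beta> p q r s")
    case True
    then have "left_op e' (left_op e t) (\<alpha>, \<beta>) (p, r) (q, s) =
        (\<Sum>c<n \<alpha>. \<Sum>d<n \<alpha>. W (slice_left t \<alpha> p d) (e \<alpha> d c * (e' \<alpha> c q * u \<beta> r s)))"
      using e(2) by (simp add: left_op_def[of e'])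
        (auto intro!: sum.cong W_slice_left_op[OF t e(1)] A0_mult u_in_A0 simp: A0_entries_def)
    also have "\<dots> = (\<Sum>d<n \<alpha>. W (slice_left t \<alpha> p d) ((\<Sum>c<n \<alpha>. e \<alpha> d c * e' \<alpha> c q) * u \<beta> r s))"
      by (subst sum.swap) (simp add: sum_distrib_right mult.assoc clinear_sum[OF W_clinear[OF slice_left_in_B[OF t]]])
    also have "\<dots> = (\<Sum>d<n \<alpha>. if d = q then W (slice_left t \<alpha> p d) (u \<beta> r s) else 0)"
      using True by (intro sum.cong refl) (auto simp: inv clinear_zero[OF W_clinear[OF slice_left_in_B[OF t]]])
    also have "\<dots> = t (\<alpha>, \<beta>) (p, r) (q, s)"
      using True by (simp add: W_u slice_left_in_B[OF t]) (simp add: slice_left_def)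
    finally show ?thesis .
  next
    case False
    then have "t (\<alpha>, \<beta>) (p, r) (q, s) = 0" using BB_range[OF t] by blast
    then show ?thesis using False by (auto simp: left_op_def[of e'])
  qed
  then show ?thesis by (auto simp: fun_eq_iff)
qed

lemma u_\<kappa>u:
  assumes "\<beta> \<in> I" "r < n \<beta>" "c < n \<beta>"
  shows "(\<Sum>d<n \<beta>. u \<beta> r d * \<kappa>u \<beta> d c) = (if r = c then 1 else 0)"
    and "(\<Sum>d<n \<beta>. \<kappa>u \<beta> r d * u \<beta> d c) = (if r = c then 1 else 0)"
  using rep_unitary_left[OF rep_u] rep_unitary_right[OF rep_u] assms by (simp_all add: \<kappa>u_def)

lemma right_op_bij: "bij_betw (right_op u) BB BB"
  by (rule bij_betw_byWitness[of _ "right_op \<kappa>u"])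
    (auto simp: right_op_inverse u_\<kappa>u A0_entries_u A0_entries_\<kappa>u right_op_in_BB)

lemma left_op_bij: "bij_betw (left_op u) BB BB"
  by (rule bij_betw_byWitness[of _ "left_op \<kappa>u"])
    (auto simp: left_op_inverse u_\<kappa>u A0_entries_u A0_entries_\<kappa>u left_op_in_BB)

subsection \<open>The comultiplication of the dual\<close>

lemma \<Delta>_index: "\<Delta> x (\<alpha>, \<beta>) (p, r) (q, s) =
    (if in_range \<alpha> \<beta> p q r s then W x (u \<alpha> p q * u \<beta> r s) else 0)"
  by (simp add: dual_coords2_def dual_comult_def)

lemma mult_one_right:
  assumes y: "y \<in> B"
  shows "mat_mult J2 (\<Delta> x) (mat_tensor eB y) (\<alpha>, \<beta>) (p, r) (q, s) =
    (if in_range \<alpha> \<beta> p q r s then \<Sum>d<n \<beta>. W x (u \<alpha> p q * u \<beta> r d) * y \<beta> d s else 0)"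
proof (cases "in_range \<alpha> \<beta> p q r s")
  case True
  have "mat_mult J2 (\<Delta> x) (mat_tensor eB y) (\<alpha>, \<beta>) (p, r) (q, s) =
      (\<Sum>c<n \<alpha>. if c = q then \<Sum>d<n \<beta>. W x (u \<alpha> p c * u \<beta> r d) * y \<beta> d s else 0)"
    unfolding mat_mult_ind_tensor
    by (intro sum.cong refl) (use True in \<open>auto simp: \<Delta>_index mat_tensor_def mat_one_def\<close>)
  then show ?thesis using True by simp
next
  case False
  have "y \<beta> d s = 0" if "\<not> (\<beta> \<in> I \<and> s < n \<beta>)" for d
    using that B_range[OF y] by blast
  then show ?thesis
    using False unfolding mat_mult_ind_tensor
    by (auto simp: \<Delta>_index mat_tensor_def mat_one_def intro!: sum.neutral)
qed

lemma mult_one_left: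
  assumes x: "x \<in> B"
  shows "mat_mult J2 (mat_tensor x eB) (\<Delta> y) (\<alpha>, \<beta>) (p, r) (q, s) =
    (if in_range \<alpha> \<beta> p q r s then \<Sum>c<n \<alpha>. x \<alpha> p c * W y (u \<alpha> c q * u \<beta> r s) else 0)"
proof (cases "in_range \<alpha> \<beta> p q r s")
  case True
  have "mat_mult J2 (mat_tensor x eB) (\<Delta> y) (\<alpha>, \<beta>) (p, r) (q, s) =
      (\<Sum>c<n \<alpha>. \<Sum>d<n \<beta>. if r = d then x \<alpha> p c * W y (u \<alpha> c q * u \<beta> d s) else 0)"
    unfolding mat_mult_ind_tensor
    by (intro sum.cong refl) (use True in \<open>auto simp: \<Delta>_index mat_tensor_def mat_one_def\<close>)
  then show ?thesis using True by simp
next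
  case False
  have "x \<alpha> p c = 0" if "\<not> (\<alpha> \<in> I \<and> p < n \<alpha>)" for c
    using that B_range[OF x] by blast
  then show ?thesis
    using False unfolding mat_mult_ind_tensor
    by (auto simp: \<Delta>_index mat_tensor_def mat_one_def intro!: sum.neutral)
qed

lemma mat_tensor_in_BB:
  assumes x: "x \<in> B" and y: "y \<in> B"
  shows "mat_tensor x y \<in> BB"
proof -
  have "{kl. mat_tensor x y kl \<noteq> (\<lambda>i j. 0)} \<subseteq> {k. x k \<noteq> (\<lambda>i j. 0)} \<times> {k. y k \<noteq> (\<lambda>i j. 0)}"
    by (auto simp: mat_tensor_def fun_eq_iff; blast)
  moreover have "finite ({k. x k \<noteq> (\<lambda>i j. 0)} \<times> {k. y k \<noteq> (\<lambda>i j. 0)})"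
    using x y by (auto simp: mat_sum_def)
  ultimately show ?thesis
    using B_range[OF x] B_range[OF y]
    by (auto simp: mat_sum_def mat_prod_def mat_tensor_def ind_tensor_def intro: finite_subset)
qed

lemma W_slice_right_tensor:
  assumes "x \<in> B" "y \<in> B" "a \<in> A\<^sub>0"
  shows "W (slice_right (mat_tensor x y) \<beta> d s) a = W x a * y \<beta> d s"
proof -
  have "W (slice_right (mat_tensor x y) \<beta> d s) a = y \<beta> d s * W x a"
    by (rule W_eqI[OF clinear_scale_fun[OF W_clinear]])
      (simp_all add: assms slice_right_in_B mat_tensor_in_BB W_u,
       simp add: slice_right_def mat_tensor_def)
  then show ?thesis by simp
qed

lemma W_slice_left_tensor:
  assumes "x \<in> B" "y \<in> B" "a \<in> A\<^sub>0"
  shows "W (slice_left (mat_tensor x y) \<alpha> p c) a = x \<alpha> p c * W y a"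
  by (rule W_eqI[OF clinear_scale_fun[OF W_clinear]])
    (simp_all add: assms slice_left_in_B mat_tensor_in_BB W_u,
     simp add: slice_left_def mat_tensor_def)

lemma mult_one_right_eq:
  assumes "x \<in> B" "y \<in> B"
  shows "mat_mult J2 (\<Delta> x) (mat_tensor eB y) = right_op u (mat_tensor x y)"
proof -
  have "mat_mult J2 (\<Delta> x) (mat_tensor eB y) (\<alpha>, \<beta>) (p, r) (q, s) =
      right_op u (mat_tensor x y) (\<alpha>, \<beta>) (p, r) (q, s)" for \<alpha> \<beta> p r q s
    unfolding mult_one_right[OF assms(2)] right_op_def
    by (auto intro!: sum.cong simp: W_slice_right_tensor assms A0_mult u_in_A0)
  then show ?thesis by (auto simp: fun_eq_iff)
qed

lemma mult_one_left_eq: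
  assumes "x \<in> B" "y \<in> B"
  shows "mat_mult J2 (mat_tensor x eB) (\<Delta> y) = left_op u (mat_tensor x y)"
proof -
  have "mat_mult J2 (mat_tensor x eB) (\<Delta> y) (\<alpha>, \<beta>) (p, r) (q, s) =
      left_op u (mat_tensor x y) (\<alpha>, \<beta>) (p, r) (q, s)" for \<alpha> \<beta> p r q s
    unfolding mult_one_left[OF assms(1)] left_op_def
    by (auto intro!: sum.cong simp: W_slice_left_tensor assms A0_mult u_in_A0)
  then show ?thesis by (auto simp: fun_eq_iff)
qed

lemma tensor_lift_zero:
  assumes t: "t \<in> BB"
    and f: "\<And>k l i i' j j'. in_range k l i j i' j' \<Longrightarrow>
      f (mat_unit k i j) (mat_unit l i' j') m a b = 0"
  shows "tensor_lift f t m a b = 0"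
  \<comment> \<open>The empty sum of slices; the values of \<beta>, g and s are arbitrary.\<close>
  using tensor_lift_right[OF t, where N = "0 :: nat" and y = "\<lambda>_. 0" and f = f and m = m and a = a and b = b
      and \<beta> = undefined and g = "\<lambda>_. 0" and s = 0] f by simp

text \<open>Identifies the first canonical map with \<open>right_op u\<close>, so that its
  bijectivity is the existence of the inverse \<open>right_op \<kappa>u\<close>.\<close>

lemma tensor_lift_mult_right:
  assumes t: "t \<in> BB"
  shows "tensor_lift (\<lambda>x y. mat_mult J2 (\<Delta> x) (mat_tensor eB y)) t = right_op u t"
proof -
  have "tensor_lift (\<lambda>x y. mat_mult J2 (\<Delta> x) (mat_tensor eB y)) t (\<alpha>, \<beta>) (p, r) (q, s) =
      right_op u t (\<alpha>, \<beta>) (p, r) (q, s)" for \<alpha> \<beta> p r q s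
  proof (cases "in_range \<alpha> \<beta> p q r s")
    case True
    then have "tensor_lift (\<lambda>x y. mat_mult J2 (\<Delta> x) (mat_tensor eB y)) t (\<alpha>, \<beta>) (p, r) (q, s) =
        (\<Sum>d<n \<beta>. W (slice_right t \<beta> d s) (u \<alpha> p q * u \<beta> r d))"
      by (intro tensor_lift_right[OF t])
        (auto simp: mult_one_right mat_unit_in_B A0_mult u_in_A0 mat_unit_index intro!: sum.cong)
    then show ?thesis using True by (simp add: right_op_def)
  next
    case False
    then have "right_op u t (\<alpha>, \<beta>) (p, r) (q, s) = 0" by (auto simp: right_op_def)
    moreover have "tensor_lift (\<lambda>x y. mat_mult J2 (\<Delta> x) (mat_tensor eB y)) t (\<alpha>, \<beta>) (p, r) (q, s) = 0"
      by (rule tensor_lift_zero[OF t]) (use False in \<open>auto simp: mult_one_right mat_unit_in_B\<close>)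
    ultimately show ?thesis by simp
  qed
  then show ?thesis by (auto simp: fun_eq_iff)
qed

lemma tensor_lift_mult_left:
  assumes t: "t \<in> BB"
  shows "tensor_lift (\<lambda>x y. mat_mult J2 (mat_tensor x eB) (\<Delta> y)) t = left_op u t"
proof -
  have "tensor_lift (\<lambda>x y. mat_mult J2 (mat_tensor x eB) (\<Delta> y)) t (\<alpha>, \<beta>) (p, r) (q, s) =
      left_op u t (\<alpha>, \<beta>) (p, r) (q, s)" for \<alpha> \<beta> p r q s
  proof (cases "in_range \<alpha> \<beta> p q r s")
    case True
    then have "tensor_lift (\<lambda>x y. mat_mult J2 (mat_tensor x eB) (\<Delta> y)) t (\<alpha>, \<beta>) (p, r) (q, s) =
        (\<Sum>c<n \<alpha>. W (slice_left t \<alpha> p c) (u \<alpha> c q * u \<beta> r s))"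
      by (intro tensor_lift_left[OF t])
        (auto simp: mult_one_left mat_unit_in_B A0_mult u_in_A0 mat_unit_index intro!: sum.cong)
    then show ?thesis using True by (simp add: left_op_def)
  next
    case False
    then have "left_op u t (\<alpha>, \<beta>) (p, r) (q, s) = 0" by (auto simp: left_op_def)
    moreover have "tensor_lift (\<lambda>x y. mat_mult J2 (mat_tensor x eB) (\<Delta> y)) t (\<alpha>, \<beta>) (p, r) (q, s) = 0"
      by (rule tensor_lift_zero[OF t]) (use False in \<open>auto simp: mult_one_left mat_unit_in_B\<close>)
    ultimately show ?thesis by simp
  qed
  then show ?thesis by (auto simp: fun_eq_iff)
qed

text \<open>A single slice is involved. For \<gamma>, v, w out of range it is 0, so the case
  distinction concerns only the legs produced by \<open>\<Delta>\<close>.\<close>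

lemma tensor_lift_\<Delta>_left:
  assumes t: "t \<in> BB"
  shows "tensor_lift (\<lambda>a b. mat_assoc (mat_tensor (\<Delta> a) b)) t (\<alpha>, \<beta>, \<gamma>) (p, r, v) (q, s, w) =
    (if in_range \<alpha> \<beta> p q r s then W (slice_right t \<gamma> v w) (u \<alpha> p q * u \<beta> r s) else 0)"
proof (cases "in_range \<alpha> \<beta> p q r s")
  case True
  have "tensor_lift (\<lambda>a b. mat_assoc (mat_tensor (\<Delta> a) b)) t (\<alpha>, \<beta>, \<gamma>) (p, r, v) (q, s, w) =
      (\<Sum>d<Suc 0. W (slice_right t \<gamma> ((\<lambda>_. v) d) w) (u \<alpha> p q * u \<beta> r s))"
    by (rule tensor_lift_right[OF t])
      (use True in \<open>auto simp: A0_mult u_in_A0 mat_assoc_def mat_tensor_def \<Delta>_index mat_unit_def\<close>)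
  then show ?thesis using True by simp
next
  case False
  have "tensor_lift (\<lambda>a b. mat_assoc (mat_tensor (\<Delta> a) b)) t (\<alpha>, \<beta>, \<gamma>) (p, r, v) (q, s, w) = 0"
    by (rule tensor_lift_zero[OF t]) (use False in \<open>auto simp: mat_assoc_def mat_tensor_def \<Delta>_index\<close>)
  then show ?thesis using False by auto
qed

lemma tensor_lift_\<Delta>_right:
  assumes t: "t \<in> BB"
  shows "tensor_lift (\<lambda>a b. mat_tensor a (\<Delta> b)) t (\<alpha>, \<beta>, \<gamma>) (p, r, v) (q, s, w) =
    (if \<beta> \<in> I \<and> \<gamma> \<in> I \<and> r < n \<beta> \<and> s < n \<beta> \<and> v < n \<gamma> \<and> w < n \<gamma>
     then W (slice_left t \<alpha> p q) (u \<beta> r s * u \<gamma> v w) else 0)"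
proof (cases "\<beta> \<in> I \<and> \<gamma> \<in> I \<and> r < n \<beta> \<and> s < n \<beta> \<and> v < n \<gamma> \<and> w < n \<gamma>")
  case True
  have "tensor_lift (\<lambda>a b. mat_tensor a (\<Delta> b)) t (\<alpha>, \<beta>, \<gamma>) (p, r, v) (q, s, w) =
      (\<Sum>c<Suc 0. W (slice_left t \<alpha> p ((\<lambda>_. q) c)) (u \<beta> r s * u \<gamma> v w))"
    by (rule tensor_lift_left[OF t])
      (use True in \<open>auto simp: A0_mult u_in_A0 mat_tensor_def \<Delta>_index mat_unit_def\<close>)
  then show ?thesis using True by simp
next
  case False
  have "tensor_lift (\<lambda>a b. mat_tensor a (\<Delta> b)) t (\<alpha>, \<beta>, \<gamma>) (p, r, v) (q, s, w) = 0"
    by (rule tensor_lift_zero[OF t]) (use False in \<open>auto simp: mat_tensor_def \<Delta>_index\<close>)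
  then show ?thesis using False by auto
qed

section \<open>The axioms of a discrete quantum group\<close>

lemma \<Delta>_in_MBB: "\<Delta> x \<in> mat_prod (I \<times> I) J2"
  by (auto simp: mat_prod_def \<Delta>_index ind_tensor_def split: if_splits)

lemma \<Delta>_add:
  assumes "x \<in> B" "y \<in> B"
  shows "\<Delta> (mat_add x y) = mat_add (\<Delta> x) (\<Delta> y)"
proof -
  have "W (mat_add x y) = (\<lambda>a. W x a + W y a)"
    using W_coords_D[OF D_add[OF W_D[OF assms(1)] W_D[OF assms(2)]]] by (simp add: coords_add W_coords assms)
  then show ?thesis by (auto simp: fun_eq_iff \<Delta>_index mat_add_def)
qed

lemma \<Delta>_scale:
  assumes "x \<in> B"
  shows "\<Delta> (mat_scale c x) = mat_scale c (\<Delta> x)"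
proof -
  have "W (mat_scale c x) = (\<lambda>a. c * W x a)"
    using W_coords_D[OF D_scale[OF W_D[OF assms]]] by (simp add: coords_scale W_coords assms)
  then show ?thesis by (auto simp: fun_eq_iff \<Delta>_index mat_scale_def)
qed

text \<open>A product of two matrix elements is a matrix element of the tensor product
  representation, where \<open>dual_mult_rep\<close> evaluates the convolution product.\<close>

lemma \<Delta>_mult:
  assumes "x \<in> B" "y \<in> B"
  shows "\<Delta> (mat_mult J x y) = mat_mult J2 (\<Delta> x) (\<Delta> y)"
proof -
  note D = W_D[OF assms(1)] W_D[OF assms(2)]
  have W: "W (mat_mult J x y) = dual_mult ten \<Phi> (W x) (W y)"
    using W_coords_D[OF dual_mult_D[OF D]] by (simp add: coords_dual_mult D W_coords assms)
  have "\<Delta> (mat_mult J x y) (\<alpha>, \<beta>) (p, r) (q, s) = mat_mult J2 (\<Delta> x) (\<Delta> y) (\<alpha>, \<beta>) (p, r) (q, s)"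
    for \<alpha> \<beta> p r q s
  proof (cases "in_range \<alpha> \<beta> p q r s")
    case True
    let ?v = "tensor_rep (n \<beta>) (u \<alpha>) (u \<beta>)"
    let ?P = "p * n \<beta> + r" and ?Q = "q * n \<beta> + s"
    have rep: "rep (n \<alpha> * n \<beta>) ?v" using True by (intro rep_tensor_rep rep_u) auto
    have PQ: "?P < n \<alpha> * n \<beta>" "?Q < n \<alpha> * n \<beta>" "?v ?P ?Q = u \<alpha> p q * u \<beta> r s"
      using True by (auto simp: tensor_rep_entry)
    have "W (mat_mult J x y) (u \<alpha> p q * u \<beta> r s) = (\<Sum>k<n \<alpha> * n \<beta>. W x (?v ?P k) * W y (?v k ?Q))"
      unfolding W PQ(3)[symmetric] by (rule dual_mult_rep[OF D rep PQ(1,2)])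
    also have "\<dots> = (\<Sum>k<n \<alpha> * n \<beta>. W x (u \<alpha> p (k div n \<beta>) * u \<beta> r (k mod n \<beta>)) *
        W y (u \<alpha> (k div n \<beta>) q * u \<beta> (k mod n \<beta>) s))"
      using True by (simp add: tensor_rep_def)
    also have "\<dots> = (\<Sum>c<n \<alpha>. \<Sum>d<n \<beta>. W x (u \<alpha> p c * u \<beta> r d) * W y (u \<alpha> c q * u \<beta> d s))"
      by (rule sum_lessThan_mult_div_mod)
    finally show ?thesis
      using True by (simp add: \<Delta>_index mat_mult_ind_tensor)
  next
    case False
    then show ?thesis by (auto simp: \<Delta>_index mat_mult_ind_tensor)
  qed
  then show ?thesis by (auto simp: fun_eq_iff)
qed

text \<open>Applying \<open>dual_star_rep\<close> to the tensor product representation takes the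
  place of the antimultiplicativity of the antipode.\<close>

lemma \<Delta>_star:
  assumes \<kappa>: "antipode ten \<Phi> \<kappa>" and x: "x \<in> B"
  shows "\<Delta> (mat_star x) = mat_star (\<Delta> x)"
proof -
  note D = W_D[OF x]
  have W: "W (mat_star x) = dual_star ten \<Phi> h \<kappa> (W x)"
    using W_coords_D[OF dual_star_props(1)[OF \<kappa> D]] by (simp add: coords_dual_star[OF \<kappa> D] W_coords x)
  have "\<Delta> (mat_star x) (\<alpha>, \<beta>) (p, r) (q, s) = mat_star (\<Delta> x) (\<alpha>, \<beta>) (p, r) (q, s)" for \<alpha> \<beta> p r q s
  proof (cases "in_range \<alpha> \<beta> p q r s")
    case True
    let ?v = "tensor_rep (n \<beta>) (u \<alpha>) (u \<beta>)"
    let ?P = "p * n \<beta> + r" and ?Q = "q * n \<beta> + s"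
    have rep: "rep (n \<alpha> * n \<beta>) ?v" using True by (intro rep_tensor_rep rep_u) auto
    have PQ: "?P < n \<alpha> * n \<beta>" "?Q < n \<alpha> * n \<beta>" "?v ?P ?Q = u \<alpha> p q * u \<beta> r s"
      "?v ?Q ?P = u \<alpha> q p * u \<beta> s r"
      using True by (auto simp: tensor_rep_entry)
    have "W (mat_star x) (u \<alpha> p q * u \<beta> r s) = cnj (W x (u \<alpha> q p * u \<beta> s r))"
      using dual_star_rep[OF \<kappa> D rep PQ(1,2)] by (simp only: W PQ(3,4))
    then show ?thesis using True by (simp add: \<Delta>_index mat_star_def)
  next
    case False
    then show ?thesis by (auto simp: \<Delta>_index mat_star_def)
  qed
  then show ?thesis by (auto simp: fun_eq_iff)
qed

lemma mat_mult_J3: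
  "mat_mult J3 x y (\<alpha>, \<beta>, \<gamma>) i j = (\<Sum>c<n \<alpha>. \<Sum>c'<n \<beta>. \<Sum>c''<n \<gamma>.
     x (\<alpha>, \<beta>, \<gamma>) i (c, c', c'') * y (\<alpha>, \<beta>, \<gamma>) (c, c', c'') j)"
  by (simp add: mat_mult_def ind_tensor_def sum.cartesian_product')

text \<open>Dual to associativity in A: both sides equal the sum over c and d of \<open>x \<alpha> p
  c * (W y (u \<alpha> c q * u \<beta> r s * u \<gamma> v d) * z \<gamma> d w)\<close>.\<close>

lemma \<Delta>_coassociative:
  assumes x: "x \<in> B" and y: "y \<in> B" and z: "z \<in> B"
  shows "mat_mult J3 (mat_tensor x eBB)
      (tensor_lift (\<lambda>a b. mat_assoc (mat_tensor (\<Delta> a) b)) (mat_mult J2 (\<Delta> y) (mat_tensor eB z))) =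
    mat_mult J3 (tensor_lift (\<lambda>a b. mat_tensor a (\<Delta> b)) (mat_mult J2 (mat_tensor x eB) (\<Delta> y)))
      (mat_tensor eB (mat_tensor eB z))"
proof -
  define T1 where "T1 = tensor_lift (\<lambda>a b. mat_assoc (mat_tensor (\<Delta> a) b)) (right_op u (mat_tensor y z))"
  define T2 where "T2 = tensor_lift (\<lambda>a b. mat_tensor a (\<Delta> b)) (left_op u (mat_tensor x y))"
  note yz = mat_tensor_in_BB[OF y z] and xy = mat_tensor_in_BB[OF x y]
  note ops = right_op_in_BB[OF yz A0_entries_u] left_op_in_BB[OF xy A0_entries_u]
  have "mat_mult J3 (mat_tensor x eBB) T1 (\<alpha>, \<beta>, \<gamma>) (p, r, v) (q, s, w) =
      mat_mult J3 T2 (mat_tensor eB (mat_tensor eB z)) (\<alpha>, \<beta>, \<gamma>) (p, r, v) (q, s, w)"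
    for \<alpha> \<beta> \<gamma> p r v q s w
  proof -
    let ?left = "mat_mult J3 (mat_tensor x eBB) T1 (\<alpha>, \<beta>, \<gamma>) (p, r, v) (q, s, w)"
    let ?right = "mat_mult J3 T2 (mat_tensor eB (mat_tensor eB z)) (\<alpha>, \<beta>, \<gamma>) (p, r, v) (q, s, w)"
    have left: "?left = (\<Sum>c<n \<alpha>. \<Sum>c'<n \<beta>. \<Sum>c''<n \<gamma>.
        x \<alpha> p c * eBB (\<beta>, \<gamma>) (r, v) (c', c'') * T1 (\<alpha>, \<beta>, \<gamma>) (c, c', c'') (q, s, w))"
      by (simp add: mat_mult_J3 mat_tensor_def)
    have right: "?right = (\<Sum>c<n \<alpha>. \<Sum>c'<n \<beta>. \<Sum>c''<n \<gamma>.
        T2 (\<alpha>, \<beta>, \<gamma>) (p, r, v) (c, c', c'') * (eB \<alpha> c q * (eB \<beta> c' s * z \<gamma> c'' w)))"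
      by (simp add: mat_mult_J3 mat_tensor_def)
    show "?left = ?right"
    proof (cases "\<alpha> \<in> I \<and> \<beta> \<in> I \<and> \<gamma> \<in> I \<and> p < n \<alpha> \<and> q < n \<alpha> \<and> r < n \<beta> \<and> s < n \<beta> \<and> v < n \<gamma> \<and> w < n \<gamma>")
      case True
      have "?left = (\<Sum>c<n \<alpha>. \<Sum>c'<n \<beta>. \<Sum>c''<n \<gamma>. if v = c'' then if r = c' then
          x \<alpha> p c * T1 (\<alpha>, \<beta>, \<gamma>) (c, c', c'') (q, s, w) else 0 else 0)"
        unfolding left using True
        by (intro sum.cong refl) (auto simp: mat_one_def ind_tensor_def)
      also have "\<dots> = (\<Sum>c<n \<alpha>. x \<alpha> p c * T1 (\<alpha>, \<beta>, \<gamma>) (c, r, v) (q, s, w))"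
        using True by simp
      also have "\<dots> = (\<Sum>c<n \<alpha>. \<Sum>d<n \<gamma>. x \<alpha> p c * (W y (u \<alpha> c q * u \<beta> r s * u \<gamma> v d) * z \<gamma> d w))"
        using True by (intro sum.cong refl) (simp add: T1_def tensor_lift_\<Delta>_left[OF ops(1)]
            W_slice_right_op[OF yz A0_entries_u] W_slice_right_tensor[OF y z] A0_mult u_in_A0 sum_distrib_left)
      finally have l: "?left = \<dots>" .
      have sum_if: "(\<Sum>k\<in>K. if P then f k else 0) = (if P then \<Sum>k\<in>K. f k else 0)"
        for P and f :: "nat \<Rightarrow> complex" and K by simp
      have "?right = (\<Sum>c<n \<alpha>. \<Sum>c'<n \<beta>. \<Sum>c''<n \<gamma>. if c = q then if c' = s then
          T2 (\<alpha>, \<beta>, \<gamma>) (p, r, v) (c, c', c'') * z \<gamma> c'' w else 0 else 0)"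
        unfolding right using True
        by (intro sum.cong refl) (auto simp: mat_one_def)
      also have "\<dots> = (\<Sum>d<n \<gamma>. T2 (\<alpha>, \<beta>, \<gamma>) (p, r, v) (q, s, d) * z \<gamma> d w)"
        using True by (simp add: sum_if)
      also have "\<dots> = (\<Sum>d<n \<gamma>. \<Sum>c<n \<alpha>. x \<alpha> p c * (W y (u \<alpha> c q * u \<beta> r s * u \<gamma> v d) * z \<gamma> d w))"
        using True by (intro sum.cong refl) (simp add: T2_def tensor_lift_\<Delta>_right[OF ops(2)]
            W_slice_left_op[OF xy A0_entries_u] W_slice_left_tensor[OF x y] A0_mult u_in_A0 sum_distrib_right mult.assoc)
      also have "\<dots> = ?left" unfolding l by (rule sum.swap)
      finally show ?thesis ..
    next
      case False
      \<comment> \<open>Outside the index range one of x, z, the unit matrices and the lifted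
        tensors vanishes in every summand, so both sides are 0.\<close>
      have x0: "x \<alpha> p c = 0" if "\<not> (\<alpha> \<in> I \<and> p < n \<alpha>)" for c using that B_range[OF x] by blast
      have z0: "z \<gamma> c w = 0" if "\<not> (\<gamma> \<in> I \<and> w < n \<gamma>)" for c using that B_range[OF z] by blast
      have T1_zero: "T1 (\<alpha>, \<beta>, \<gamma>) (c, c', c'') (q, s, w) = 0" if "\<not> (\<alpha> \<in> I \<and> \<beta> \<in> I \<and> q < n \<alpha> \<and> s < n \<beta> \<and> \<gamma> \<in> I \<and> w < n \<gamma>)"
        for c c' c''
      proof -
        have "slice_right (right_op u (mat_tensor y z)) \<gamma> c'' w = (\<lambda>k i j. 0)" if "\<not> (\<gamma> \<in> I \<and> w < n \<gamma>)"
          using that by (auto simp: slice_right_def right_op_def)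
        then show ?thesis
          using that by (auto simp: T1_def tensor_lift_\<Delta>_left[OF ops(1)] W_zero A0_mult u_in_A0)
      qed
      have T2_zero: "T2 (\<alpha>, \<beta>, \<gamma>) (p, r, v) (c, c', c'') = 0" if "\<not> (\<alpha> \<in> I \<and> p < n \<alpha> \<and> \<beta> \<in> I \<and> r < n \<beta> \<and> \<gamma> \<in> I \<and> v < n \<gamma>)"
        for c c' c''
      proof -
        have "slice_left (left_op u (mat_tensor x y)) \<alpha> p c = (\<lambda>k i j. 0)" if "\<not> (\<alpha> \<in> I \<and> p < n \<alpha>)"
          using that by (auto simp: slice_left_def left_op_def)
        then show ?thesis
          using that by (auto simp: T2_def tensor_lift_\<Delta>_right[OF ops(2)] W_zero A0_mult u_in_A0)
      qed
      have "?left = 0"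
        unfolding left using False x0 T1_zero
        by (intro sum.neutral ballI) (auto simp: mat_one_def ind_tensor_def)
      moreover have "?right = 0"
        unfolding right using False z0 T2_zero
        by (intro sum.neutral ballI) (auto simp: mat_one_def)
      ultimately show ?thesis by simp
    qed
  qed
  then show ?thesis
    unfolding mult_one_right_eq[OF y z] mult_one_left_eq[OF x y] T1_def T2_def
    by (auto simp: fun_eq_iff)
qed

theorem dual_discrete_quantum_group:
  assumes "antipode ten \<Phi> \<kappa>"
  shows "discrete_quantum_group I n \<Delta>"
proof -
  have "bij_betw (tensor_lift (\<lambda>x y. mat_mult J2 (\<Delta> x) (mat_tensor eB y))) BB BB"
    using bij_betw_cong[THEN iffD2, OF tensor_lift_mult_right right_op_bij] .
  moreover have "bij_betw (tensor_lift (\<lambda>x y. mat_mult J2 (mat_tensor x eB) (\<Delta> y))) BB BB"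
    using bij_betw_cong[THEN iffD2, OF tensor_lift_mult_left left_op_bij] .
  moreover have "mat_mult J2 (\<Delta> x) (mat_tensor eB y) \<in> BB" "mat_mult J2 (mat_tensor x eB) (\<Delta> y) \<in> BB"
    if "x \<in> B" "y \<in> B" for x y
    using that by (simp_all only: mult_one_right_eq mult_one_left_eq right_op_in_BB left_op_in_BB
        mat_tensor_in_BB A0_entries_u)
  ultimately show ?thesis
    unfolding discrete_quantum_group_def Let_def
    by (intro conjI ballI allI n_pos \<Delta>_in_MBB \<Delta>_add \<Delta>_scale \<Delta>_mult \<Delta>_star[OF assms]
        \<Delta>_coassociative)
qed

end

theorem mainTheorem9:
  fixes ten :: "'a::unital_cstar_algebra \<Rightarrow> 'a \<Rightarrow> 't::unital_cstar_algebra"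
    and tenl :: "'t \<Rightarrow> 'a \<Rightarrow> 'w::unital_cstar_algebra"
    and tenr :: "'a \<Rightarrow> 't \<Rightarrow> 'w"
    and \<Phi> :: "'a \<Rightarrow> 't" and h :: "'a \<Rightarrow> complex" and \<kappa> :: "'a \<Rightarrow> 'a"
    and I :: "'i set" and n :: "'i \<Rightarrow> nat" and u :: "'i \<Rightarrow> nat \<Rightarrow> nat \<Rightarrow> 'a"
  assumes "compact_quantum_group ten tenl tenr \<Phi>"
    and "haar_measure ten \<Phi> h"
    and "antipode ten \<Phi> \<kappa>"
    and "complete_irreps ten \<Phi> I n u"
  shows "star_isomorphism (dual_space ten \<Phi> h) (dual_mult ten \<Phi>) (dual_star ten \<Phi> h \<kappa>)
           I n (dual_coords I n u) \<and>
    discrete_quantum_group I n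
      (\<lambda>x. dual_coords2 I n u
             (dual_comult (inv_into (dual_space ten \<Phi> h) (dual_coords I n u) x)))"
proof -
  obtain L R where "is_tensor_map ten (\<lambda>a z. z *\<^sub>C a) id h L" "is_tensor_map ten (\<lambda>z a. z *\<^sub>C a) h id R"
    "\<And>a. L (\<Phi> a) = h a *\<^sub>C 1" "\<And>a. R (\<Phi> a) = h a *\<^sub>C 1"
    using assms(2) by (auto simp: haar_measure_def)
  then interpret haar_quantum_group_irreps ten \<Phi> h L R I n u
    using assms
    by unfold_locales (auto simp: compact_quantum_group_def min_tensor_powers_def comultiplication_def
        haar_measure_def)
  show ?thesis
    using dual_star_isomorphism[OF assms(3)] dual_discrete_quantum_group[OF assms(3)] by blast
qed

end
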